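(* Suppose assumptions (A1)–(A5) of the context hold, and fix $\mu\ge\hat\mu$. If the parameters $\eta_1,\eta_2>0$ and $\delta_{\mu,b}$ satisfy $$\eta_1\ge\frac{9}{\eta_2\gamma_G},\qquad\eta_2\le\frac{\gamma_H}{7\hat\Upsilon^2},\qquad\delta_{\mu,b}\le\frac{\eta_2\gamma_G}{17\,\eta_1\hat\Upsilon^2},$$ then at every iteration $\tau\ge0$ (index $\tau$ suppressed) $$\begin{bmatrix}\nabla_{\boldsymbol x}\mathcal L_\eta \\ \nabla_{\boldsymbol\lambda}\mathcal L_\eta\end{bmatrix}^T\begin{bmatrix}\tilde\Delta\boldsymbol x \\ \tilde\Delta\boldsymbol\lambda\end{bmatrix}\ \le\ -\frac{\eta_2}{8}\left\|\begin{bmatrix}\nabla_{\boldsymbol x}\mathcal L \\ \nabla_{\boldsymbol\lambda}\mathcal L\end{bmatrix}\right\|^2-\frac{\eta_2\gamma_G}{16}\left\|\begin{bmatrix}\Delta\boldsymbol x \\ \Delta\boldsymbol\lambda\end{bmatrix}\right\|^2 .$$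
   Context: Graph notation. $\mathcal G=(\mathcal V,\mathcal E)$ is a finite undirected graph with strictly ordered node set; $d_{\mathcal G}(i,j)$ is the number of edges of a shortest path between $i$ and $j$, and $d_{\mathcal G}(i,\mathcal W)$ is the distance from $i$ to the set $\mathcal W$. $N^b_{\mathcal G}[\mathcal W]=\{i\in\mathcal V:d_{\mathcal G}(i,\mathcal W)\le b\}$, $N_{\mathcal G}[\mathcal W]=N^1_{\mathcal G}[\mathcal W]$, $N_{\mathcal G}(\mathcal W)=N_{\mathcal G}[\mathcal W]\setminus\mathcal W$, $N_{\mathcal G}[i]=N_{\mathcal G}[\{i\}]$, $[M]=\{1,\dots,M\}$. Problem. The graph-structured nonlinear program is $\min\sum_{i\in\mathcal V}f_i(\{\boldsymbol x_j\}_{j\in N_{\mathcal G}[i]})$ subject to $\boldsymbol c_i(\{\boldsymbol x_j\}_{j\in N_{\mathcal G}[i]})=\boldsymbol 0$, $i\in\mathcal V$, with $\boldsymbol x_i\in\mathbb R^{r_i}$, $f_i$ real valued, $\boldsymbol c_i$ valued in $\mathbb R^{m_i}$, and dual variables $\boldsymbol\lambda_i\in\mathbb R^{m_i}$. Put $f=\sum_if_i$, $\boldsymbol c=\{\boldsymbol c_i\}_{i\in\mathcal V}$, $\mathcal L(\boldsymbol x,\boldsymbol\lambda)=f(\boldsymbol x)+\boldsymbol\lambda^T\boldsymbol c(\boldsymbol x)$, $G(\boldsymbol x)=\nabla\boldsymbol c(\boldsymbol x)$ (constraint Jacobian), $H(\boldsymbol x,\boldsymbol\lambda)=\nabla^2_{\boldsymbol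 x}\mathcal L(\boldsymbol x,\boldsymbol\lambda)$. At iterates $(\boldsymbol x^\tau,\boldsymbol\lambda^\tau)$, $\tau=0,1,\dots$, a superscript $\tau$ denotes evaluation there ($\boldsymbol c^\tau,\nabla\mathcal L^\tau,G^\tau,H^\tau$), and $\hat H^\tau$ is a symmetric structure-preserving modification of $H^\tau$. Vectors and matrices are indexed blockwise by nodes; $A_{i,j}$ is the $(i,j)$-block and $A[\mathcal I][\mathcal J]$ (or $v[\mathcal I]$) the subarray with row indices in $\mathcal I$ and column indices in $\mathcal J$. Thus $H_{i,j}=\hat H^\tau_{i,j}=\boldsymbol0$ if $d_{\mathcal G}(i,j)>2$ and $G_{i,j}=\boldsymbol0$ if $d_{\mathcal G}(i,j)>1$. $\|\cdot\|$ is the Euclidean/spectral norm. Exact Newton direction $(\Delta\boldsymbol x^\tau,\Delta\boldsymbol\lambda^\tau)$: the solution of $\begin{bmatrix}\hat H^\tau & (G^\tau)^T \\ G^\tau & \boldsymbol0\end{bmatrix}\begin{bmatrix}\Delta\boldsymbol x^\tau \\ \Delta\boldsymbol\lambda^\tau\end{bmatrix}=-\begin{bmatrix}\nabla_{\boldsymbol x}\mathcal L^\tau \\ \nabla_{\boldsymbol\lambda}\mathcal L^\tau\end{bmatrix}$. Overlapping decomposition. $\{\mathcal V_\ell\}_{\ell\in[M]}$ is a disjoint partition of $\mathcal V$, $b\ge1$ is an integer (overlap size), and $\mathcal W_\ell\subseteq\mathcal V$ satisfies $N^b_{\mathcal G}[\mathcal V_\ell]\subseteq\mathcal W_\ell$.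 Set $\tilde{\mathcal W}_\ell=N_{\mathcal G}(N_{\mathcal G}(\mathcal W_\ell))\cap\mathcal W_\ell$ and $\hat{\mathcal W}_\ell=N_{\mathcal G}(\mathcal W_\ell)\cup\tilde{\mathcal W}_\ell$. Approximate Newton direction $(\tilde\Delta\boldsymbol x^\tau,\tilde\Delta\boldsymbol\lambda^\tau)$: for each $\ell\in[M]$ let $(\tilde{\boldsymbol\omega}^*_\ell,\tilde{\boldsymbol\zeta}^*_\ell)$ be the primal-dual solution (unique for $\mu\ge\hat\mu$) of $$\min_{\tilde{\boldsymbol\omega}_\ell}\ \tfrac12\tilde{\boldsymbol\omega}_\ell^T\hat H^\tau[\mathcal W_\ell][\mathcal W_\ell]\tilde{\boldsymbol\omega}_\ell+\tilde{\boldsymbol\omega}_\ell^T\nabla_{\boldsymbol x}\mathcal L^\tau[\mathcal W_\ell]+\tfrac\mu2\|\boldsymbol c^\tau[\hat{\mathcal W}_\ell]+G^\tau[\hat{\mathcal W}_\ell][\mathcal W_\ell]\tilde{\boldsymbol\omega}_\ell\|^2\ \ \text{s.t.}\ \ \boldsymbol c^\tau[\mathcal W_\ell\setminus\tilde{\mathcal W}_\ell]+G^\tau[\mathcal W_\ell\setminus\tilde{\mathcal W}_\ell][\mathcal W_\ell]\tilde{\boldsymbol\omega}_\ell=\boldsymbol0,$$ where $\tilde{\boldsymbol\omega}_\ell$ is indexed by $\mathcal W_\ell$ and the dual variable $\tilde{\boldsymbol\zeta}_\ell$ by $\mathcal W_\ell\setminus\tilde{\mathcal W}_\ell$. For $k\in\mathcal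 V$ and the unique $\ell$ with $k\in\mathcal V_\ell$, the components of $(\tilde\Delta\boldsymbol x^\tau,\tilde\Delta\boldsymbol\lambda^\tau)$ at node $k$ are those of $(\tilde{\boldsymbol\omega}^*_\ell,\tilde{\boldsymbol\zeta}^*_\ell)$ at node $k$. Merit function (exact augmented Lagrangian), $\eta=(\eta_1,\eta_2)$: $\mathcal L_\eta(\boldsymbol x,\boldsymbol\lambda)=\mathcal L(\boldsymbol x,\boldsymbol\lambda)+\frac{\eta_1}2\|\nabla_{\boldsymbol\lambda}\mathcal L(\boldsymbol x,\boldsymbol\lambda)\|^2+\frac{\eta_2}2\|\nabla_{\boldsymbol x}\mathcal L(\boldsymbol x,\boldsymbol\lambda)\|^2$. The iterates satisfy $(\boldsymbol x^{\tau+1},\boldsymbol\lambda^{\tau+1})=(\boldsymbol x^\tau,\boldsymbol\lambda^\tau)+\alpha_\tau(\tilde\Delta\boldsymbol x^\tau,\tilde\Delta\boldsymbol\lambda^\tau)$ for stepsizes $\alpha_\tau\in(0,1]$ chosen by line search on $\mathcal L_\eta$. Assumptions. (A1) For a constant $\gamma_H\in(0,1]$ and all $\tau\ge0$, $\boldsymbol\omega^T\hat H^\tau\boldsymbol\omega\ge\gamma_H\|\boldsymbol\omega\|^2$ whenever $G^\tau\boldsymbol\omega=\boldsymbol0$. (A2) For a constant $\gamma_G\in(0,1]$ and all $\tau\ge0$, $G^\tau(G^\tau)^T\succeq\gamma_GI$. (A3) For a constant $\Upsilon\ge1$, all $\tau\ge0$ and all $i,j\in\mathcal V$, $\max\{\|\hat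 H^\tau_{i,j}\|,\|H^\tau_{i,j}\|,\|G^\tau_{i,j}\|\}\le\Upsilon$. (A4) There are polynomials $\mathrm{poly}_{\mathcal W},\mathrm{poly}_{\mathcal G}$ such that $d_{\mathcal G}(i,j)\le\mathrm{poly}_{\mathcal W}(b)$ for all $i,j\in\mathcal W_\ell$, $\ell\in[M]$, and $|\{j\in\mathcal V:d_{\mathcal G}(i,j)\le d\}|\le\mathrm{poly}_{\mathcal G}(d)$ for all $i\in\mathcal V$ and any integer $d$. (A5) There is a compact set $\mathcal X\times\Lambda$ with $(\boldsymbol x^\tau+\alpha\tilde\Delta\boldsymbol x^\tau,\boldsymbol\lambda^\tau+\alpha\tilde\Delta\boldsymbol\lambda^\tau)\in\mathcal X\times\Lambda$ for all $\tau\ge0$, $\alpha\in[0,1]$; the functions $f_i,\boldsymbol c_i$ ($i\in\mathcal V$) are thrice continuously differentiable in $\mathcal X\times\Lambda$; and (with the same constant $\Upsilon\ge1$) $\sup_{\boldsymbol x\in\mathcal X,\boldsymbol\lambda\in\Lambda}\|H_{i,j}(\boldsymbol x,\boldsymbol\lambda)\|\le\Upsilon$ and $\sup_{\boldsymbol x\in\mathcal X}\|G_{i,j}(\boldsymbol x)\|\le\Upsilon$ for all $i,j\in\mathcal V$. Constants: $\mathrm{poly}_{\mathcal G\circ\mathcal W}(b):=\mathrm{poly}_{\mathcal G}(\mathrm{poly}_{\mathcal W}(b))$, $\hat\Upsilon:=\Upsilon\cdot\mathrm{poly}_{\mathcal G}(1)^2$ (which bounds $\|\hat H^\tau\|,\|H^\tau\|,\|G^\tau\|$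 for all $\tau$), $\hat\mu:=4\hat\Upsilon^2/(\gamma_G\gamma_H)$, $\Upsilon_K=1.5\mu\hat\Upsilon^2$, $\gamma_K=\gamma_H^3\gamma_G^2/(75\Upsilon_K^6)$, $\rho_\mu=\big((\Upsilon_K^2-\gamma_K^2)/(\Upsilon_K^2+\gamma_K^2)\big)^{1/4}\in(0,1)$, $\Upsilon_\mu=\Upsilon_K/(\gamma_K^2\rho_\mu^2)$, $\Upsilon_{\mu,b}=\frac{\sqrt2\Upsilon_\mu\Upsilon_K}{\rho_\mu\sqrt{1-\rho_\mu^2}}\mathrm{poly}_{\mathcal G\circ\mathcal W}(b)\{\mathrm{poly}_{\mathcal G}(b+2)\}^{1/2}$, and $\delta_{\mu,b}:=\Upsilon_{\mu,b}\rho_\mu^b$.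
   Formalization: In (A4) the bound on the number of nodes within distance d is also required at d = poly_W(b), even if that is not an integer; otherwise poly_G(poly_W(b)) could be negative and the claim false. At least one variable and one constraint are assumed. *)

theory Defs
  imports "HOL-Analysis.Analysis" "HOL-Computational_Algebra.Polynomial"
begin

section \<open>Graphs\<close>

text \<open>
  The node set is a finite type; the edge set is a relation \<open>E\<close>, assumed symmetric where it is
  used. The distance of nodes in different components, and the distance to the empty set, is
  \<open>\<infinity>\<close>.
\<close>

definition gdist :: "('v \<times> 'v) set \<Rightarrow> 'v \<Rightarrow> 'v \<Rightarrow> enat" where
  "gdist E i j = (INF n\<in>{n. (i, j) \<in> E ^^ n}. enat n)"

definition gdist_set :: "('v \<times> 'v) set \<Rightarrow> 'v \<Rightarrow> 'v set \<Rightarrow> enat" where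
  "gdist_set E i W = (INF j\<in>W. gdist E i j)"

definition closed_nbhd :: "('v \<times> 'v) set \<Rightarrow> nat \<Rightarrow> 'v set \<Rightarrow> 'v set" where
  "closed_nbhd E b W = {i. gdist_set E i W \<le> enat b}"

definition open_nbhd :: "('v \<times> 'v) set \<Rightarrow> 'v set \<Rightarrow> 'v set" where
  "open_nbhd E W = closed_nbhd E 1 W - W"

definition W_tilde :: "('v \<times> 'v) set \<Rightarrow> 'v set \<Rightarrow> 'v set" where
  "W_tilde E W = open_nbhd E (open_nbhd E W) \<inter> W"

definition W_hat :: "('v \<times> 'v) set \<Rightarrow> 'v set \<Rightarrow> 'v set" where
  "W_hat E W = open_nbhd E W \<union> W_tilde E W"


section \<open>Blocks indexed by nodes\<close>

text \<open>
  A vector with one block per node is an element of \<open>real ^ 'a\<close> together with a map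
  \<open>nd :: 'a \<Rightarrow> 'v\<close> that gives the node owning each scalar coordinate: the block of node \<open>i\<close> has
  dimension \<open>card {k. nd k = i}\<close> (possibly 0). A subarray \<open>v[I]\<close> or \<open>A[I][J]\<close> is represented by its
  extension by zero to the full index type. This changes neither matrix-vector products nor
  Euclidean and spectral norms.
\<close>

definition subvec :: "('a::finite \<Rightarrow> 'v) \<Rightarrow> 'v set \<Rightarrow> real ^ 'a \<Rightarrow> real ^ 'a" where
  "subvec nd I v = (\<chi> k. if nd k \<in> I then v $ k else 0)"

definition submat ::
  "('a::finite \<Rightarrow> 'v) \<Rightarrow> ('b::finite \<Rightarrow> 'v) \<Rightarrow> 'v set \<Rightarrow> 'v set \<Rightarrow> real ^ 'b ^ 'a \<Rightarrow> real ^ 'b ^ 'a" where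
  "submat nr nc I J A = (\<chi> k l. if nr k \<in> I \<and> nc l \<in> J then A $ k $ l else 0)"

definition spectral_norm :: "real ^ 'b ^ 'a \<Rightarrow> real" where
  "spectral_norm A = onorm ((*v) A)"

definition depends_only_on :: "('a::finite \<Rightarrow> 'v) \<Rightarrow> 'v set \<Rightarrow> (real ^ 'a \<Rightarrow> 'c) \<Rightarrow> bool" where
  "depends_only_on nd I g \<longleftrightarrow> (\<forall>x y. (\<forall>k. nd k \<in> I \<longrightarrow> x $ k = y $ k) \<longrightarrow> g x = g y)"


section \<open>Calculus\<close>

definition grad :: "(real ^ 'a \<Rightarrow> real) \<Rightarrow> real ^ 'a \<Rightarrow> real ^ 'a" where
  "grad g x = (\<chi> k. frechet_derivative g (at x) (axis k 1))"

fun Ck_on :: "nat \<Rightarrow> ('a::euclidean_space \<Rightarrow> 'b::real_normed_vector) \<Rightarrow> 'a set \<Rightarrow> bool" where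
  "Ck_on 0 g U \<longleftrightarrow> continuous_on U g"
| "Ck_on (Suc k) g U \<longleftrightarrow>
     (\<forall>x\<in>U. g differentiable at x) \<and> (\<forall>v. Ck_on k (\<lambda>x. frechet_derivative g (at x) v) U)"

text \<open>Differentiability of order \<open>k\<close> on a set that need not be open, such as a compact set.\<close>

definition Ck_near :: "nat \<Rightarrow> ('a::euclidean_space \<Rightarrow> 'b::real_normed_vector) \<Rightarrow> 'a set \<Rightarrow> bool" where
  "Ck_near k g S \<longleftrightarrow> (\<exists>U. open U \<and> S \<subseteq> U \<and> Ck_on k g U)"


section \<open>Lagrangian and merit function\<close>

definition lagrangian ::
  "('v::finite \<Rightarrow> real ^ 'p \<Rightarrow> real) \<Rightarrow> (real ^ 'p \<Rightarrow> real ^ 'd) \<Rightarrow> real ^ 'p \<Rightarrow> real ^ 'd \<Rightarrow> real" where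
  "lagrangian f c x lam = (\<Sum>i\<in>UNIV. f i x) + lam \<bullet> c x"

definition grad_x_L ::
  "('v::finite \<Rightarrow> real ^ 'p \<Rightarrow> real) \<Rightarrow> (real ^ 'p \<Rightarrow> real ^ 'd) \<Rightarrow> real ^ 'p \<Rightarrow> real ^ 'd \<Rightarrow> real ^ 'p" where
  "grad_x_L f c x lam = grad (\<lambda>y. lagrangian f c y lam) x"

definition grad_l_L ::
  "('v::finite \<Rightarrow> real ^ 'p \<Rightarrow> real) \<Rightarrow> (real ^ 'p \<Rightarrow> real ^ 'd) \<Rightarrow> real ^ 'p \<Rightarrow> real ^ 'd \<Rightarrow> real ^ 'd" where
  "grad_l_L f c x lam = grad (\<lambda>l. lagrangian f c x l) lam"

definition hess_L ::
  "('v::finite \<Rightarrow> real ^ 'p \<Rightarrow> real) \<Rightarrow> (real ^ 'p \<Rightarrow> real ^ 'd) \<Rightarrow> real ^ 'p \<Rightarrow> real ^ 'd \<Rightarrow> real ^ 'p ^ 'p" where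
  "hess_L f c x lam = jacobian (\<lambda>y. grad_x_L f c y lam) (at x)"

definition merit ::
  "('v::finite \<Rightarrow> real ^ 'p \<Rightarrow> real) \<Rightarrow> (real ^ 'p \<Rightarrow> real ^ 'd) \<Rightarrow> real \<Rightarrow> real
    \<Rightarrow> real ^ 'p \<Rightarrow> real ^ 'd \<Rightarrow> real" where
  "merit f c eta1 eta2 x lam =
     lagrangian f c x lam + eta1 / 2 * (norm (grad_l_L f c x lam))\<^sup>2
       + eta2 / 2 * (norm (grad_x_L f c x lam))\<^sup>2"

definition grad_x_merit ::
  "('v::finite \<Rightarrow> real ^ 'p \<Rightarrow> real) \<Rightarrow> (real ^ 'p \<Rightarrow> real ^ 'd) \<Rightarrow> real \<Rightarrow> real
    \<Rightarrow> real ^ 'p \<Rightarrow> real ^ 'd \<Rightarrow> real ^ 'p" where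
  "grad_x_merit f c eta1 eta2 x lam = grad (\<lambda>y. merit f c eta1 eta2 y lam) x"

definition grad_l_merit ::
  "('v::finite \<Rightarrow> real ^ 'p \<Rightarrow> real) \<Rightarrow> (real ^ 'p \<Rightarrow> real ^ 'd) \<Rightarrow> real \<Rightarrow> real
    \<Rightarrow> real ^ 'p \<Rightarrow> real ^ 'd \<Rightarrow> real ^ 'd" where
  "grad_l_merit f c eta1 eta2 x lam = grad (\<lambda>l. merit f c eta1 eta2 x l) lam"


section \<open>Newton system and overlapping subproblems\<close>

definition newton_direction ::
  "real ^ 'p ^ 'p \<Rightarrow> real ^ 'p ^ 'd \<Rightarrow> real ^ 'p \<Rightarrow> real ^ 'd \<Rightarrow> real ^ 'p \<Rightarrow> real ^ 'd \<Rightarrow> bool" where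
  "newton_direction Hh G gx gl dx dl \<longleftrightarrow>
     Hh *v dx + transpose G *v dl = - gx \<and> G *v dx = - gl"

text \<open>
  Data of a subproblem: \<open>np\<close> and \<open>nd\<close> are the owner maps of the primal and dual coordinates,
  \<open>gx\<close> is the gradient of the Lagrangian with respect to the primal variables, \<open>cv\<close> is the
  constraint value, \<open>G\<close> is the constraint Jacobian.
\<close>

definition sub_objective ::
  "('v \<times> 'v) set \<Rightarrow> ('p::finite \<Rightarrow> 'v) \<Rightarrow> ('d::finite \<Rightarrow> 'v) \<Rightarrow> real ^ 'p ^ 'p \<Rightarrow> real ^ 'p ^ 'd
    \<Rightarrow> real ^ 'p \<Rightarrow> real ^ 'd \<Rightarrow> real \<Rightarrow> 'v set \<Rightarrow> real ^ 'p \<Rightarrow> real" where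
  "sub_objective E np nd Hh G gx cv mu W w =
     1 / 2 * (w \<bullet> (submat np np W W Hh *v w)) + w \<bullet> subvec np W gx
     + mu / 2 * (norm (subvec nd (W_hat E W) cv + submat nd np (W_hat E W) W G *v w))\<^sup>2"

definition sub_constraint ::
  "('v \<times> 'v) set \<Rightarrow> ('p::finite \<Rightarrow> 'v) \<Rightarrow> ('d::finite \<Rightarrow> 'v) \<Rightarrow> real ^ 'p ^ 'd
    \<Rightarrow> real ^ 'd \<Rightarrow> 'v set \<Rightarrow> real ^ 'p \<Rightarrow> real ^ 'd" where
  "sub_constraint E np nd G cv W w =
     subvec nd (W - W_tilde E W) cv + submat nd np (W - W_tilde E W) W G *v w"

text \<open>
  The first two conjuncts say that \<open>w\<close> is indexed by \<open>W\<close> and \<open>z\<close> by \<open>W - W_tilde E W\<close>; the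
  last one is stationarity of the Lagrangian of the subproblem, which depends on its argument only
  through the coordinates owned by \<open>W\<close>.
\<close>

definition sub_primal_dual_solution ::
  "('v \<times> 'v) set \<Rightarrow> ('p::finite \<Rightarrow> 'v) \<Rightarrow> ('d::finite \<Rightarrow> 'v) \<Rightarrow> real ^ 'p ^ 'p \<Rightarrow> real ^ 'p ^ 'd
    \<Rightarrow> real ^ 'p \<Rightarrow> real ^ 'd \<Rightarrow> real \<Rightarrow> 'v set \<Rightarrow> real ^ 'p \<Rightarrow> real ^ 'd \<Rightarrow> bool" where
  "sub_primal_dual_solution E np nd Hh G gx cv mu W w z \<longleftrightarrow>
     subvec np W w = w \<and> subvec nd (W - W_tilde E W) z = z
     \<and> sub_constraint E np nd G cv W w = 0
     \<and> (\<forall>w'. subvec np W w' = w' \<and> sub_constraint E np nd G cv W w' = 0 \<longrightarrow>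
            sub_objective E np nd Hh G gx cv mu W w \<le> sub_objective E np nd Hh G gx cv mu W w')
     \<and> grad (\<lambda>u. sub_objective E np nd Hh G gx cv mu W u
                  + z \<bullet> sub_constraint E np nd G cv W u) w = 0"


section \<open>Constants\<close>

definition Ups_hat :: "real \<Rightarrow> real poly \<Rightarrow> real" where
  "Ups_hat Ups pG = Ups * (poly pG 1)\<^sup>2"

definition mu_hat :: "real \<Rightarrow> real \<Rightarrow> real \<Rightarrow> real poly \<Rightarrow> real" where
  "mu_hat gamH gamG Ups pG = 4 * (Ups_hat Ups pG)\<^sup>2 / (gamG * gamH)"

definition Ups_K :: "real \<Rightarrow> real poly \<Rightarrow> real \<Rightarrow> real" where
  "Ups_K Ups pG mu = 3 / 2 * mu * (Ups_hat Ups pG)\<^sup>2"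

definition gam_K :: "real \<Rightarrow> real \<Rightarrow> real \<Rightarrow> real poly \<Rightarrow> real \<Rightarrow> real" where
  "gam_K gamH gamG Ups pG mu = gamH ^ 3 * gamG\<^sup>2 / (75 * Ups_K Ups pG mu ^ 6)"

definition rho_mu :: "real \<Rightarrow> real \<Rightarrow> real \<Rightarrow> real poly \<Rightarrow> real \<Rightarrow> real" where
  "rho_mu gamH gamG Ups pG mu =
     root 4 (((Ups_K Ups pG mu)\<^sup>2 - (gam_K gamH gamG Ups pG mu)\<^sup>2)
             / ((Ups_K Ups pG mu)\<^sup>2 + (gam_K gamH gamG Ups pG mu)\<^sup>2))"

definition Ups_mu :: "real \<Rightarrow> real \<Rightarrow> real \<Rightarrow> real poly \<Rightarrow> real \<Rightarrow> real" where
  "Ups_mu gamH gamG Ups pG mu =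
     Ups_K Ups pG mu / ((gam_K gamH gamG Ups pG mu)\<^sup>2 * (rho_mu gamH gamG Ups pG mu)\<^sup>2)"

definition Ups_mu_b ::
  "real \<Rightarrow> real \<Rightarrow> real \<Rightarrow> real poly \<Rightarrow> real poly \<Rightarrow> real \<Rightarrow> nat \<Rightarrow> real" where
  "Ups_mu_b gamH gamG Ups pG pW mu b =
     sqrt 2 * Ups_mu gamH gamG Ups pG mu * Ups_K Ups pG mu
       / (rho_mu gamH gamG Ups pG mu * sqrt (1 - (rho_mu gamH gamG Ups pG mu)\<^sup>2))
     * poly pG (poly pW (real b)) * sqrt (poly pG (real b + 2))"

definition delta_mu_b ::
  "real \<Rightarrow> real \<Rightarrow> real \<Rightarrow> real poly \<Rightarrow> real poly \<Rightarrow> real \<Rightarrow> nat \<Rightarrow> real" where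
  "delta_mu_b gamH gamG Ups pG pW mu b =
     Ups_mu_b gamH gamG Ups pG pW mu b * rho_mu gamH gamG Ups pG mu ^ b"


section \<open>Growth of the graph and of the subdomains\<close>

text \<open>
  The ball bound is required at natural radii and at \<open>poly pW b\<close>. The latter value need not
  be a natural number, but it is a radius at which \<open>pG\<close> is used as a bound, through
  \<open>poly pG (poly pW b)\<close>. If \<open>pG\<close> is nondecreasing on the nonnegative reals, or if
  \<open>poly pW b\<close> is an integer, this requirement follows from the bound at natural radii.
\<close>

definition growth_bounds ::
  "('v::finite \<times> 'v) set \<Rightarrow> nat \<Rightarrow> nat \<Rightarrow> (nat \<Rightarrow> 'v set) \<Rightarrow> real poly \<Rightarrow> real poly \<Rightarrow> bool" where
  "growth_bounds E b M W pW pG \<longleftrightarrow>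
     (\<forall>l\<in>{1..M}. \<forall>i\<in>W l. \<forall>j\<in>W l. ereal_of_enat (gdist E i j) \<le> ereal (poly pW (real b)))
     \<and> (\<forall>r\<in>\<nat> \<union> {poly pW (real b)}. \<forall>i.
          real (card {j. ereal_of_enat (gdist E i j) \<le> ereal r}) \<le> poly pG r)"

end

theory Submission
  imports Defs
begin

text \<open>
  Truncating the Newton direction to \<open>W\<close> solves the KKT system of the subproblem up to a residual
  supported within distance 2 of the complement of \<open>W\<close>. With \<open>K\<close> the KKT matrix, whose
  singular values lie in \<open>[gam_K, Ups_K]\<close>, the map \<open>I - c K\<^sup>2\<close> is a contraction that enlarges
  supports by 4, so after \<open>b div 4\<close> fixed point iterations the solution of the error equation is
  known up to the contraction factor to that power, and the iterate still vanishes on \<open>V\<close>.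
  Each residual only involves the Newton direction within distance 2 of \<open>W\<close>, and these
  regions overlap a bounded number of times; summing squares gives a relative error of at most
  \<open>delta_mu_b\<close> for the assembled direction. For the exact Newton direction the merit function
  decreases by a direct computation, and the smallness of \<open>delta_mu_b\<close> absorbs the perturbation.
\<close>

section \<open>Distances and neighbourhoods\<close>

text \<open>Cutting the problem down to \<open>W\<close> could destroy both regularity assumptions:
  rows cut at the boundary need not stay independent, and (A1) gives curvature only on the kernel of
  the full Jacobian. The subproblem is shaped to avoid both. A constraint at a node of
  \<open>W - W_tilde E W\<close> involves only variables in \<open>W\<close>, so the enforced rows
  are uncut rows of \<open>G\<close> and inherit (A2). All other constraints that touch
  \<open>W\<close> sit at \<open>W_hat E W\<close> and are penalized. For a direction supported in
  \<open>W\<close> and annihilated by the enforced rows the penalty therefore sees all of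
  \<open>G *v u\<close>, and \<open>mu_hat\<close> is large enough to offset the curvature missing
  off the kernel of \<open>G\<close>. This gives singular value bounds that depend neither on
  \<open>W\<close> nor on the number of nodes. The exact Newton direction satisfies the linearized
  constraints, so the penalty gradient vanishes on it and only couplings across the boundary of
  \<open>W\<close> enter the residual. One iteration spreads supports by 4, hence the fourth root in
  \<open>rho_mu\<close>; rounding \<open>b\<close> down to a multiple of 4 costs the three powers of
  \<open>rho_mu\<close> in the denominators of the constants.\<close>

lemma gdist_le_iff: "gdist E i j \<le> enat n \<longleftrightarrow> (\<exists>m\<le>n. (i, j) \<in> E ^^ m)"
proof
  assume le: "gdist E i j \<le> enat n"
  let ?S = "enat ` {m. (i, j) \<in> E ^^ m}"
  \<comment> \<open>The infimum of the empty set in \<open>enat\<close> is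
    \<open>\<infinity>\<close>, and a nonempty set contains its infimum; a finite bound therefore
    produces an actual walk.\<close>
  have "?S \<noteq> {}"
  proof
    assume "?S = {}"
    then have "gdist E i j = \<infinity>" by (simp add: gdist_def Inf_enat_def)
    with le show False by simp
  qed
  then have "Inf ?S \<in> ?S"
    by (metis (no_types, lifting) Inf_enat_def LeastI ex_in_conv)
  then show "\<exists>m\<le>n. (i, j) \<in> E ^^ m"
    using le by (auto simp: gdist_def)
next
  assume "\<exists>m\<le>n. (i, j) \<in> E ^^ m"
  then obtain m where "m \<le> n" "(i, j) \<in> E ^^ m" by blast
  then show "gdist E i j \<le> enat n"
    unfolding gdist_def by (intro INF_lower2[of m]) auto
qed

lemma closed_nbhd_iff: "i \<in> closed_nbhd E n W \<longleftrightarrow> (\<exists>j\<in>W. gdist E i j \<le> enat n)"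
proof
  assume le: "i \<in> closed_nbhd E n W"
  let ?S = "gdist E i ` W"
  have "?S \<noteq> {}"
  proof
    assume "?S = {}"
    then have "gdist_set E i W = \<infinity>" by (simp add: gdist_set_def Inf_enat_def)
    with le show False by (simp add: closed_nbhd_def)
  qed
  then have "Inf ?S \<in> ?S"
    by (metis (no_types, lifting) Inf_enat_def LeastI ex_in_conv)
  then show "\<exists>j\<in>W. gdist E i j \<le> enat n"
    using le by (auto simp: gdist_set_def closed_nbhd_def)
next
  assume "\<exists>j\<in>W. gdist E i j \<le> enat n"
  then show "i \<in> closed_nbhd E n W"
    unfolding closed_nbhd_def gdist_set_def by (auto intro: INF_lower2)
qed

lemma gdist_refl [simp]: "gdist E i i \<le> enat n"
  by (auto simp: gdist_le_iff intro!: exI[of _ 0])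

lemma gdist_triangle:
  "gdist E i j \<le> enat m \<Longrightarrow> gdist E j k \<le> enat n \<Longrightarrow> gdist E i k \<le> enat (m + n)"
  unfolding gdist_le_iff
  by (metis add_mono relcomp.relcompI relpow_add)

lemma gdist_sym:
  assumes "sym E" "gdist E i j \<le> enat n"
  shows "gdist E j i \<le> enat n"
proof -
  have "(i, j) \<in> E ^^ m \<Longrightarrow> (j, i) \<in> E ^^ m" for m
  proof (induction m arbitrary: i)
    case (Suc m)
    then obtain k where "(i, k) \<in> E" "(k, j) \<in> E ^^ m" by (meson relpow_Suc_D2)
    with Suc.IH assms(1) show ?case by (meson relpow_Suc_I symD)
  qed simp
  then show ?thesis using assms(2) by (auto simp: gdist_le_iff)
qed

lemma gdist_mono: "gdist E i j \<le> enat m \<Longrightarrow> m \<le> n \<Longrightarrow> gdist E i j \<le> enat n"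
  by (meson enat_ord_simps(1) order_trans)

lemma gdist_two_midpoint:
  assumes "gdist E i j \<le> enat 2"
  shows "\<exists>k. gdist E i k \<le> enat 1 \<and> gdist E k j \<le> enat 1"
proof -
  obtain m where m: "m \<le> 2" "(i, j) \<in> E ^^ m"
    using assms by (auto simp: gdist_le_iff)
  show ?thesis
  proof (cases "m \<le> 1")
    case True
    then have "gdist E i j \<le> enat 1" using m by (auto simp: gdist_le_iff)
    then show ?thesis by (intro exI[of _ j]) simp
  next
    case False
    with m have "m = 1 + 1" by linarith
    with m have "(i, j) \<in> E ^^ (1 + 1)" by simp
    then obtain k where "(i, k) \<in> E ^^ 1" "(k, j) \<in> E ^^ 1"
      unfolding relpow_add by blast
    then show ?thesis unfolding gdist_le_iff by blast
  qed
qed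

lemma closed_nbhdI: "j \<in> W \<Longrightarrow> gdist E i j \<le> enat n \<Longrightarrow> i \<in> closed_nbhd E n W"
  unfolding closed_nbhd_iff by blast

lemma closed_nbhdE:
  assumes "i \<in> closed_nbhd E n W"
  obtains j where "j \<in> W" "gdist E i j \<le> enat n"
  using assms unfolding closed_nbhd_iff by blast

lemma closed_nbhd_closed_nbhd:
  "closed_nbhd E m (closed_nbhd E n W) \<subseteq> closed_nbhd E (m + n) W"
proof
  fix i assume "i \<in> closed_nbhd E m (closed_nbhd E n W)"
  then obtain j k where "gdist E i j \<le> enat m" "k \<in> W" "gdist E j k \<le> enat n"
    by (elim closed_nbhdE)
  then show "i \<in> closed_nbhd E (m + n) W" using closed_nbhdI gdist_triangle by metis
qed

lemma closed_nbhd_twice: "closed_nbhd E 1 (closed_nbhd E 1 W) \<subseteq> closed_nbhd E 2 W"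
  using closed_nbhd_closed_nbhd[of E 1 1 W] unfolding one_add_one .

lemma closed_nbhd_mono:
  assumes "V \<subseteq> W" "m \<le> n"
  shows "closed_nbhd E m V \<subseteq> closed_nbhd E n W"
proof
  fix i assume "i \<in> closed_nbhd E m V"
  then obtain j where "j \<in> V" "gdist E i j \<le> enat m" by (elim closed_nbhdE)
  with assms show "i \<in> closed_nbhd E n W" by (meson closed_nbhdI gdist_mono subsetD)
qed

lemma subset_closed_nbhd: "W \<subseteq> closed_nbhd E n W"
proof
  fix i assume "i \<in> W"
  then show "i \<in> closed_nbhd E n W" by (rule closed_nbhdI) (rule gdist_refl)
qed

text \<open>Turns the overlap hypothesis around: a support that starts at the complement of
  \<open>W\<close> must spread farther than \<open>n\<close> before it reaches
  \<open>V\<close>.\<close>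

lemma closed_nbhd_disjoint_commute:
  assumes "sym E" "closed_nbhd E n V \<subseteq> W"
  shows "V \<inter> closed_nbhd E n (- W) = {}"
proof (rule equals0I)
  fix i assume i: "i \<in> V \<inter> closed_nbhd E n (- W)"
  then obtain j where j: "j \<in> - W" "gdist E i j \<le> enat n" by (elim IntE closed_nbhdE)
  have "j \<in> closed_nbhd E n V"
    using closed_nbhdI[OF _ gdist_sym[OF assms(1) j(2)]] i by blast
  with assms(2) j(1) show False by blast
qed

lemma W_tilde_subset: "W_tilde E W \<subseteq> closed_nbhd E 1 (- W)"
proof -
  have "open_nbhd E W \<subseteq> - W" by (auto simp: open_nbhd_def)
  then show ?thesis
    using closed_nbhd_mono[of "open_nbhd E W" "- W" 1 1 E] by (auto simp: W_tilde_def open_nbhd_def)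
qed

text \<open>An outside neighbour of \<open>i\<close> would lie in \<open>open_nbhd E W\<close> and
  thereby put \<open>i\<close> into \<open>W_tilde E W\<close>. Hence the Jacobian rows at
  \<open>W - W_tilde E W\<close> have all their columns in \<open>W\<close>, and restricting them to
  \<open>W\<close> loses nothing.\<close>

lemma closed_nbhd_minus_W_tilde:
  assumes "sym E" "i \<in> W - W_tilde E W" "gdist E i j \<le> enat 1"
  shows "j \<in> W"
proof (rule ccontr)
  assume j: "j \<notin> W"
  have "gdist E j i \<le> enat 1" by (rule gdist_sym[OF assms(1,3)])
  then have "j \<in> closed_nbhd E 1 W" using assms(2) by (intro closed_nbhdI[of i]) auto
  with j have jo: "j \<in> open_nbhd E W" by (simp add: open_nbhd_def)
  have "i \<in> closed_nbhd E 1 (open_nbhd E W)"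
    using jo assms(3) by (rule closed_nbhdI)
  then have "i \<in> W_tilde E W"
    using assms(2) by (simp add: W_tilde_def open_nbhd_def)
  with assms(2) show False by blast
qed

lemma closed_nbhd_interior_subset: "sym E \<Longrightarrow> closed_nbhd E 1 (W - W_tilde E W) \<subseteq> W"
proof
  fix i assume E: "sym E" and i: "i \<in> closed_nbhd E 1 (W - W_tilde E W)"
  obtain j where "j \<in> W - W_tilde E W" "gdist E i j \<le> enat 1" using i by (elim closed_nbhdE)
  then show "i \<in> W" using closed_nbhd_minus_W_tilde[OF E] gdist_sym[OF E] by metis
qed

lemma W_hat_subset: "W_hat E W \<subseteq> closed_nbhd E 1 (- W)" "W_hat E W \<subseteq> closed_nbhd E 1 W"
proof -
  have "open_nbhd E W \<subseteq> closed_nbhd E 1 (- W)"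
    using subset_closed_nbhd[of "- W" E 1] by (auto simp: open_nbhd_def)
  then show "W_hat E W \<subseteq> closed_nbhd E 1 (- W)"
    using W_tilde_subset[of E W] by (auto simp: W_hat_def)
  show "W_hat E W \<subseteq> closed_nbhd E 1 W"
    using subset_closed_nbhd[of W E 1] by (auto simp: W_hat_def W_tilde_def open_nbhd_def)
qed

text \<open>\<open>G *v u\<close> with \<open>u\<close> supported in \<open>W\<close> lives on this
  neighbourhood; its two parts carry the enforced and the penalized constraints.\<close>

lemma closed_nbhd_1_eq: "closed_nbhd E 1 W = (W - W_tilde E W) \<union> W_hat E W"
  using subset_closed_nbhd[of W E 1] by (auto simp: W_hat_def W_tilde_def open_nbhd_def)

lemma W_tilde_disjoint: "(W - W_tilde E W) \<inter> W_hat E W = {}"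
  by (auto simp: W_hat_def W_tilde_def open_nbhd_def)

lemma subset_minus_W_tilde:
  assumes "sym E" "b \<ge> 1" "closed_nbhd E b V \<subseteq> W"
  shows "V \<subseteq> W - W_tilde E W"
proof -
  have "V \<subseteq> W" using subset_closed_nbhd assms(3) by (rule order_trans)
  moreover have "W_tilde E W \<subseteq> closed_nbhd E b (- W)"
    using W_tilde_subset closed_nbhd_mono[OF order_refl assms(2)] by (rule order_trans)
  ultimately show ?thesis using closed_nbhd_disjoint_commute[OF assms(1,3)] by blast
qed

lemma ball_bounds:
  fixes E :: "('v::finite \<times> 'v) set"
  assumes "growth_bounds E b M W pW pG"
  shows "real (card {j. gdist E i j \<le> enat n}) \<le> poly pG (real n)"
    and "real (card {j. ereal_of_enat (gdist E i j) \<le> ereal (poly pW (real b))})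
           \<le> poly pG (poly pW (real b))"
proof -
  have eq: "ereal_of_enat e \<le> ereal (real n) \<longleftrightarrow> e \<le> enat n" for e n
    by (cases e) auto
  have "real n \<in> \<nat> \<union> {poly pW (real b)}" by simp
  then have "real (card {j. ereal_of_enat (gdist E i j) \<le> ereal (real n)}) \<le> poly pG (real n)"
    using assms unfolding growth_bounds_def by blast
  then show "real (card {j. gdist E i j \<le> enat n}) \<le> poly pG (real n)"
    by (simp only: eq)
  show "real (card {j. ereal_of_enat (gdist E i j) \<le> ereal (poly pW (real b))})
           \<le> poly pG (poly pW (real b))"
    using assms unfolding growth_bounds_def by blast
qed

lemma card_ball_pos: "1 \<le> real (card {j. gdist E (i::'v::finite) j \<le> enat n})"
proof -
  have "i \<in> {j. gdist E i j \<le> enat n}" by simp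
  then have "card {j. gdist E i j \<le> enat n} \<noteq> 0"
    by (metis card_eq_0_iff empty_iff finite)
  then show ?thesis by linarith
qed

text \<open>\<open>Ups_hat\<close> contains \<open>(poly pG 1)\<^sup>2\<close>, not
  \<open>poly pG 2\<close>, so the ball of radius 2 is counted by unit balls: each of its nodes is
  reached through a midpoint.\<close>

lemma card_ball_two:
  fixes E :: "('v::finite \<times> 'v) set"
  assumes "\<And>i. real (card {j. gdist E i j \<le> enat 1}) \<le> N"
  shows "real (card {j. gdist E i j \<le> enat 2}) \<le> N\<^sup>2"
proof -
  let ?B = "\<lambda>i. {j. gdist E i j \<le> enat 1}"
  have "{j. gdist E i j \<le> enat 2} \<subseteq> (\<Union>k\<in>?B i. ?B k)"
  proof
    fix j assume "j \<in> {j. gdist E i j \<le> enat 2}"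
    then obtain k where "gdist E i k \<le> enat 1" "gdist E k j \<le> enat 1"
      using gdist_two_midpoint[of E i j] by auto
    then show "j \<in> (\<Union>k\<in>?B i. ?B k)" by auto
  qed
  then have "card {j. gdist E i j \<le> enat 2} \<le> card (\<Union>k\<in>?B i. ?B k)"
    by (intro card_mono) auto
  also have "\<dots> \<le> (\<Sum>k\<in>?B i. card (?B k))" by (rule card_UN_le) simp
  finally have "real (card {j. gdist E i j \<le> enat 2}) \<le> (\<Sum>k\<in>?B i. real (card (?B k)))"
    by (metis of_nat_le_iff of_nat_sum)
  also have "\<dots> \<le> (\<Sum>k\<in>?B i. N)" by (intro sum_mono assms)
  also have "\<dots> \<le> N\<^sup>2"
    using mult_right_mono[OF assms[of i], of N] order_trans[OF card_ball_pos assms]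
    by (simp add: power2_eq_square)
  finally show ?thesis .
qed

section \<open>Blocks\<close>

lemma subvec_nth [simp]: "subvec nd I v $ k = (if nd k \<in> I then v $ k else 0)"
  by (simp add: subvec_def)

lemma linear_subvec: "linear (subvec nd I)"
  by (rule linearI) (auto simp: vec_eq_iff)

lemmas subvec_linear_simps = linear_add[OF linear_subvec] linear_diff[OF linear_subvec]
  linear_scale[OF linear_subvec] linear_0[OF linear_subvec] linear_sum[OF linear_subvec]

lemma subvec_subvec: "subvec nd I (subvec nd J v) = subvec nd (I \<inter> J) v"
  by (auto simp: vec_eq_iff)

lemma inner_subvec: "subvec nd I u \<bullet> v = u \<bullet> subvec nd I v"
  unfolding inner_vec_def by (intro sum.cong) auto

lemma norm_subvec_le: "norm (subvec nd I v) \<le> norm v"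
  by (rule norm_le_componentwise_cart) auto

lemma norm_subvec_mono: "I \<subseteq> J \<Longrightarrow> norm (subvec nd I v) \<le> norm (subvec nd J v)"
  by (rule norm_le_componentwise_cart) auto

lemma submat_mult_vec: "submat nr nc I J A *v u = subvec nr I (A *v subvec nc J u)"
  by (auto simp: vec_eq_iff submat_def matrix_vector_mult_def intro!: sum.cong)

lemma transpose_submat: "transpose (submat nr nc I J A) = submat nc nr J I (transpose A)"
  by (auto simp: vec_eq_iff submat_def transpose_def)

lemma inner_transpose: "(transpose A *v u) \<bullet> v = u \<bullet> (A *v v)" for A :: "real^'b^'a"
  by (metis dot_lmul_matrix transpose_matrix_vector)

lemma inner_transpose_right: "u \<bullet> (transpose A *v v) = v \<bullet> (A *v u)" for A :: "real^'b^'a"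
  by (metis inner_transpose inner_commute)

lemma subvec_eq_iff: "subvec nd I v = v \<longleftrightarrow> (\<forall>k. nd k \<notin> I \<longrightarrow> v $ k = 0)"
  by (auto simp: vec_eq_iff)

lemma sum_subvec_singletons:
  fixes nd :: "'a::finite \<Rightarrow> 'v::finite"
  shows "(\<Sum>i\<in>UNIV. subvec nd {i} v) = v"
  by (simp add: vec_eq_iff if_distrib cong: if_cong)

lemma norm_subvec_sq: "(norm (subvec nd I v))\<^sup>2 = (\<Sum>k\<in>UNIV. if nd k \<in> I then (v $ k)\<^sup>2 else 0)"
  unfolding power2_norm_eq_inner inner_vec_def by (auto simp: power2_eq_square intro!: sum.cong)

lemma sum_norm_subvec_singletons:
  fixes nd :: "'a::finite \<Rightarrow> 'v::finite"
  shows "(\<Sum>i\<in>UNIV. (norm (subvec nd {i} v))\<^sup>2) = (norm v)\<^sup>2"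
proof -
  have "(\<Sum>i\<in>UNIV. (norm (subvec nd {i} v))\<^sup>2) = (\<Sum>k\<in>UNIV. \<Sum>i\<in>UNIV. if nd k \<in> {i} then (v $ k)\<^sup>2 else 0)"
    unfolding norm_subvec_sq by (rule sum.swap)
  also have "\<dots> = (norm v)\<^sup>2"
    unfolding power2_norm_eq_inner inner_vec_def by (simp add: power2_eq_square)
  finally show ?thesis .
qed

definition banded :: "('v \<times> 'v) set \<Rightarrow> nat \<Rightarrow> ('a::finite \<Rightarrow> 'v) \<Rightarrow> ('b::finite \<Rightarrow> 'v)
    \<Rightarrow> real ^ 'b ^ 'a \<Rightarrow> bool" where
  "banded E r nr nc A \<longleftrightarrow> (\<forall>k l. A $ k $ l \<noteq> 0 \<longrightarrow> gdist E (nr k) (nc l) \<le> enat r)"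

lemma banded_mono: "banded E r nr nc A \<Longrightarrow> r \<le> s \<Longrightarrow> banded E s nr nc A"
  unfolding banded_def by (blast intro: gdist_mono)

lemma banded_transpose: "sym E \<Longrightarrow> banded E r nr nc A \<Longrightarrow> banded E r nc nr (transpose A)"
  unfolding banded_def transpose_def by (auto intro: gdist_sym)

lemma banded_supported:
  assumes "banded E r nr nc A" "subvec nc I u = u" "closed_nbhd E r I \<subseteq> J"
  shows "subvec nr J (A *v u) = A *v u"
proof -
  have "(A *v u) $ k = 0" if k: "nr k \<notin> J" for k
  proof -
    have "A $ k $ l * u $ l = 0" for l
    proof (cases "A $ k $ l = 0 \<or> nc l \<notin> I")
      case False
      then have "nr k \<in> closed_nbhd E r I"
        using assms(1) by (auto simp: banded_def closed_nbhd_iff)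
      with k assms(3) show ?thesis by blast
    qed (use assms(2) in \<open>auto simp: subvec_eq_iff\<close>)
    then show ?thesis
      unfolding matrix_vector_mult_def vec_lambda_beta by (intro sum.neutral) blast
  qed
  then show ?thesis by (simp add: subvec_eq_iff)
qed

lemma banded_restrict:
  assumes "banded E r nr nc A" "sym E" "closed_nbhd E r I \<subseteq> J"
  shows "subvec nr I (A *v u) = subvec nr I (A *v subvec nc J u)"
proof -
  have "(A *v u) $ k = (A *v subvec nc J u) $ k" if "nr k \<in> I" for k
    unfolding matrix_vector_mult_def vec_lambda_beta
  proof (intro sum.cong refl)
    fix l
    show "A $ k $ l * u $ l = A $ k $ l * subvec nc J u $ l"
    proof (cases "A $ k $ l = 0 \<or> nc l \<in> J")
      case False
      then have "nc l \<in> closed_nbhd E r I"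
        using assms(1,2) that by (auto simp: banded_def closed_nbhd_iff intro: gdist_sym)
      with False assms(3) show ?thesis by blast
    qed auto
  qed
  then show ?thesis by (auto simp: vec_eq_iff)
qed

lemma spectral_norm_bound: "norm (A *v u) \<le> spectral_norm A * norm u"
  unfolding spectral_norm_def by (rule onorm) simp

text \<open>Schur's test for the matrix of block norms.\<close>

lemma banded_norm_le:
  fixes E :: "('v::finite \<times> 'v) set" and A :: "real ^ 'b ^ 'a"
  assumes E: "sym E" and A: "banded E r nr nc A"
    and C: "\<And>i j. spectral_norm (submat nr nc {i} {j} A) \<le> C"
    and N: "\<And>i. real (card {j. gdist E i j \<le> enat r}) \<le> N"
  shows "norm (A *v u) \<le> C * N * norm u"
proof -
  let ?B = "\<lambda>i. {j. gdist E i j \<le> enat r}"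
  have C0: "C \<ge> 0"
    using C[of undefined undefined] onorm_pos_le[OF matrix_vector_mul_bounded_linear]
    unfolding spectral_norm_def by (metis order_trans)
  have N0: "N \<ge> 0" using N[of undefined] by (meson of_nat_0_le_iff order_trans)
  have blk: "subvec nr {i} (A *v u) = (\<Sum>j\<in>?B i. submat nr nc {i} {j} A *v subvec nc {j} u)" for i
  proof -
    have "subvec nr {i} (A *v u) = subvec nr {i} (A *v (\<Sum>j\<in>?B i. subvec nc {j} u))"
    proof -
      have "(\<Sum>j\<in>?B i. subvec nc {j} u) = subvec nc (?B i) u"
        by (auto simp: vec_eq_iff if_distrib cong: if_cong)
      moreover have "closed_nbhd E r {i} \<subseteq> ?B i"
        using E by (auto simp: closed_nbhd_iff intro: gdist_sym)
      ultimately show ?thesis using banded_restrict[OF A E] by metis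
    qed
    then show ?thesis
      by (simp add: submat_mult_vec subvec_subvec linear_sum[OF matrix_vector_mul_linear]
          linear_sum[OF linear_subvec])
  qed
  have "(norm (A *v u))\<^sup>2 = (\<Sum>i\<in>UNIV. (norm (subvec nr {i} (A *v u)))\<^sup>2)"
    by (simp add: sum_norm_subvec_singletons)
  also have "\<dots> \<le> (\<Sum>i\<in>UNIV. C\<^sup>2 * N * (\<Sum>j\<in>?B i. (norm (subvec nc {j} u))\<^sup>2))"
  proof (intro sum_mono)
    fix i
    have "norm (subvec nr {i} (A *v u)) \<le> (\<Sum>j\<in>?B i. C * norm (subvec nc {j} u))"
      unfolding blk
      by (intro order_trans[OF norm_sum] sum_mono order_trans[OF spectral_norm_bound]
          mult_right_mono C norm_ge_zero)
    also have "\<dots> = C * (\<Sum>j\<in>?B i. norm (subvec nc {j} u))" by (simp add: sum_distrib_left)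
    finally have "(norm (subvec nr {i} (A *v u)))\<^sup>2 \<le> (C * (\<Sum>j\<in>?B i. norm (subvec nc {j} u)))\<^sup>2"
      by (intro power_mono) auto
    also have "\<dots> \<le> C\<^sup>2 * (real (card (?B i)) * (\<Sum>j\<in>?B i. (norm (subvec nc {j} u))\<^sup>2))"
      unfolding power_mult_distrib
      by (intro mult_left_mono sum_squared_le_sum_of_squares[THEN order_trans]) (auto simp: mult.commute)
    also have "\<dots> \<le> C\<^sup>2 * (N * (\<Sum>j\<in>?B i. (norm (subvec nc {j} u))\<^sup>2))"
      by (intro mult_left_mono mult_right_mono N sum_nonneg) auto
    finally show "(norm (subvec nr {i} (A *v u)))\<^sup>2 \<le> C\<^sup>2 * N * (\<Sum>j\<in>?B i. (norm (subvec nc {j} u))\<^sup>2)"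
      by (simp add: mult.assoc)
  qed
  also have "\<dots> = C\<^sup>2 * N * (\<Sum>i\<in>UNIV. \<Sum>j\<in>?B i. (norm (subvec nc {j} u))\<^sup>2)"
    by (simp add: sum_distrib_left)
  \<comment> \<open>Exchanging the sums replaces balls around row nodes by balls around column
    nodes. Symmetry of the distance makes both counts \<open>N\<close>, one from Cauchy-Schwarz
    above and one from here.\<close>
  also have "(\<Sum>i\<in>UNIV. \<Sum>j\<in>?B i. (norm (subvec nc {j} u))\<^sup>2)
      = (\<Sum>j\<in>UNIV. \<Sum>i\<in>?B j. (norm (subvec nc {j} u))\<^sup>2)"
  proof -
    have B: "gdist E i j \<le> enat r \<longleftrightarrow> gdist E j i \<le> enat r" for i j
      using gdist_sym[OF E, of i j r] gdist_sym[OF E, of j i r] by blast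
    have filter: "(\<Sum>j\<in>?B i. h j) = (\<Sum>j\<in>UNIV. if gdist E i j \<le> enat r then h j else 0)"
      for i and h :: "'v \<Rightarrow> real"
      using sum.inter_filter[of UNIV h "\<lambda>j. gdist E i j \<le> enat r"] by simp
    show ?thesis unfolding filter by (subst sum.swap) (simp only: B)
  qed
  also have "C\<^sup>2 * N * (\<Sum>j\<in>UNIV. \<Sum>i\<in>?B j. (norm (subvec nc {j} u))\<^sup>2)
      \<le> C\<^sup>2 * N * (\<Sum>j\<in>UNIV. N * (norm (subvec nc {j} u))\<^sup>2)"
    by (intro mult_left_mono sum_mono) (auto intro!: mult_right_mono N simp: N0)
  also have "\<dots> = (C * N * norm u)\<^sup>2"
  proof -
    have "(\<Sum>j\<in>UNIV. N * (norm (subvec nc {j} u))\<^sup>2) = N * (norm u)\<^sup>2"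
      by (subst sum_distrib_left[symmetric], subst sum_norm_subvec_singletons) (rule refl)
    then show ?thesis by (simp add: power2_eq_square)
  qed
  finally show ?thesis
    using C0 N0 by (rule_tac power2_le_imp_le) simp_all
qed

section \<open>Contractions and saddle point systems\<close>

text \<open>Polarization: with \<open>y\<close> parallel to \<open>T x\<close> and as long as
  \<open>x\<close>, \<open>4 * (T x \<bullet> y)\<close> is a difference of two values of the
  quadratic form, and the parallelogram law turns their bounds into
  \<open>4 * (r * (norm x)\<^sup>2)\<close>. The invariant subspace is there because the KKT map is
  shown to be symmetric on its index set.\<close>

lemma quadratic_form_norm_le:
  fixes T :: "'a::real_inner \<Rightarrow> 'a"
  assumes T: "linear T" and S: "subspace S" "\<And>z. z \<in> S \<Longrightarrow> T z \<in> S"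
    and sym: "\<And>x y. x \<in> S \<Longrightarrow> y \<in> S \<Longrightarrow> T x \<bullet> y = x \<bullet> T y"
    and bound: "\<And>z. z \<in> S \<Longrightarrow> \<bar>z \<bullet> T z\<bar> \<le> r * (norm z)\<^sup>2" and x: "x \<in> S"
  shows "norm (T x) \<le> r * norm x"
proof (cases "T x = 0 \<or> x = 0")
  case True
  have "0 \<le> r" if "x \<noteq> 0"
  proof -
    have "0 \<le> r * (norm x)\<^sup>2" using bound[OF x] by linarith
    then show ?thesis using that by (simp add: zero_le_mult_iff)
  qed
  with True show ?thesis using linear_0[OF T] by (cases "x = 0") auto
next
  case False
  define y where "y = (norm x / norm (T x)) *\<^sub>R T x"
  have y: "y \<in> S" unfolding y_def by (intro subspace_scale S x)
  have ny: "norm y = norm x" using False by (simp add: y_def)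
  have "4 * (T x \<bullet> y) = (x + y) \<bullet> T (x + y) - (x - y) \<bullet> T (x - y)"
    using sym[OF x y] sym[OF y x]
    by (simp add: linear_add[OF T] linear_diff[OF T] inner_add_left inner_add_right
        inner_diff_left inner_diff_right inner_commute)
  also have "\<dots> \<le> r * (norm (x + y))\<^sup>2 + r * (norm (x - y))\<^sup>2"
    using bound[OF subspace_add[OF S(1) x y]] bound[OF subspace_diff[OF S(1) x y]] by linarith
  also have "\<dots> = 4 * (r * (norm x)\<^sup>2)"
    using ny unfolding power2_norm_eq_inner
    by (simp add: inner_add_left inner_add_right inner_diff_left inner_diff_right norm_eq_sqrt_inner algebra_simps inner_commute)
  finally have "T x \<bullet> y \<le> r * (norm x)\<^sup>2" by simp
  moreover have "T x \<bullet> y = norm x * norm (T x)"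
    using False by (simp add: y_def dot_square_norm power2_eq_square)
  ultimately have "norm x * norm (T x) \<le> norm x * (r * norm x)"
    by (simp add: power2_eq_square mult_ac)
  then show ?thesis using False by simp
qed

text \<open>A saddle point matrix is indefinite, hence the square of \<open>K\<close>. Its quadratic
  form lies between \<open>g\<^sup>2\<close> and \<open>U\<^sup>2\<close>, and the step
  \<open>2 / (U\<^sup>2 + g\<^sup>2)\<close> makes the two extreme values of the form of
  \<open>I - c K\<^sup>2\<close> opposite numbers, which gives the best factor.\<close>

lemma normal_equation_contraction:
  fixes K :: "'a::real_inner \<Rightarrow> 'a"
  assumes K: "linear K" and S: "subspace S" "\<And>z. z \<in> S \<Longrightarrow> K z \<in> S"
    and sym: "\<And>x y. x \<in> S \<Longrightarrow> y \<in> S \<Longrightarrow> K x \<bullet> y = x \<bullet> K y"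
    and g: "0 < g" and lower: "\<And>z. z \<in> S \<Longrightarrow> g * norm z \<le> norm (K z)"
    and upper: "\<And>z. z \<in> S \<Longrightarrow> norm (K z) \<le> U * norm z" and x: "x \<in> S"
  shows "norm (x - (2 / (U\<^sup>2 + g\<^sup>2)) *\<^sub>R K (K x)) \<le> (U\<^sup>2 - g\<^sup>2) / (U\<^sup>2 + g\<^sup>2) * norm x"
proof (rule quadratic_form_norm_le[OF _ S(1) _ _ _ x])
  let ?c = "2 / (U\<^sup>2 + g\<^sup>2)"
  have d: "0 < U\<^sup>2 + g\<^sup>2" using g by (simp add: add_nonneg_pos)
  show "linear (\<lambda>x. x - ?c *\<^sub>R K (K x))"
    by (rule linearI) (auto simp: linear_add[OF K] linear_scale[OF K] algebra_simps)
  show "z - ?c *\<^sub>R K (K z) \<in> S" if "z \<in> S" for z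
    using that by (intro subspace_diff subspace_scale S)
  show "(x - ?c *\<^sub>R K (K x)) \<bullet> y = x \<bullet> (y - ?c *\<^sub>R K (K y))" if "x \<in> S" "y \<in> S" for x y
    using that by (simp add: inner_diff_left inner_diff_right sym S)
  show "\<bar>z \<bullet> (z - ?c *\<^sub>R K (K z))\<bar> \<le> (U\<^sup>2 - g\<^sup>2) / (U\<^sup>2 + g\<^sup>2) * (norm z)\<^sup>2" if z: "z \<in> S" for z
  proof -
    have "z \<bullet> K (K z) = (norm (K z))\<^sup>2"
      using sym[OF z S(2)[OF z]] by (simp add: dot_square_norm)
    then have eq: "z \<bullet> (z - ?c *\<^sub>R K (K z)) = (norm z)\<^sup>2 - ?c * (norm (K z))\<^sup>2"
      by (simp add: inner_diff_right dot_square_norm)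
    have "(g * norm z)\<^sup>2 \<le> (norm (K z))\<^sup>2" "(norm (K z))\<^sup>2 \<le> (U * norm z)\<^sup>2"
      using lower[OF z] upper[OF z] g by (auto intro!: power_mono)
    then have "?c * (g * norm z)\<^sup>2 \<le> ?c * (norm (K z))\<^sup>2" "?c * (norm (K z))\<^sup>2 \<le> ?c * (U * norm z)\<^sup>2"
      using d by (intro mult_left_mono; simp)+
    moreover have "(norm z)\<^sup>2 - ?c * (g * norm z)\<^sup>2 = (U\<^sup>2 - g\<^sup>2) / (U\<^sup>2 + g\<^sup>2) * (norm z)\<^sup>2"
      "(norm z)\<^sup>2 - ?c * (U * norm z)\<^sup>2 = - ((U\<^sup>2 - g\<^sup>2) / (U\<^sup>2 + g\<^sup>2) * (norm z)\<^sup>2)"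
    proof -
      have 1: "(U\<^sup>2 - g\<^sup>2) / (U\<^sup>2 + g\<^sup>2) = 1 - ?c * g\<^sup>2"
        and 2: "(U\<^sup>2 - g\<^sup>2) / (U\<^sup>2 + g\<^sup>2) = ?c * U\<^sup>2 - 1"
        using d by (auto simp: divide_simps)
      show "(norm z)\<^sup>2 - ?c * (g * norm z)\<^sup>2 = (U\<^sup>2 - g\<^sup>2) / (U\<^sup>2 + g\<^sup>2) * (norm z)\<^sup>2"
        unfolding 1 power_mult_distrib left_diff_distrib by (simp only: mult.assoc mult_1)
      show "(norm z)\<^sup>2 - ?c * (U * norm z)\<^sup>2 = - ((U\<^sup>2 - g\<^sup>2) / (U\<^sup>2 + g\<^sup>2) * (norm z)\<^sup>2)"
        unfolding 2 power_mult_distrib left_diff_distrib by (simp only: mult.assoc mult_1 minus_diff_eq)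
    qed
    ultimately show ?thesis unfolding eq by linarith
  qed
qed

text \<open>
  A solution \<open>e\<close> of \<open>K e = q\<close> is a fixed point of \<open>e \<mapsto> (e - c K (K e)) + c K q\<close>, a contraction for
  the right \<open>c\<close>; \<open>n\<close> iterations started at \<open>0\<close> leave an error \<open>r ^ n\<close> and enlarge the support of
  the right-hand side by at most \<open>4 n - 2\<close>.
\<close>

lemma banded_inverse_decay:
  fixes K :: "'a::real_inner \<Rightarrow> 'a" and D :: "nat \<Rightarrow> 'a set"
  assumes K: "linear K" and S: "subspace S" "\<And>z. z \<in> S \<Longrightarrow> K z \<in> S"
    and sym: "\<And>x y. x \<in> S \<Longrightarrow> y \<in> S \<Longrightarrow> K x \<bullet> y = x \<bullet> K y"
    and g: "0 < g" "g \<le> U" and lower: "\<And>z. z \<in> S \<Longrightarrow> g * norm z \<le> norm (K z)"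
    and upper: "\<And>z. z \<in> S \<Longrightarrow> norm (K z) \<le> U * norm z"
    and D: "\<And>m. subspace (D m)" "\<And>m z. z \<in> S \<Longrightarrow> z \<in> D m \<Longrightarrow> K z \<in> D (m + 2)" "mono D"
    and e: "e \<in> S" "K e \<in> D 0"
  shows "\<exists>y. y \<in> (if n = 0 then {0} else D (4 * n - 2)) \<and> y \<in> S
           \<and> norm (e - y) \<le> ((U\<^sup>2 - g\<^sup>2) / (U\<^sup>2 + g\<^sup>2)) ^ n * norm e"
proof (induction n)
  case 0
  show ?case using subspace_0[OF S(1)] by (intro exI[of _ 0]) auto
next
  case (Suc n)
  let ?c = "2 / (U\<^sup>2 + g\<^sup>2)" and ?r = "(U\<^sup>2 - g\<^sup>2) / (U\<^sup>2 + g\<^sup>2)"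
  obtain y where y: "y \<in> (if n = 0 then {0} else D (4 * n - 2))" "y \<in> S"
      and le: "norm (e - y) \<le> ?r ^ n * norm e"
    using Suc by blast
  have r: "0 \<le> ?r" using g by (intro divide_nonneg_nonneg) (auto intro: power_mono)
  \<comment> \<open>The right-hand side is written as \<open>K e\<close>, so that \<open>e\<close>
    is the fixed point and the new error is the contraction applied to \<open>e - y\<close>.\<close>
  define y' where "y' = y - ?c *\<^sub>R K (K y) + ?c *\<^sub>R K (K e)"
  have "e - y' = (e - y) - ?c *\<^sub>R K (K (e - y))"
    by (simp add: y'_def linear_diff[OF K] scaleR_diff_right)
  then have "norm (e - y') \<le> ?r * norm (e - y)"
    using normal_equation_contraction[OF K S sym g(1) lower upper subspace_diff[OF S(1) e(1) y(2)]]
    by metis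
  also have "\<dots> \<le> ?r * (?r ^ n * norm e)" by (rule mult_left_mono[OF le r])
  finally have "norm (e - y') \<le> ?r ^ Suc n * norm e" by (simp add: mult.assoc)
  moreover have "y' \<in> S"
    unfolding y'_def using y e by (intro subspace_add subspace_diff subspace_scale S)
  moreover have "y' \<in> D (4 * Suc n - 2)"
  proof -
    have mono: "z \<in> D m \<Longrightarrow> m \<le> k \<Longrightarrow> z \<in> D k" for z m k using D(3) by (auto dest: monoD)
    have "K (K e) \<in> D (4 * Suc n - 2)"
      by (rule mono[OF D(2)[OF S(2)[OF e(1)] e(2)]]) simp
    moreover have "y \<in> D (4 * Suc n - 2) \<and> K (K y) \<in> D (4 * Suc n - 2)"
    \<comment> \<open>The first iterate is a multiple of \<open>K (K e)\<close> alone and lies in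
      \<open>D 2\<close>, which is \<open>D (4 * 1 - 2)\<close>; only later steps add 4. The start
      is separate because natural subtraction would give \<open>D 0\<close> in place of
      \<open>{0}\<close>.\<close>
    proof (cases "n = 0")
      case True
      then show ?thesis using y linear_0[OF K] subspace_0[OF D(1)] by simp
    next
      case False
      then have yn: "y \<in> D (4 * n - 2)" using y by simp
      have "K (K y) \<in> D (4 * n - 2 + 2 + 2)" by (intro D(2) S y yn)
      with yn False show ?thesis by (auto intro: mono)
    qed
    ultimately show ?thesis
      unfolding y'_def by (intro subspace_add subspace_diff subspace_scale D(1)) auto
  qed
  ultimately show ?case by auto
qed

text \<open>\<open>u\<close> is projected orthogonally onto the image of \<open>Y\<close> under
  \<open>transpose G\<close>; the remainder is invisible to the constraints in \<open>Y\<close>. The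
  image part has squared norm \<open>y \<bullet> s\<close>, and \<open>low\<close> controls
  \<open>y\<close>. With \<open>Y\<close> the whole space this treats the full Jacobian, with
  vectors supported on the enforced constraints it treats the subproblem.\<close>

lemma transpose_range_decomposition:
  fixes G :: "real ^ 'p ^ 'd"
  assumes Y: "subspace Y" and low: "\<And>y. y \<in> Y \<Longrightarrow> g * (norm y)\<^sup>2 \<le> (norm (transpose G *v y))\<^sup>2"
    and g: "0 < g" and s: "\<And>y. y \<in> Y \<Longrightarrow> y \<bullet> (G *v u) = y \<bullet> s"
  shows "\<exists>u0 y. y \<in> Y \<and> u = u0 + transpose G *v y \<and> u0 \<bullet> (transpose G *v y) = 0
    \<and> (\<forall>y\<in>Y. y \<bullet> (G *v u0) = 0) \<and> g * (norm (transpose G *v y))\<^sup>2 \<le> (norm s)\<^sup>2"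
proof -
  let ?R = "(*v) (transpose G) ` Y"
  have R: "span ?R = ?R"
    by (intro span_eq_iff[THEN iffD2] linear_subspace_image Y) simp
  obtain u1 u0 where u1: "u1 \<in> span ?R" and u0: "\<And>w. w \<in> span ?R \<Longrightarrow> orthogonal u0 w"
    and u: "u = u1 + u0"
    using orthogonal_subspace_decomp_exists[of ?R u] by blast
  obtain y where y: "y \<in> Y" "u1 = transpose G *v y" using u1 unfolding R by (elim imageE)
  have ker: "y' \<bullet> (G *v u0) = 0" if "y' \<in> Y" for y'
  proof -
    have "orthogonal u0 (transpose G *v y')" using that by (intro u0 span_base imageI)
    then show ?thesis by (metis inner_transpose inner_commute orthogonal_def)
  qed
  have "(norm u1)\<^sup>2 = y \<bullet> (G *v u1)"
    using y by (metis dot_square_norm inner_transpose)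
  also have "\<dots> = y \<bullet> s"
    using s[OF y(1)] ker[OF y(1)] u by (simp add: matrix_vector_right_distrib inner_add_right)
  also have "\<dots> \<le> norm y * norm s" by (rule norm_cauchy_schwarz)
  finally have "(norm u1)\<^sup>2 \<le> norm y * norm s" .
  \<comment> \<open>Squaring avoids the square root of \<open>g\<close>; one factor
    \<open>(norm u1)\<^sup>2\<close> is cancelled at the end.\<close>
  then have "g * ((norm u1)\<^sup>2 * (norm u1)\<^sup>2) \<le> g * ((norm y * norm s) * (norm y * norm s))"
    using g by (intro mult_left_mono mult_mono) auto
  also have "\<dots> = (g * (norm y)\<^sup>2) * (norm s)\<^sup>2" by (simp add: power2_eq_square)
  also have "\<dots> \<le> (norm u1)\<^sup>2 * (norm s)\<^sup>2"
    using low[OF y(1)] y(2) by (intro mult_right_mono) auto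
  finally have "(norm u1)\<^sup>2 * (g * (norm u1)\<^sup>2) \<le> (norm u1)\<^sup>2 * (norm s)\<^sup>2"
    by (simp add: mult_ac)
  then have "g * (norm u1)\<^sup>2 \<le> (norm s)\<^sup>2"
    by (cases "u1 = 0") auto
  moreover have "u0 \<bullet> u1 = 0" using u0[OF u1] by (simp add: orthogonal_def)
  ultimately show ?thesis using y u ker by (metis add.commute)
qed

text \<open>On the kernel of \<open>G\<close> this is (A1). The row space component is paid for by
  \<open>norm (G *v u)\<close>, and the cross terms by half of the curvature. The deficit is what
  \<open>mu_hat\<close> in the subproblem and \<open>eta1\<close> in the merit function have to
  offset.\<close>

lemma reduced_hessian_bound:
  fixes H :: "real ^ 'p ^ 'p" and G :: "real ^ 'p ^ 'd"
  assumes H: "transpose H = H" "\<And>u. norm (H *v u) \<le> U * norm u" and U: "1 \<le> U"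
    and gamH: "0 < gamH" "gamH \<le> 1"
    and A1: "\<And>u. G *v u = 0 \<Longrightarrow> gamH * (norm u)\<^sup>2 \<le> u \<bullet> (H *v u)"
    and gamG: "0 < gamG" and A2: "\<And>y. gamG * (norm y)\<^sup>2 \<le> (norm (transpose G *v y))\<^sup>2"
  shows "gamH / 2 * (norm u)\<^sup>2 - 7 / 2 * U\<^sup>2 / (gamH * gamG) * (norm (G *v u))\<^sup>2 \<le> u \<bullet> (H *v u)"
proof -
  obtain u0 y where u: "u = u0 + transpose G *v y" and orth: "u0 \<bullet> (transpose G *v y) = 0"
    and ker: "\<And>y. y \<bullet> (G *v u0) = 0" and y: "gamG * (norm (transpose G *v y))\<^sup>2 \<le> (norm (G *v u))\<^sup>2"
    using transpose_range_decomposition[OF subspace_UNIV A2 gamG(1), of u "G *v u"] by (auto simp del: transpose_matrix_vector)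
  define u1 where "u1 = transpose G *v y"
  have "G *v u0 = 0" using ker[of "G *v u0"] by simp
  then have q0: "gamH * (norm u0)\<^sup>2 \<le> u0 \<bullet> (H *v u0)" by (rule A1)
  have "\<bar>u0 \<bullet> (H *v u1)\<bar> \<le> norm u0 * (U * norm u1)"
    by (intro order_trans[OF Cauchy_Schwarz_ineq2] mult_left_mono H) auto
  moreover have "\<bar>u1 \<bullet> (H *v u1)\<bar> \<le> norm u1 * (U * norm u1)"
    by (intro order_trans[OF Cauchy_Schwarz_ineq2] mult_left_mono H) auto
  moreover have "u \<bullet> (H *v u) = u0 \<bullet> (H *v u0) + 2 * (u0 \<bullet> (H *v u1)) + u1 \<bullet> (H *v u1)"
  proof -
    have "u1 \<bullet> (H *v u0) = u0 \<bullet> (H *v u1)"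
      using inner_transpose[of H u1 u0] H(1) by (simp add: inner_commute)
    then show ?thesis
      unfolding u u1_def[symmetric] by (simp add: matrix_vector_right_distrib inner_add_left inner_add_right)
  qed
  ultimately have low: "gamH * (norm u0)\<^sup>2 - 2 * (norm u0 * (U * norm u1)) - norm u1 * (U * norm u1)
      \<le> u \<bullet> (H *v u)" using q0 by linarith
  have nu: "(norm u)\<^sup>2 = (norm u0)\<^sup>2 + (norm u1)\<^sup>2"
    using orth unfolding u u1_def by (simp add: power2_norm_eq_inner inner_add_left inner_add_right inner_commute)
  define q where "q = U\<^sup>2 / gamH"
  have U2: "U \<le> U\<^sup>2" using U by (simp add: power2_eq_square)
  have q: "U\<^sup>2 \<le> q" using gamH unfolding q_def by (simp add: pos_le_divide_eq mult_left_le)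
  have "7 / 2 * U\<^sup>2 / (gamH * gamG) * (norm (G *v u))\<^sup>2 = 7 / 2 * q * ((norm (G *v u))\<^sup>2 / gamG)"
    by (simp add: q_def)
  also have "\<dots> \<ge> 7 / 2 * q * (norm u1)\<^sup>2"
    using y gamG q U2 U by (intro mult_left_mono) (auto simp: u1_def field_simps)
  finally have c: "7 / 2 * q * (norm u1)\<^sup>2 \<le> 7 / 2 * U\<^sup>2 / (gamH * gamG) * (norm (G *v u))\<^sup>2" .
  \<comment> \<open>Young's inequality, weighted to use exactly \<open>gamH / 2\<close> of the
    curvature; it costs \<open>2 * q\<close>.\<close>
  have "0 \<le> (gamH * norm u0 - 2 * U * norm u1)\<^sup>2 / (2 * gamH)" using gamH by simp
  also have "\<dots> = gamH / 2 * (norm u0)\<^sup>2 - 2 * (norm u0 * (U * norm u1)) + 2 * q * (norm u1)\<^sup>2"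
    using gamH by (simp add: q_def field_simps power2_eq_square)
  finally have sq: "0 \<le> gamH / 2 * (norm u0)\<^sup>2 - 2 * (norm u0 * (U * norm u1)) + 2 * q * (norm u1)\<^sup>2" .
  \<comment> \<open>The other \<open>3 / 2 * q\<close> of the constant \<open>7 / 2\<close> pays for
    the quadratic form of \<open>H\<close> at \<open>u1\<close> and for the share of
    \<open>u1\<close> in \<open>(norm u)\<^sup>2\<close>.\<close>
  have "(U + gamH / 2) * (norm u1)\<^sup>2 \<le> (3 / 2 * q) * (norm u1)\<^sup>2"
    using q U2 U gamH by (intro mult_right_mono) auto
  then have "norm u1 * (U * norm u1) + gamH / 2 * (norm u1)\<^sup>2 \<le> 3 / 2 * q * (norm u1)\<^sup>2"
    by (simp add: power2_eq_square algebra_simps)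
  then show ?thesis using low sq c unfolding nu by (simp add: algebra_simps)
qed

section \<open>Subproblems\<close>

lemma grad_eqI:
  assumes "(g has_derivative (\<lambda>h. d \<bullet> h)) (at x)"
  shows "grad g x = d"
  unfolding grad_def frechet_derivative_at[OF assms, symmetric]
  by (simp add: vec_eq_iff inner_axis)

lemma norm_Pair_mono: "norm a \<le> norm a' \<Longrightarrow> norm b \<le> norm b' \<Longrightarrow> norm (a, b) \<le> norm (a', b')"
  by (auto simp: norm_Pair intro!: add_mono power_mono)

lemma transpose_norm_le:
  fixes G :: "real ^ 'p ^ 'd"
  assumes "0 \<le> U" "\<And>u. norm (G *v u) \<le> U * norm u"
  shows "norm (transpose G *v v) \<le> U * norm v"
proof -
  let ?w = "transpose G *v v"
  have "(norm ?w)\<^sup>2 = v \<bullet> (G *v ?w)"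
    by (metis dot_square_norm inner_transpose)
  also have "\<dots> \<le> norm v * (U * norm ?w)"
    by (intro order_trans[OF norm_cauchy_schwarz] mult_left_mono assms) auto
  finally have le: "norm ?w * norm ?w \<le> (U * norm v) * norm ?w"
    by (simp only: power2_eq_square mult_ac)
  then show ?thesis
    using assms(1) by (cases "norm ?w = 0") (auto simp del: transpose_matrix_vector)
qed

text \<open>Zero extension makes the gradient in all coordinates supported in \<open>W\<close>, and
  \<open>submat_mult_vec\<close> moves every restriction from the matrices to the vectors. The full
  \<open>H\<close> and \<open>G\<close> under one outer projection can then be compared with the
  Newton system.\<close>

lemma sub_solution_stationary:
  fixes H :: "real ^ 'p ^ 'p" and G :: "real ^ 'p ^ 'd"
  assumes sol: "sub_primal_dual_solution E np nd H G gx cv mu W w z" and H: "transpose H = H"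
  shows "subvec np W (H *v w + gx + mu *\<^sub>R (transpose G *v subvec nd (W_hat E W) (cv + G *v w))
    + transpose G *v z) = 0"
proof -
  let ?P = "subvec np W" and ?R = "subvec nd (W_hat E W)"
  let ?Q = "subvec nd (W - W_tilde E W)"
  let ?A = "submat np np W W H" and ?B = "submat nd np (W_hat E W) W G"
    and ?C = "submat nd np (W - W_tilde E W) W G"
  have w: "?P w = w" and z: "?Q z = z"
    and g0: "grad (\<lambda>u. sub_objective E np nd H G gx cv mu W u
                  + z \<bullet> sub_constraint E np nd G cv W u) w = 0"
    using sol by (auto simp: sub_primal_dual_solution_def)
  let ?d = "?A *v w + ?P gx + mu *\<^sub>R (transpose ?B *v (?R cv + ?B *v w)) + transpose ?C *v z"
  have bl: "((\<lambda>u. M *v u) has_derivative (\<lambda>h. M *v h)) F" for M :: "real ^ 'p ^ 'n" and F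
    by (rule bounded_linear_imp_has_derivative) simp
  have symA: "w \<bullet> (?A *v h) = h \<bullet> (?A *v w)" for h
    using inner_transpose[of ?A w h] H by (simp add: transpose_submat inner_commute del: transpose_matrix_vector)
  have "((\<lambda>u. 1 / 2 * (u \<bullet> (?A *v u)) + u \<bullet> ?P gx
      + mu / 2 * ((?R cv + ?B *v u) \<bullet> (?R cv + ?B *v u)) + z \<bullet> (?Q cv + ?C *v u))
      has_derivative (\<lambda>h. ?d \<bullet> h)) (at w)"
    apply (rule derivative_eq_intros bl | rule refl)+
    apply (rule ext)
    using symA
    by (simp add: inner_add_left inner_add_right inner_transpose_right inner_commute algebra_simps
        del: transpose_matrix_vector)
  then have "grad (\<lambda>u. sub_objective E np nd H G gx cv mu W u
                  + z \<bullet> sub_constraint E np nd G cv W u) w = ?d"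
    unfolding sub_objective_def sub_constraint_def power2_norm_eq_inner by (rule grad_eqI)
  then have d0: "?d = 0" using g0 by (rule trans[OF sym])
  have "?A *v w = ?P (H *v w)" "?B *v w = ?R (G *v w)"
    using w by (simp_all add: submat_mult_vec)
  moreover have "transpose ?C *v z = ?P (transpose G *v z)"
    using z by (simp add: submat_mult_vec transpose_submat del: transpose_matrix_vector)
  moreover have "transpose ?B *v (?R cv + ?R (G *v w)) = ?P (transpose G *v ?R (cv + G *v w))"
    by (simp add: submat_mult_vec transpose_submat subvec_subvec subvec_linear_simps del: transpose_matrix_vector)
  ultimately show ?thesis
    using d0 by (simp add: subvec_linear_simps del: transpose_matrix_vector)
qed

section \<open>The KKT operator of one subproblem: symmetry and singular value bounds\<close>

locale subproblem =
  fixes E :: "('v::finite \<times> 'v) set" and np :: "'p::finite \<Rightarrow> 'v" and nd :: "'d::finite \<Rightarrow> 'v"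
    and H :: "real ^ 'p ^ 'p" and G :: "real ^ 'p ^ 'd"
    and U gamH gamG mu :: real and W :: "'v set"
  assumes symE: "sym E" and H_sym: "transpose H = H"
    and H_band: "banded E 2 np np H" and G_band: "banded E 1 nd np G"
    and H_norm: "\<And>u. norm (H *v u) \<le> U * norm u" and G_norm: "\<And>u. norm (G *v u) \<le> U * norm u"
    and U: "1 \<le> U" and gamH: "0 < gamH" "gamH \<le> 1" and gamG: "0 < gamG" "gamG \<le> 1"
    and A1: "\<And>u. G *v u = 0 \<Longrightarrow> gamH * (norm u)\<^sup>2 \<le> u \<bullet> (H *v u)"
    and A2: "\<And>y. gamG * (norm y)\<^sup>2 \<le> (norm (transpose G *v y))\<^sup>2"
    and mu: "4 * U\<^sup>2 / (gamG * gamH) \<le> mu"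
begin

abbreviation "P \<equiv> subvec np W"
abbreviation "Q \<equiv> subvec nd (W - W_tilde E W)"
abbreviation "R \<equiv> subvec nd (W_hat E W)"

text \<open>
  \<open>K\<close> is the KKT matrix of the subproblem on its index set \<open>S\<close>, extended by zero; \<open>Y\<close> and \<open>g\<close> are the
  constants \<open>Ups_K\<close> and \<open>gam_K\<close>, with \<open>U\<close> in the role of \<open>Ups_hat\<close>.
\<close>

definition A :: "real ^ 'p \<Rightarrow> real ^ 'p" where
  "A u = H *v u + mu *\<^sub>R (transpose G *v R (G *v u))"

definition K :: "(real ^ 'p) \<times> (real ^ 'd) \<Rightarrow> (real ^ 'p) \<times> (real ^ 'd)" where
  "K z = (P (A (fst z) + transpose G *v snd z), Q (G *v fst z))"

definition S :: "((real ^ 'p) \<times> (real ^ 'd)) set" where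
  "S = {z. P (fst z) = fst z \<and> Q (snd z) = snd z}"

definition Y :: real where "Y = 3 / 2 * mu * U\<^sup>2"

definition g :: real where "g = gamH ^ 3 * gamG\<^sup>2 / (75 * Y ^ 6)"

lemma GT_norm: "norm (transpose G *v v) \<le> U * norm v"
  using U by (intro transpose_norm_le G_norm) auto

lemma mu_ge_4: "4 \<le> mu"
proof -
  have "gamG * gamH \<le> 1" using gamG gamH by (simp add: mult_le_one)
  moreover have "1 \<le> U\<^sup>2" using U by simp
  ultimately have "4 * (gamG * gamH) \<le> 4 * U\<^sup>2" by linarith
  then have "4 \<le> 4 * U\<^sup>2 / (gamG * gamH)" using gamG gamH by (simp add: pos_le_divide_eq)
  with mu show ?thesis by linarith
qed

text \<open>The factor \<open>3 / 2\<close> leaves \<open>mu / 2 * U\<^sup>2\<close>, which is at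
  least \<open>2 * U\<^sup>2\<close> as \<open>4 \<le> mu\<close>, for the norm of \<open>H\<close>
  and that of the constraint blocks.\<close>

lemma Y_ge: "2 * U + mu * U\<^sup>2 \<le> Y" "6 \<le> Y"
proof -
  have U2: "U \<le> U\<^sup>2" using U by (simp add: power2_eq_square)
  have "4 * U\<^sup>2 \<le> mu * U\<^sup>2" using mu_ge_4 by (intro mult_right_mono) auto
  then show "2 * U + mu * U\<^sup>2 \<le> Y" "6 \<le> Y" using U2 U unfolding Y_def by linarith+
qed

lemma g_pos: "0 < g"
  using Y_ge gamH gamG by (simp add: g_def)

lemma A_linear: "linear A"
  unfolding A_def
  by (rule linearI) (simp_all add: subvec_linear_simps matrix_vector_right_distrib
      matrix_vector_mult_scaleR algebra_simps del: transpose_matrix_vector)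

lemma K_linear: "linear K"
  unfolding K_def
  by (rule linearI) (simp_all add: subvec_linear_simps matrix_vector_right_distrib
      linear_add[OF A_linear] linear_scale[OF A_linear]
      matrix_vector_mult_scaleR algebra_simps del: transpose_matrix_vector)

lemma A_norm: "norm (A u) \<le> (U + mu * U\<^sup>2) * norm u"
proof -
  have "norm (transpose G *v R (G *v u)) \<le> U * (U * norm u)"
    using U by (intro order_trans[OF GT_norm] mult_left_mono order_trans[OF norm_subvec_le] G_norm) auto
  then have "mu * norm (transpose G *v R (G *v u)) \<le> mu * (U * (U * norm u))"
    using mu_ge_4 by (intro mult_left_mono) auto
  then show ?thesis
    using norm_triangle_ineq[of "H *v u" "mu *\<^sub>R (transpose G *v R (G *v u))"] H_norm[of u] mu_ge_4
    unfolding A_def norm_scaleR abs_of_nonneg[OF order_trans[OF zero_le_numeral mu_ge_4]]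
    by (simp only: power2_eq_square distrib_right mult.assoc)
qed

lemma S_subspace: "subspace S"
  unfolding S_def subspace_def by (auto simp: subvec_linear_simps)

lemma K_S: "K z \<in> S"
  by (simp add: S_def K_def subvec_subvec)

lemma GT_supported: "Q v = v \<Longrightarrow> P (transpose G *v v) = transpose G *v v"
  by (rule banded_supported[OF banded_transpose[OF symE G_band] _ closed_nbhd_interior_subset[OF symE]])

text \<open>A constraint with a variable in \<open>W\<close> is either enforced or penalized, never
  dropped.\<close>

lemma G_split:
  assumes "P u = u" shows "G *v u = Q (G *v u) + R (G *v u)"
proof -
  have "subvec nd ((W - W_tilde E W) \<union> W_hat E W) (G *v u) = G *v u"
    by (rule banded_supported[OF G_band assms]) (rule equalityD1[OF closed_nbhd_1_eq])
  moreover have "subvec nd ((W - W_tilde E W) \<union> W_hat E W) x = Q x + R x" for x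
    using W_tilde_disjoint[of W E] by (auto simp: vec_eq_iff)
  ultimately show ?thesis by metis
qed

lemma A_sym: "A u \<bullet> v = u \<bullet> A v"
proof -
  have "(H *v u) \<bullet> v = u \<bullet> (H *v v)" using inner_transpose[of H u v] H_sym by simp
  moreover have "(transpose G *v R (G *v u)) \<bullet> v = u \<bullet> (transpose G *v R (G *v v))"
    by (metis inner_transpose inner_subvec inner_commute)
  ultimately show ?thesis
    by (simp add: A_def inner_add_left inner_add_right del: transpose_matrix_vector)
qed

lemma K_sym:
  assumes "x \<in> S" "y \<in> S" shows "K x \<bullet> y = x \<bullet> K y"
proof -
  have x: "P (fst x) = fst x" "Q (snd x) = snd x" and y: "P (fst y) = fst y" "Q (snd y) = snd y"
    using assms by (auto simp: S_def)
  have 1: "P a \<bullet> fst y = a \<bullet> fst y" "fst x \<bullet> P a = fst x \<bullet> a" for a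
    using x y by (metis inner_subvec)+
  have 2: "Q a \<bullet> snd y = a \<bullet> snd y" "snd x \<bullet> Q a = snd x \<bullet> a" for a
    using x y by (metis inner_subvec)+
  have 3: "fst x \<bullet> (transpose G *v snd y) = (G *v fst x) \<bullet> snd y"
    by (metis inner_transpose inner_commute)
  show ?thesis
    unfolding K_def inner_prod_def fst_conv snd_conv 1 2
    by (simp add: inner_add_left inner_add_right A_sym inner_transpose 3 del: transpose_matrix_vector)
qed

lemma K_upper: "norm (K z) \<le> Y * norm z"
proof -
  obtain u v where z: "z = (u, v)" by (cases z)
  have "norm (K z) \<le> norm (A u + transpose G *v v, G *v u)"
    unfolding K_def z by (auto intro!: norm_Pair_mono norm_subvec_le)
  also have "\<dots> = norm ((A u, 0) + (transpose G *v v, G *v u))" by simp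
  also have "\<dots> \<le> norm (A u) + norm (transpose G *v v, G *v u)"
    using norm_triangle_ineq[of "(A u, 0 :: real^'d)" "(transpose G *v v, G *v u)"] by (simp add: norm_Pair)
  also have "norm (transpose G *v v, G *v u) \<le> norm (U *\<^sub>R v, U *\<^sub>R u)"
    using U by (intro norm_Pair_mono) (simp_all add: GT_norm G_norm del: transpose_matrix_vector)
  also have "norm (U *\<^sub>R v, U *\<^sub>R u) = U * norm z"
    using U norm_scaleR[of U "(v, u)"] by (simp add: z norm_Pair add.commute)
  also have "norm (A u) \<le> (U + mu * U\<^sup>2) * norm z"
    using U mu_ge_4 norm_fst_le[of u v] unfolding z
    by (intro order_trans[OF A_norm] mult_left_mono) auto
  finally have "norm (K z) \<le> (2 * U + mu * U\<^sup>2) * norm z" by (simp add: algebra_simps)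
  also have "\<dots> \<le> Y * norm z" using Y_ge by (intro mult_right_mono) auto
  finally show ?thesis .
qed

text \<open>The saddle point system is solved by estimates, with \<open>N\<close> bounding both
  residuals. The row space part \<open>u1\<close> of \<open>u\<close> is controlled by the
  constraint residual; testing the first equation with the kernel part \<open>u0\<close> removes the
  multiplier and leaves the curvature of \<open>A\<close>; then (A2) recovers \<open>v\<close> from
  \<open>transpose G *v v\<close>. The total loss is
  \<open>7 * Y\<^sup>2 / (gamG\<^sup>2 * gamH)\<close>.\<close>

lemma K_lower:
  assumes zS: "z \<in> S" shows "g * norm z \<le> norm (K z)"
proof -
  obtain u v where z: "z = (u, v)" by (cases z)
  have u: "P u = u" and v: "Q v = v" using zS by (auto simp: S_def z)
  let ?r = "P (A u + transpose G *v v)" and ?s = "Q (G *v u)"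
  define N where "N = norm (K z)"
  have r: "norm ?r \<le> N" and s: "norm ?s \<le> N"
    unfolding N_def K_def z using norm_fst_le[of ?r ?s] norm_snd_le[of ?s ?r] by auto
  have N0: "0 \<le> N" by (simp add: N_def)
  have sub: "subspace {y. Q y = y}" by (auto simp: subspace_def subvec_linear_simps)
  have proj: "y \<bullet> (G *v u) = y \<bullet> ?s" if "y \<in> {y. Q y = y}" for y
    using that inner_subvec[of nd "W - W_tilde E W" y "G *v u"] by simp
  have "\<exists>u0 y. y \<in> {y. Q y = y} \<and> u = u0 + transpose G *v y \<and> u0 \<bullet> (transpose G *v y) = 0
    \<and> (\<forall>y\<in>{y. Q y = y}. y \<bullet> (G *v u0) = 0) \<and> gamG * (norm (transpose G *v y))\<^sup>2 \<le> (norm ?s)\<^sup>2"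
    by (rule transpose_range_decomposition[OF sub A2 gamG(1)]) (rule proj)
  then obtain u0 y where y: "Q y = y" and uu: "u = u0 + transpose G *v y"
      and ker': "\<forall>y\<in>{y. Q y = y}. y \<bullet> (G *v u0) = 0"
      and u1: "gamG * (norm (transpose G *v y))\<^sup>2 \<le> (norm ?s)\<^sup>2"
    unfolding mem_Collect_eq by (elim exE conjE)
  have ker: "y \<bullet> (G *v u0) = 0" if "Q y = y" for y using ker' that by simp
  define u1 where "u1 = transpose G *v y"
  have u1P: "P u1 = u1" using GT_supported y by (simp add: u1_def del: transpose_matrix_vector)
  have u0P: "P u0 = u0"
  proof -
    have "u0 = u - u1" using uu by (simp add: u1_def del: transpose_matrix_vector)
    then show ?thesis using u u1P by (simp add: subvec_linear_simps)
  qed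
  have "Q (G *v u0) \<bullet> (G *v u0) = 0" by (rule ker) (simp add: subvec_subvec)
  then have "Q (G *v u0) \<bullet> Q (G *v u0) = 0"
    using inner_subvec[of nd "W - W_tilde E W" "Q (G *v u0)" "G *v u0"] by (simp add: subvec_subvec)
  then have QG: "Q (G *v u0) = 0" by simp
  \<comment> \<open>As the enforced rows annihilate \<open>u0\<close>, all of \<open>G *v u0\<close>
    sits at penalized constraints, so the penalty sees its full norm.\<close>
  then have RG: "R (G *v u0) = G *v u0" using G_split[OF u0P] by simp
  \<comment> \<open>Since \<open>gamG \<le> 1\<close>, it may replace its own square root, which
    keeps the later bounds rational.\<close>
  have sq_le: "gamG * a \<le> b" if "gamG * a\<^sup>2 \<le> b\<^sup>2" "0 \<le> a" "0 \<le> b" for a b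
  proof (rule power2_le_imp_le)
    have "gamG * (gamG * a\<^sup>2) \<le> 1 * (gamG * a\<^sup>2)" using gamG by (intro mult_right_mono) auto
    with that(1) show "(gamG * a)\<^sup>2 \<le> b\<^sup>2" by (simp add: power2_eq_square mult_ac)
  qed (use that in auto)
  have b: "gamG * norm u1 \<le> N"
  proof (rule sq_le)
    have "(norm ?s)\<^sup>2 \<le> N\<^sup>2" using s by (intro power_mono) auto
    then show "gamG * (norm u1)\<^sup>2 \<le> N\<^sup>2" using u1 unfolding u1_def by linarith
  qed (use N0 in auto)
  \<comment> \<open>The deficit \<open>7 / 2\<close> of \<open>reduced_hessian_bound\<close> fits
    below the 4 in \<open>mu_hat\<close>.\<close>
  have "7 / 2 * U\<^sup>2 / (gamH * gamG) \<le> mu"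
  proof -
    have "7 / 2 * U\<^sup>2 / (gamH * gamG) \<le> 4 * U\<^sup>2 / (gamH * gamG)"
      using gamH gamG by (intro divide_right_mono) auto
    then show ?thesis using mu by (simp add: mult.commute)
  qed
  then have "7 / 2 * U\<^sup>2 / (gamH * gamG) * (norm (G *v u0))\<^sup>2 \<le> mu * (norm (G *v u0))\<^sup>2"
    by (intro mult_right_mono) auto
  moreover have "u0 \<bullet> A u0 = u0 \<bullet> (H *v u0) + mu * (norm (G *v u0))\<^sup>2"
  proof -
    have "u0 \<bullet> (transpose G *v (G *v u0)) = (norm (G *v u0))\<^sup>2"
      by (metis inner_transpose inner_commute dot_square_norm)
    then show ?thesis by (simp add: A_def inner_add_right RG del: transpose_matrix_vector)
  qed
  ultimately have q: "gamH / 2 * (norm u0)\<^sup>2 \<le> u0 \<bullet> A u0"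
    using reduced_hessian_bound[OF H_sym H_norm U gamH A1 gamG(1) A2, of u0] by linarith
  have UY: "U + mu * U\<^sup>2 \<le> Y" using Y_ge U by linarith
  have AY: "norm (A x) \<le> Y * norm x" for x
    by (rule order_trans[OF A_norm]) (intro mult_right_mono UY norm_ge_zero)
  \<comment> \<open>\<open>u0\<close> is orthogonal to the span of the enforced rows, so the
    multiplier term drops out.\<close>
  have "u0 \<bullet> ?r = u0 \<bullet> A u0 + u0 \<bullet> A u1"
  proof -
    have "u0 \<bullet> (transpose G *v v) = 0"
      using ker[OF v] inner_transpose[of G v u0] by (simp only: inner_commute)
    moreover have "u0 \<bullet> ?r = u0 \<bullet> (A u + transpose G *v v)"
      using u0P inner_subvec[of np W u0 "A u + transpose G *v v"] by simp
    ultimately show ?thesis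
      unfolding uu u1_def linear_add[OF A_linear] inner_add_right by linarith
  qed
  moreover have "u0 \<bullet> ?r \<le> norm u0 * N"
    by (intro order_trans[OF norm_cauchy_schwarz] mult_left_mono r) auto
  moreover have "- (u0 \<bullet> A u1) \<le> norm u0 * (Y * norm u1)"
    using order_trans[OF Cauchy_Schwarz_ineq2 mult_left_mono[OF AY norm_ge_zero], of u0 u1] by linarith
  ultimately have "gamH / 2 * (norm u0)\<^sup>2 \<le> norm u0 * (N + Y * norm u1)"
    using q unfolding distrib_left by linarith
  then have "norm u0 * (gamH * norm u0) \<le> norm u0 * (2 * (N + Y * norm u1))"
    by (simp add: power2_eq_square algebra_simps)
  then have a: "gamH * norm u0 \<le> 2 * (N + Y * norm u1)"
    using N0 Y_ge by (cases "u0 = 0") auto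
  have "gamG * (gamH * norm u0) \<le> gamG * (2 * (N + Y * norm u1))"
    using a gamG by (intro mult_left_mono) auto
  also have "\<dots> = 2 * (gamG * N) + 2 * Y * (gamG * norm u1)" by (simp add: algebra_simps)
  also have "\<dots> \<le> 2 * N + 2 * Y * N"
  proof -
    have "gamG * N \<le> N" using gamG N0 by (simp add: mult_left_le_one_le)
    moreover have "2 * Y * (gamG * norm u1) \<le> 2 * Y * N" using b Y_ge by (intro mult_left_mono) auto
    ultimately show ?thesis by linarith
  qed
  finally have c1: "gamG * (gamH * norm u0) \<le> 2 * N + 2 * Y * N" .
  have c2: "gamH * (gamG * norm u1) \<le> N"
    using mult_mono[of gamH 1 "gamG * norm u1" N] b gamH gamG N0 by auto
  have nu: "norm u \<le> norm u0 + norm u1" unfolding uu u1_def by (rule norm_triangle_ineq)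
  then have "gamG * gamH * norm u \<le> gamG * gamH * (norm u0 + norm u1)"
    using gamG gamH by (intro mult_left_mono) auto
  also have "\<dots> \<le> (2 * Y + 3) * N" using c1 c2 by (simp add: algebra_simps)
  also have "\<dots> \<le> 3 * Y * N" using Y_ge N0 by (intro mult_right_mono) auto
  finally have nU: "gamG * gamH * norm u \<le> 3 * Y * N" .
  \<comment> \<open>\<open>transpose G *v v\<close> is already supported in \<open>W\<close>, so the
    projected first equation gives it without loss.\<close>
  have GTv: "norm (transpose G *v v) \<le> N + Y * norm u"
  proof -
    have "transpose G *v v = ?r - P (A u)"
      using GT_supported[OF v] by (simp add: subvec_linear_simps del: transpose_matrix_vector)
    then have "norm (transpose G *v v) \<le> norm ?r + norm (P (A u))"
      by (metis norm_triangle_ineq4)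
    also have "\<dots> \<le> N + Y * norm u"
      by (intro add_mono r order_trans[OF norm_subvec_le AY])
    finally show ?thesis .
  qed
  have "gamG * norm v \<le> N + Y * norm u"
  proof (rule sq_le)
    show "gamG * (norm v)\<^sup>2 \<le> (N + Y * norm u)\<^sup>2"
      using A2[of v] power_mono[OF GTv, of 2] by (simp del: transpose_matrix_vector)
  qed (use N0 Y_ge in auto)
  then have "gamG * gamH * (gamG * norm v) \<le> gamG * gamH * (N + Y * norm u)"
    using gamG gamH by (intro mult_left_mono) auto
  also have "\<dots> = gamG * gamH * N + Y * (gamG * gamH * norm u)" by (simp add: algebra_simps)
  also have "\<dots> \<le> N + Y * (3 * Y * N)"
  proof -
    have "gamG * gamH * N \<le> N" using gamG gamH N0 by (simp add: mult_le_one mult_left_le_one_le)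
    moreover have "Y * (gamG * gamH * norm u) \<le> Y * (3 * Y * N)" using nU Y_ge by (intro mult_left_mono) auto
    ultimately show ?thesis by linarith
  qed
  finally have nV: "gamG * gamH * (gamG * norm v) \<le> N + 3 * Y\<^sup>2 * N" by (simp add: power2_eq_square mult_ac)
  have "gamG * (gamG * gamH * norm u) \<le> 3 * Y * N"
  proof -
    have "gamG * (gamG * gamH * norm u) \<le> 1 * (gamG * gamH * norm u)"
      using gamG gamH by (intro mult_right_mono) auto
    with nU show ?thesis by simp
  qed
  moreover have "gamG\<^sup>2 * gamH * norm z \<le> gamG\<^sup>2 * gamH * (norm u + norm v)"
    using gamH unfolding z by (intro mult_left_mono norm_Pair_le) auto
  ultimately have "gamG\<^sup>2 * gamH * norm z \<le> 3 * Y * N + N + 3 * Y\<^sup>2 * N"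
    using nV by (simp add: power2_eq_square algebra_simps)
  also have "\<dots> \<le> 7 * Y\<^sup>2 * N"
  proof -
    have "Y * 1 \<le> Y * Y" using Y_ge by (intro mult_left_mono) auto
    then have "3 * Y + 1 + 3 * Y\<^sup>2 \<le> 7 * Y\<^sup>2" using Y_ge unfolding power2_eq_square by linarith
    then have "(3 * Y + 1 + 3 * Y\<^sup>2) * N \<le> 7 * Y\<^sup>2 * N" using N0 by (rule mult_right_mono)
    then show ?thesis by (simp add: algebra_simps)
  qed
  finally have main: "gamG\<^sup>2 * gamH * norm z \<le> 7 * Y\<^sup>2 * N" .
  \<comment> \<open>From here on only slack is spent: \<open>g\<close> carries two more factors
    \<open>gamH\<close>, and \<open>75 * Y ^ 6\<close> in place of
    \<open>7 * Y\<^sup>2\<close>.\<close>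
  have Y4: "1 \<le> Y ^ 4" using Y_ge by simp
  have "gamH ^ 3 * gamG\<^sup>2 * norm z = gamH\<^sup>2 * (gamG\<^sup>2 * gamH * norm z)"
    by (simp add: power3_eq_cube power2_eq_square)
  also have "\<dots> \<le> 1 * (gamG\<^sup>2 * gamH * norm z)"
    using gamH by (intro mult_right_mono mult_nonneg_nonneg) (auto simp: power_le_one)
  also have "\<dots> \<le> 7 * Y\<^sup>2 * N" using main by simp
  also have "\<dots> \<le> 75 * Y\<^sup>2 * N * Y ^ 4"
  proof -
    have "7 * Y\<^sup>2 * N * 1 \<le> 75 * Y\<^sup>2 * N * Y ^ 4"
      using N0 Y4 by (intro mult_mono) (auto intro!: mult_right_mono)
    then show ?thesis by simp
  qed
  also have "\<dots> = N * (75 * Y ^ 6)" by (simp add: power2_eq_square eval_nat_numeral)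
  finally show ?thesis using Y_ge by (simp add: g_def pos_divide_le_eq N_def[symmetric])
qed

lemma g_less_Y: "g < Y"
proof -
  have "gamH ^ 3 * gamG\<^sup>2 \<le> 1" using gamH gamG by (intro mult_le_one power_le_one) auto
  moreover have "1 \<le> Y ^ 6" using Y_ge by simp
  ultimately have "gamH ^ 3 * gamG\<^sup>2 \<le> 1 * (75 * Y ^ 6)" by linarith
  then have "g \<le> 1" using Y_ge unfolding g_def by (subst pos_divide_le_eq) auto
  with Y_ge show ?thesis by linarith
qed

lemmas g_le_Y = less_imp_le[OF g_less_Y]

end

lemma subvec_disjoint_eq_0: "subvec n I x = x \<Longrightarrow> V \<inter> I = {} \<Longrightarrow> subvec n V x = 0"
  unfolding subvec_eq_iff by (auto simp: vec_eq_iff)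

section \<open>Locality of the KKT operator and the error away from the boundary\<close>

context subproblem
begin

text \<open>The offset 2 makes \<open>D 0\<close> contain the residual of the truncated Newton direction.\<close>

definition D :: "nat \<Rightarrow> ((real ^ 'p) \<times> (real ^ 'd)) set" where
  "D m = {z. subvec np (closed_nbhd E (m + 2) (- W)) (fst z) = fst z
           \<and> subvec nd (closed_nbhd E (m + 2) (- W)) (snd z) = snd z}"

lemma D_subspace: "subspace (D m)"
  unfolding D_def subspace_def by (auto simp: subvec_linear_simps)

lemma D_mono: "mono D"
proof (rule monoI)
  fix m n :: nat assume "m \<le> n"
  then have "closed_nbhd E (m + 2) (- W) \<subseteq> closed_nbhd E (n + 2) (- W)"
    by (intro closed_nbhd_mono) auto
  then show "D m \<subseteq> D n" by (auto simp: D_def subvec_eq_iff)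
qed

lemma subvec_commute: "subvec n I x = x \<Longrightarrow> subvec n I (subvec n J x) = subvec n J x"
  by (auto simp: subvec_eq_iff)

text \<open>Both summands reach distance 2: \<open>H\<close> by its band, the penalty by one step
  through \<open>G\<close> and one step back. This is the increment in \<open>K_D\<close>; two
  applications of \<open>K\<close> per iteration make it 4.\<close>

lemma A_supported:
  assumes "subvec np I u = u" shows "subvec np (closed_nbhd E 2 I) (A u) = A u"
proof -
  have 1: "subvec nd (closed_nbhd E 1 I) (G *v u) = G *v u"
    by (rule banded_supported[OF G_band assms]) simp
  have "subvec np (closed_nbhd E 2 I) (transpose G *v R (G *v u)) = transpose G *v R (G *v u)"
    by (rule banded_supported[OF banded_transpose[OF symE G_band] subvec_commute[OF 1]
          closed_nbhd_twice])
  moreover have "subvec np (closed_nbhd E 2 I) (H *v u) = H *v u"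
    by (rule banded_supported[OF H_band assms]) simp
  ultimately show ?thesis by (simp add: A_def subvec_linear_simps del: transpose_matrix_vector)
qed

lemma K_D:
  assumes "z \<in> D m" shows "K z \<in> D (m + 2)"
proof -
  let ?I = "closed_nbhd E (m + 2) (- W)" and ?J = "closed_nbhd E (m + 2 + 2) (- W)"
  have u: "subvec np ?I (fst z) = fst z" and v: "subvec nd ?I (snd z) = snd z"
    using assms by (auto simp: D_def)
  have sub: "closed_nbhd E 2 ?I \<subseteq> ?J"
    using closed_nbhd_closed_nbhd[of E 2 "m + 2" "- W"] by (simp add: add.commute)
  have sub1: "closed_nbhd E 1 ?I \<subseteq> ?J"
    using closed_nbhd_mono[of ?I ?I 1 2 E] sub by auto
  have "subvec np ?J (A (fst z)) = A (fst z)"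
    using A_supported[OF u] sub by (auto simp: subvec_eq_iff)
  moreover have "subvec np ?J (transpose G *v snd z) = transpose G *v snd z"
    by (rule banded_supported[OF banded_transpose[OF symE G_band] v sub1])
  ultimately have "subvec np ?J (A (fst z) + transpose G *v snd z) = A (fst z) + transpose G *v snd z"
    by (simp add: subvec_linear_simps del: transpose_matrix_vector)
  moreover have "subvec nd ?J (G *v fst z) = G *v fst z"
    by (rule banded_supported[OF G_band u sub1])
  ultimately show ?thesis
    unfolding D_def K_def by (simp add: subvec_commute del: transpose_matrix_vector)
qed

text \<open>The iterate \<open>y\<close> is supported within \<open>4 * (b div 4)\<close> of the
  complement of \<open>W\<close>, while \<open>V\<close> is farther than \<open>b\<close> from it.
  On \<open>V\<close> the error \<open>e\<close> thus coincides with \<open>e - y\<close>.\<close>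

lemma interior_decay:
  assumes e: "e \<in> S" "K e \<in> D 0" and V: "closed_nbhd E b V \<subseteq> W"
  shows "norm (subvec np V (fst e), subvec nd V (snd e))
    \<le> ((Y\<^sup>2 - g\<^sup>2) / (Y\<^sup>2 + g\<^sup>2)) ^ (b div 4) * (norm (K e) / g)"
proof -
  let ?n = "b div 4" and ?r = "(Y\<^sup>2 - g\<^sup>2) / (Y\<^sup>2 + g\<^sup>2)"
  obtain y where y: "y \<in> (if ?n = 0 then {0} else D (4 * ?n - 2))"
      and le: "norm (e - y) \<le> ?r ^ ?n * norm e"
  proof -
    have "\<exists>y. y \<in> (if ?n = 0 then {0} else D (4 * ?n - 2)) \<and> y \<in> S
           \<and> norm (e - y) \<le> ?r ^ ?n * norm e"
      by (rule banded_inverse_decay[OF K_linear S_subspace K_S K_sym g_pos g_le_Y K_lower K_upper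
        D_subspace K_D D_mono e])
    then show ?thesis using that by (elim exE conjE)
  qed
  have disj: "V \<inter> closed_nbhd E b (- W) = {}"
    by (rule closed_nbhd_disjoint_commute[OF symE V])
  have "subvec np V (fst y) = 0 \<and> subvec nd V (snd y) = 0"
  proof (cases "?n = 0")
    case True
    then show ?thesis using y by (simp add: subvec_linear_simps)
  next
    case False
    \<comment> \<open>The offset 2 in \<open>D\<close> meets the 2 saved by the first iterate: the
      support radius is \<open>4 * ?n\<close>, at most \<open>b\<close>.\<close>
    then have "4 * ?n - 2 + 2 \<le> b" by (simp add: div_greater_zero_iff)
    then have "closed_nbhd E (4 * ?n - 2 + 2) (- W) \<subseteq> closed_nbhd E b (- W)"
      by (intro closed_nbhd_mono) auto
    with disj have dis: "V \<inter> closed_nbhd E (4 * ?n - 2 + 2) (- W) = {}" by blast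
    have "y \<in> D (4 * ?n - 2)" using y False by simp
    then have "subvec np (closed_nbhd E (4 * ?n - 2 + 2) (- W)) (fst y) = fst y"
      "subvec nd (closed_nbhd E (4 * ?n - 2 + 2) (- W)) (snd y) = snd y"
      unfolding D_def by blast+
    from this[THEN subvec_disjoint_eq_0, OF dis] show ?thesis by blast
  qed
  then have "norm (subvec np V (fst e), subvec nd V (snd e))
      = norm (subvec np V (fst (e - y)), subvec nd V (snd (e - y)))"
    by (simp add: subvec_linear_simps)
  also have "\<dots> \<le> norm (fst (e - y), snd (e - y))"
    by (intro norm_Pair_mono norm_subvec_le)
  also have "\<dots> \<le> ?r ^ ?n * norm e" using le by (simp only: prod.collapse)
  also have "\<dots> \<le> ?r ^ ?n * (norm (K e) / g)"
  proof (intro mult_left_mono)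
    show "norm e \<le> norm (K e) / g"
      using K_lower[OF e(1)] g_pos by (simp add: pos_le_divide_eq mult.commute)
    show "0 \<le> ?r ^ ?n"
      using g_pos g_le_Y by (intro zero_le_power divide_nonneg_nonneg) (auto intro: power_mono)
  qed
  finally show ?thesis .
qed

text \<open>The optimality conditions of the subproblem are subtracted from the Newton equations.
  Enforced rows have no columns outside \<open>W\<close>, so the constraint residual vanishes; the
  penalty gradient vanishes at \<open>dx\<close> because \<open>cv = - (G *v dx)\<close>. What
  remains are the variables outside \<open>W\<close> and the multipliers \<open>R dl\<close> of
  penalized constraints, which the subproblem does not carry.\<close>

lemma K_solution_error:
  assumes sol: "sub_primal_dual_solution E np nd H G gx cv mu W w z"
    and newton: "newton_direction H G gx cv dx dl"
  defines "e \<equiv> (P dx - w, Q dl - z)" and "Z \<equiv> closed_nbhd E 2 W"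
  shows "e \<in> S" "K e \<in> D 0" "norm (K e) \<le> Y * norm (subvec np Z dx, subvec nd Z dl)"
proof -
  have w: "P w = w" and z: "Q z = z" and con: "Q cv + Q (G *v P w) = 0"
    using sol by (auto simp: sub_primal_dual_solution_def sub_constraint_def submat_mult_vec)
  have gx: "gx = - (H *v dx) - transpose G *v dl" and cv: "cv = - (G *v dx)"
    using newton unfolding newton_direction_def
    by (metis add.commute add_diff_cancel_left' minus_add_distrib minus_minus diff_conv_add_uminus,
        metis minus_minus)
  have stat: "P (H *v w) + P gx + mu *\<^sub>R P (transpose G *v R (cv + G *v w)) + P (transpose G *v z) = 0"
    using sub_solution_stationary[OF sol H_sym] by (simp add: subvec_linear_simps del: transpose_matrix_vector)
  show S: "e \<in> S" using w z by (simp add: e_def S_def subvec_linear_simps subvec_subvec)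
  let ?x = "dx - P dx"
  have QG: "Q (G *v P dx) = Q (G *v dx)"
    by (rule banded_restrict[OF G_band symE closed_nbhd_interior_subset[OF symE], symmetric])
  have snd0: "snd (K e) = 0"
  proof -
    have "Q (G *v (P dx - w)) = Q (G *v dx) + Q cv"
    proof -
      have "Q cv = - Q (G *v w)" using con w by (metis eq_neg_iff_add_eq_0)
      then show ?thesis using QG by (simp add: matrix_vector_mult_diff_distrib subvec_linear_simps)
    qed
    also have "\<dots> = 0" by (simp add: cv subvec_linear_simps linear_neg[OF linear_subvec])
    finally show ?thesis by (simp add: K_def e_def)
  qed
  \<comment> \<open>Variables in \<open>W\<close> meet only constraints in
    \<open>closed_nbhd E 1 W\<close>; the multipliers there split into those kept by the subproblem
    and those it lacks.\<close>
  have PGT: "P (transpose G *v dl) = P (transpose G *v Q dl) + P (transpose G *v R dl)"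
  proof -
    have "P (transpose G *v dl) = P (transpose G *v subvec nd ((W - W_tilde E W) \<union> W_hat E W) dl)"
      by (rule banded_restrict[OF banded_transpose[OF symE G_band] symE]) (rule equalityD1[OF closed_nbhd_1_eq])
    also have "subvec nd ((W - W_tilde E W) \<union> W_hat E W) dl = Q dl + R dl"
      using W_tilde_disjoint[of W E] by (auto simp: vec_eq_iff)
    finally show ?thesis
      by (simp add: matrix_vector_right_distrib subvec_linear_simps del: transpose_matrix_vector)
  qed
  have fst: "fst (K e) = - P (A ?x + transpose G *v R dl)"
  proof -
    have "fst (K e) + P (A ?x + transpose G *v R dl)
      = P (H *v dx) - P (H *v w) + mu *\<^sub>R (P (transpose G *v R (G *v dx)) - P (transpose G *v R (G *v w)))
        + P (transpose G *v dl) - P (transpose G *v z)"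
      unfolding K_def e_def fst_conv snd_conv A_def PGT
      by (simp add: matrix_vector_right_distrib matrix_vector_mult_diff_distrib subvec_linear_simps
          algebra_simps del: transpose_matrix_vector)
    also have "\<dots> = 0"
    proof -
      have "R (cv + G *v w) = R (G *v w) - R (G *v dx)"
        by (simp add: cv subvec_linear_simps linear_neg[OF linear_subvec])
      then have "P (H *v w) + P gx + mu *\<^sub>R (P (transpose G *v R (G *v w)) - P (transpose G *v R (G *v dx)))
          + P (transpose G *v z) = 0"
        using stat by (simp add: matrix_vector_mult_diff_distrib subvec_linear_simps del: transpose_matrix_vector)
      then show ?thesis
        unfolding gx
        by (simp add: subvec_linear_simps linear_neg[OF linear_subvec] algebra_simps del: transpose_matrix_vector)
    qed
    finally show ?thesis by (simp add: eq_neg_iff_add_eq_0 del: transpose_matrix_vector)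
  qed
  let ?B = "closed_nbhd E 2 (- W)"
  have xW: "subvec np (- W) ?x = ?x" by (auto simp: subvec_eq_iff)
  have "subvec np ?B (A ?x) = A ?x" by (rule A_supported[OF xW])
  moreover have "subvec np ?B (transpose G *v R dl) = transpose G *v R dl"
  proof (rule banded_supported[OF banded_transpose[OF symE G_band]])
    show "subvec nd (closed_nbhd E 1 (- W)) (R dl) = R dl"
      using W_hat_subset(1)[of E W] by (auto simp: subvec_eq_iff)
    show "closed_nbhd E 1 (closed_nbhd E 1 (- W)) \<subseteq> ?B"
      by (rule closed_nbhd_twice)
  qed
  ultimately have "subvec np ?B (A ?x + transpose G *v R dl) = A ?x + transpose G *v R dl"
    by (simp add: subvec_linear_simps del: transpose_matrix_vector)
  note 3 = subvec_commute[OF this, of W]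
  show "K e \<in> D 0"
    unfolding D_def mem_Collect_eq fst snd0 add_0 linear_neg[OF linear_subvec]
    by (simp only: 3 linear_0[OF linear_subvec])
  \<comment> \<open>The bands allow \<open>?x\<close> to be cut to \<open>Z\<close>. A bound by the
    local part of the Newton direction, rather than by its full norm, is what can be summed over the
    subdomains.\<close>
  have AZ: "P (A ?x) = P (A (subvec np Z ?x))"
  proof -
    have "P (H *v ?x) = P (H *v subvec np Z ?x)"
      by (rule banded_restrict[OF H_band symE]) (simp add: Z_def)
    moreover have "R (G *v ?x) = R (G *v subvec np Z ?x)"
    proof (rule banded_restrict[OF G_band symE])
      have "closed_nbhd E 1 (W_hat E W) \<subseteq> closed_nbhd E 1 (closed_nbhd E 1 W)"
        by (intro closed_nbhd_mono W_hat_subset order_refl)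
      also have "\<dots> \<subseteq> Z" unfolding Z_def by (rule closed_nbhd_twice)
      finally show "closed_nbhd E 1 (W_hat E W) \<subseteq> Z" .
    qed
    ultimately show ?thesis by (simp add: A_def subvec_linear_simps del: transpose_matrix_vector)
  qed
  let ?N = "norm (subvec np Z dx, subvec nd Z dl)"
  have "norm (subvec np Z ?x) \<le> norm (subvec np Z dx)"
    by (rule norm_le_componentwise_cart) auto
  then have n1: "norm (subvec np Z ?x) \<le> ?N" using norm_fst_le order_trans by blast
  have "W_hat E W \<subseteq> Z"
    using W_hat_subset(2)[of E W] closed_nbhd_mono[of W W 1 2 E] by (auto simp: Z_def)
  then have n2: "norm (R dl) \<le> ?N" using norm_subvec_mono norm_snd_le order_trans by blast
  have "norm (K e) = norm (fst (K e))" using snd0 by (cases "K e") (simp add: norm_Pair)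
  also have "\<dots> = norm (P (A (subvec np Z ?x)) + P (transpose G *v R dl))"
    unfolding fst norm_minus_cancel by (simp only: linear_add[OF linear_subvec] AZ)
  also have "\<dots> \<le> norm (A (subvec np Z ?x)) + norm (transpose G *v R dl)"
    by (intro order_trans[OF norm_triangle_ineq] add_mono norm_subvec_le)
  also have "\<dots> \<le> (U + mu * U\<^sup>2) * ?N + U * ?N"
    using U mu_ge_4
    by (intro add_mono order_trans[OF A_norm] order_trans[OF GT_norm] mult_left_mono n1 n2) auto
  also have "\<dots> = (2 * U + mu * U\<^sup>2) * ?N" by (simp add: algebra_simps)
  also have "\<dots> \<le> Y * ?N" using Y_ge by (intro mult_right_mono) auto
  finally show "norm (K e) \<le> Y * ?N" .
qed

text \<open>Since \<open>1 \<le> b\<close>, the set \<open>V\<close> avoids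
  \<open>W_tilde E W\<close>; both \<open>P\<close> and \<open>Q\<close> act as the identity there,
  and the truncation is invisible on \<open>V\<close>.\<close>

lemma interior_error:
  assumes sol: "sub_primal_dual_solution E np nd H G gx cv mu W w z"
    and newton: "newton_direction H G gx cv dx dl"
    and V: "closed_nbhd E b V \<subseteq> W" "1 \<le> b"
  shows "norm (subvec np V (dx - w), subvec nd V (dl - z))
    \<le> ((Y\<^sup>2 - g\<^sup>2) / (Y\<^sup>2 + g\<^sup>2)) ^ (b div 4) * (Y / g)
       * norm (subvec np (closed_nbhd E 2 W) dx, subvec nd (closed_nbhd E 2 W) dl)"
proof -
  let ?r = "((Y\<^sup>2 - g\<^sup>2) / (Y\<^sup>2 + g\<^sup>2)) ^ (b div 4)"
  note K = K_solution_error[OF sol newton]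
  have "V \<subseteq> W - W_tilde E W" by (rule subset_minus_W_tilde[OF symE V(2,1)])
  then have "subvec np V (dx - w) = subvec np V (P dx - w)" "subvec nd V (dl - z) = subvec nd V (Q dl - z)"
    by (auto simp: vec_eq_iff)
  then have "norm (subvec np V (dx - w), subvec nd V (dl - z))
      \<le> ?r * (norm (K (P dx - w, Q dl - z)) / g)"
    using interior_decay[OF K(1,2) V(1)] by simp
  also have "\<dots> \<le> ?r * ((Y * norm (subvec np (closed_nbhd E 2 W) dx, subvec nd (closed_nbhd E 2 W) dl)) / g)"
    using g_pos g_le_Y K(3)
    by (intro mult_left_mono divide_right_mono zero_le_power divide_nonneg_nonneg) (auto intro: power_mono)
  finally show ?thesis by simp
qed

end

section \<open>Assembling the subproblem errors\<close>

text \<open>Each counted \<open>l\<close> is sent to a pair of nodes, one of \<open>W l\<close> near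
  \<open>k\<close> and one of \<open>V l\<close>. Disjointness of the \<open>V l\<close> makes the
  map injective, and the diameter bound limits the second node. Indices with empty
  \<open>V l\<close> are left out, as their \<open>W l\<close> could repeat without limit.\<close>

lemma card_overlap_le:
  fixes E :: "('v::finite \<times> 'v) set"
  assumes growth: "growth_bounds E b M W pW pG"
    and disj: "disjoint_family_on V {1..M}" and sub: "\<And>l. l \<in> {1..M} \<Longrightarrow> V l \<subseteq> W l"
  shows "real (card {l \<in> {1..M}. V l \<noteq> {} \<and> k \<in> closed_nbhd E 2 (W l)})
    \<le> poly pG (poly pW (real b)) * poly pG (real b + 2)"
proof -
  let ?T = "{l \<in> {1..M}. V l \<noteq> {} \<and> k \<in> closed_nbhd E 2 (W l)}"
  let ?B = "{j. gdist E k j \<le> enat 2}"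
  let ?C = "\<lambda>i. {j. ereal_of_enat (gdist E i j) \<le> ereal (poly pW (real b))}"
  have "\<forall>l\<in>?T. \<exists>p. fst p \<in> W l \<and> gdist E k (fst p) \<le> enat 2 \<and> snd p \<in> V l"
  proof
    fix l assume l: "l \<in> ?T"
    then obtain v where "v \<in> V l" by blast
    moreover obtain j where "j \<in> W l" "gdist E k j \<le> enat 2"
      using l closed_nbhdE[of k E 2 "W l"] by auto
    ultimately show "\<exists>p. fst p \<in> W l \<and> gdist E k (fst p) \<le> enat 2 \<and> snd p \<in> V l"
      by (intro exI[of _ "(j, v)"]) simp
  qed
  from bchoice[OF this] obtain h
    where h: "\<And>l. l \<in> ?T \<Longrightarrow> fst (h l) \<in> W l \<and> gdist E k (fst (h l)) \<le> enat 2 \<and> snd (h l) \<in> V l"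
    by blast
  have "inj_on h ?T"
  proof (rule inj_onI)
    fix l l' assume l: "l \<in> ?T" and l': "l' \<in> ?T" and eq: "h l = h l'"
    then have "snd (h l) \<in> V l \<inter> V l'" using h[OF l] h[OF l'] by simp
    then show "l = l'" using disj l l' unfolding disjoint_family_on_def by blast
  qed
  moreover have "h ` ?T \<subseteq> Sigma ?B ?C"
  proof (rule image_subsetI)
    fix l assume l: "l \<in> ?T"
    have "snd (h l) \<in> W l" using h[OF l] sub l by blast
    then have "ereal_of_enat (gdist E (fst (h l)) (snd (h l))) \<le> ereal (poly pW (real b))"
      using h[OF l] l growth unfolding growth_bounds_def by blast
    then show "h l \<in> Sigma ?B ?C" using h[OF l] by (cases "h l") auto
  qed
  ultimately have "card ?T \<le> card (Sigma ?B ?C)"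
    by (intro card_inj_on_le) auto
  also have "card (Sigma ?B ?C) = (\<Sum>i\<in>?B. card (?C i))" by (rule card_SigmaI) auto
  finally have "real (card ?T) \<le> (\<Sum>i\<in>?B. real (card (?C i)))"
    by (simp only: of_nat_sum[symmetric] of_nat_le_iff)
  also have "\<dots> \<le> (\<Sum>i\<in>?B. poly pG (poly pW (real b)))"
    by (intro sum_mono ball_bounds(2)[OF growth])
  also have "\<dots> = real (card ?B) * poly pG (poly pW (real b))" by simp
  also have "\<dots> \<le> poly pG (real b + 2) * poly pG (poly pW (real b))"
  proof (rule mult_right_mono)
    \<comment> \<open>The ball is enlarged before its bound is applied, because \<open>pG\<close> is
      not assumed monotone.\<close>
    have "?B \<subseteq> {j. gdist E k j \<le> enat (b + 2)}"
      by (rule Collect_mono) (intro impI, rule gdist_mono, assumption, simp)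
    then have "card ?B \<le> card {j. gdist E k j \<le> enat (b + 2)}" by (intro card_mono) auto
    then show "real (card ?B) \<le> poly pG (real b + 2)"
      using ball_bounds(1)[OF growth, of k "b + 2"] by (simp add: add.commute)
    show "0 \<le> poly pG (poly pW (real b))"
      by (rule order_trans[OF of_nat_0_le_iff ball_bounds(2)[OF growth]])
  qed
  finally show ?thesis by (simp add: mult.commute)
qed

text \<open>Supplies the hypothesis \<open>1 \<le> A\<close> of \<open>decay_constant_le\<close>.
  That \<open>i\<close> lies in its own ball is the diameter bound for the pair \<open>i\<close>,
  \<open>i\<close>, which also forces the radius to be nonnegative.\<close>

lemma one_le_poly_ball:
  fixes E :: "('v::finite \<times> 'v) set"
  assumes growth: "growth_bounds E b M W pW pG" and l: "l \<in> {1..M}" and i: "i \<in> W l"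
  shows "1 \<le> poly pG (poly pW (real b))"
proof -
  let ?C = "{j. ereal_of_enat (gdist E i j) \<le> ereal (poly pW (real b))}"
  have "i \<in> ?C" using growth l i unfolding growth_bounds_def by blast
  then have "card ?C \<noteq> 0" by (metis card_eq_0_iff empty_iff finite)
  then have "1 \<le> real (card ?C)" by linarith
  then show ?thesis using ball_bounds(2)[OF growth, of i] by linarith
qed

lemma norm_sq_le_cover:
  fixes nd :: "'a::finite \<Rightarrow> 'v"
  assumes "finite L" and "\<And>k. \<exists>l\<in>L. nd k \<in> V l \<and> a $ k = a' l $ k"
  shows "(norm a)\<^sup>2 \<le> (\<Sum>l\<in>L. (norm (subvec nd (V l) (a' l)))\<^sup>2)"
proof -
  have "(norm a)\<^sup>2 = (\<Sum>k\<in>UNIV. (a $ k)\<^sup>2)"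
    unfolding power2_norm_eq_inner inner_vec_def by (simp add: power2_eq_square)
  also have "\<dots> \<le> (\<Sum>k\<in>UNIV. \<Sum>l\<in>L. if nd k \<in> V l then (a' l $ k)\<^sup>2 else 0)"
  proof (rule sum_mono)
    fix k
    obtain l where l: "l \<in> L" "nd k \<in> V l" "a $ k = a' l $ k" using assms(2) by blast
    have "(if nd k \<in> V l then (a' l $ k)\<^sup>2 else 0) \<le> (\<Sum>l\<in>L. if nd k \<in> V l then (a' l $ k)\<^sup>2 else 0)"
      by (rule member_le_sum[OF l(1) _ assms(1)]) simp
    with l show "(a $ k)\<^sup>2 \<le> (\<Sum>l\<in>L. if nd k \<in> V l then (a' l $ k)\<^sup>2 else 0)" by simp
  qed
  finally show ?thesis unfolding norm_subvec_sq by (subst sum.swap)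
qed

text \<open>Double counting: coordinate \<open>k\<close> enters the sum once for each
  \<open>l\<close> with \<open>nd k \<in> Z l\<close>.\<close>

lemma sum_norm_subvec_le:
  fixes nd :: "'a::finite \<Rightarrow> 'v"
  assumes "finite L" and "\<And>i. real (card {l \<in> L. i \<in> Z l}) \<le> N"
  shows "(\<Sum>l\<in>L. (norm (subvec nd (Z l) v))\<^sup>2) \<le> N * (norm v)\<^sup>2"
proof -
  have "(\<Sum>l\<in>L. (norm (subvec nd (Z l) v))\<^sup>2)
      = (\<Sum>k\<in>UNIV. \<Sum>l\<in>L. if nd k \<in> Z l then (v $ k)\<^sup>2 else 0)"
    unfolding norm_subvec_sq by (rule sum.swap)
  also have "\<dots> = (\<Sum>k\<in>UNIV. real (card {l \<in> L. nd k \<in> Z l}) * (v $ k)\<^sup>2)"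
    using assms(1) by (simp add: sum.inter_filter[symmetric])
  also have "\<dots> \<le> (\<Sum>k\<in>UNIV. N * (v $ k)\<^sup>2)"
    by (intro sum_mono mult_right_mono assms(2)) auto
  also have "\<dots> = N * (norm v)\<^sup>2"
    unfolding power2_norm_eq_inner inner_vec_def by (simp add: power2_eq_square sum_distrib_left)
  finally show ?thesis .
qed

lemma norm_Pair_sq: "(norm (a, b))\<^sup>2 = (norm a)\<^sup>2 + (norm b)\<^sup>2"
  by (simp add: norm_Pair)

text \<open>Summing squares lets the overlap enter as \<open>sqrt N\<close>, independently of the
  number of subdomains.\<close>

lemma assembled_error:
  fixes np :: "'p::finite \<Rightarrow> 'v" and nd :: "'d::finite \<Rightarrow> 'v"
  assumes L: "finite L" "(\<Union>l\<in>L. V l) = UNIV"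
    and Dxt: "\<And>l k. l \<in> L \<Longrightarrow> np k \<in> V l \<Longrightarrow> Dxt $ k = w l $ k"
    and Dlt: "\<And>l k. l \<in> L \<Longrightarrow> nd k \<in> V l \<Longrightarrow> Dlt $ k = z l $ k"
    and err: "\<And>l. l \<in> L \<Longrightarrow> norm (subvec np (V l) (dx - w l), subvec nd (V l) (dl - z l))
               \<le> C * norm (subvec np (Z l) dx, subvec nd (Z l) dl)"
    and C: "0 \<le> C" and N: "\<And>i. real (card {l \<in> L. i \<in> Z l}) \<le> N"
  shows "norm (dx - Dxt, dl - Dlt) \<le> C * sqrt N * norm (dx, dl)"
proof (rule power2_le_imp_le)
  have N0: "0 \<le> N" using N[of undefined] of_nat_0_le_iff order_trans by blast
  have cov: "\<exists>l\<in>L. i \<in> V l" for i using L(2) by blast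
  have "(norm (dx - Dxt))\<^sup>2 \<le> (\<Sum>l\<in>L. (norm (subvec np (V l) (dx - w l)))\<^sup>2)"
    using cov Dxt by (intro norm_sq_le_cover L(1)) (metis vector_minus_component)
  moreover have "(norm (dl - Dlt))\<^sup>2 \<le> (\<Sum>l\<in>L. (norm (subvec nd (V l) (dl - z l)))\<^sup>2)"
    using cov Dlt by (intro norm_sq_le_cover L(1)) (metis vector_minus_component)
  ultimately have "(norm (dx - Dxt, dl - Dlt))\<^sup>2
      \<le> (\<Sum>l\<in>L. (norm (subvec np (V l) (dx - w l), subvec nd (V l) (dl - z l)))\<^sup>2)"
    unfolding norm_Pair_sq sum.distrib by linarith
  also have "\<dots> \<le> (\<Sum>l\<in>L. (C * norm (subvec np (Z l) dx, subvec nd (Z l) dl))\<^sup>2)"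
    by (intro sum_mono power_mono err) auto
  also have "\<dots> = C\<^sup>2 * ((\<Sum>l\<in>L. (norm (subvec np (Z l) dx))\<^sup>2) + (\<Sum>l\<in>L. (norm (subvec nd (Z l) dl))\<^sup>2))"
    unfolding power_mult_distrib norm_Pair_sq by (simp add: sum.distrib sum_distrib_left algebra_simps)
  also have "\<dots> \<le> C\<^sup>2 * (N * (norm dx)\<^sup>2 + N * (norm dl)\<^sup>2)"
    by (intro mult_left_mono add_mono sum_norm_subvec_le L(1) N) auto
  also have "\<dots> = (C * sqrt N * norm (dx, dl))\<^sup>2"
    using N0 unfolding power_mult_distrib norm_Pair_sq by (simp add: algebra_simps)
  finally show "(norm (dx - Dxt, dl - Dlt))\<^sup>2 \<le> (C * sqrt N * norm (dx, dl))\<^sup>2" .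
  show "0 \<le> C * sqrt N * norm (dx, dl)" using C N0 by simp
qed

text \<open>Rounding \<open>b\<close> down loses at most three powers of \<open>rho\<close>: the
  \<open>rho\<^sup>2\<close> in \<open>Ups_mu\<close> and the \<open>rho\<close> in
  \<open>Ups_mu_b\<close>. The factor \<open>A\<close> may leave the square root as
  \<open>1 \<le> A\<close>. Passing from \<open>Y / g\<close> to \<open>Y * Y / g\<^sup>2\<close>
  and inserting \<open>sqrt 2 / sqrt (1 - rho\<^sup>2)\<close>, which is at least 1, is
  slack.\<close>

lemma decay_constant_le:
  fixes Y g A B :: real
  assumes g: "0 < g" "g < Y" and A: "1 \<le> A" and B: "0 \<le> B"
  defines "r \<equiv> (Y\<^sup>2 - g\<^sup>2) / (Y\<^sup>2 + g\<^sup>2)"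
  defines "rho \<equiv> root 4 r"
  shows "r ^ (b div 4) * (Y / g) * sqrt (A * B)
    \<le> sqrt 2 * (Y / (g\<^sup>2 * rho\<^sup>2)) * Y / (rho * sqrt (1 - rho\<^sup>2)) * A * sqrt B * rho ^ b"
proof -
  have "g\<^sup>2 < Y\<^sup>2" using g by (intro power_strict_mono) auto
  then have r: "0 < r" "r < 1" unfolding r_def using g by (auto simp: pos_divide_less_eq add_pos_pos)
  have rho: "0 < rho" "rho < 1" "rho ^ 4 = r" using r by (auto simp: rho_def real_root_pow_pos)
  have "r ^ (b div 4) * rho ^ 3 = rho ^ (4 * (b div 4) + 3)"
    by (simp add: rho(3)[symmetric] power_mult power_add)
  also have "\<dots> \<le> rho ^ b" using rho by (intro power_decreasing) auto
  finally have 1: "r ^ (b div 4) \<le> rho ^ b / rho ^ 3" using rho by (simp add: pos_le_divide_eq)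
  have "g * Y \<le> Y * Y" using g by (intro mult_right_mono) auto
  then have 2: "Y / g \<le> Y * Y / g\<^sup>2" using g by (simp add: power2_eq_square field_simps)
  have 3: "sqrt (A * B) \<le> A * sqrt B"
  proof -
    have "A * 1 \<le> A * A" using A by (intro mult_left_mono) auto
    then have "sqrt A \<le> A" using A by (intro real_le_lsqrt) (auto simp: power2_eq_square)
    then show ?thesis using B by (simp add: real_sqrt_mult mult_right_mono)
  qed
  have q: "0 < 1 - rho\<^sup>2" "1 - rho\<^sup>2 \<le> 1" using rho by (auto simp: power_less_one_iff)
  then have "1 \<le> 1 / sqrt (1 - rho\<^sup>2)" by (simp add: pos_le_divide_eq)
  moreover have "1 \<le> sqrt 2" by simp
  ultimately have 4: "1 \<le> sqrt 2 * (1 / sqrt (1 - rho\<^sup>2))"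
    using mult_mono[of 1 "sqrt 2" 1 "1 / sqrt (1 - rho\<^sup>2)"] by simp
  have "r ^ (b div 4) * (Y / g) * sqrt (A * B) \<le> rho ^ b / rho ^ 3 * (Y * Y / g\<^sup>2) * (A * sqrt B)"
    using r g rho A B by (intro mult_mono 1 2 3) auto
  also have "\<dots> \<le> rho ^ b / rho ^ 3 * (Y * Y / g\<^sup>2) * (A * sqrt B) * (sqrt 2 * (1 / sqrt (1 - rho\<^sup>2)))"
    using mult_left_mono[OF 4, of "rho ^ b / rho ^ 3 * (Y * Y / g\<^sup>2) * (A * sqrt B)"] rho g A B by simp
  also have "\<dots> = sqrt 2 * (Y / (g\<^sup>2 * rho\<^sup>2)) * Y / (rho * sqrt (1 - rho\<^sup>2)) * A * sqrt B * rho ^ b"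
    by (simp add: power2_eq_square power3_eq_cube mult_ac)
  finally show ?thesis .
qed

section \<open>Derivatives of the Lagrangian and of the merit function\<close>

text \<open>Smoothness in the form in which it is consumed: directional derivatives can be
  differentiated once more, so that the Hessian is the derivative of the gradient map.\<close>

definition C2_on :: "('a::euclidean_space \<Rightarrow> 'b::real_normed_vector) \<Rightarrow> 'a set \<Rightarrow> bool" where
  "C2_on g U \<longleftrightarrow> (\<forall>y\<in>U. g differentiable (at y)
     \<and> (\<forall>v. (\<lambda>x. frechet_derivative g (at x) v) differentiable (at y)))"

lemma Ck_near_3_imp_C2_on:
  assumes "Ck_near 3 g X" obtains U where "open U" "X \<subseteq> U" "C2_on g U"
proof -
  obtain U where "open U" "X \<subseteq> U" "Ck_on 3 g U" using assms by (auto simp: Ck_near_def)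
  moreover from \<open>Ck_on 3 g U\<close> have "C2_on g U" by (simp add: numeral_3_eq_3 C2_on_def)
  ultimately show ?thesis using that by blast
qed

lemma C2_on_subset: "C2_on g U \<Longrightarrow> V \<subseteq> U \<Longrightarrow> C2_on g V"
  by (auto simp: C2_on_def)

lemma C2_on_D:
  assumes "C2_on g U" "y \<in> U"
  shows "(g has_derivative frechet_derivative g (at y)) (at y)"
    and "(\<lambda>x. frechet_derivative g (at x) v) differentiable (at y)"
  using assms by (auto simp: C2_on_def frechet_derivative_works[symmetric])

lemma differentiable_transform_open:
  assumes "f differentiable (at x)" "open U" "x \<in> U" "\<And>y. y \<in> U \<Longrightarrow> f y = g y"
  shows "g differentiable (at x)"
  using assms unfolding differentiable_def
  by (meson has_derivative_transform_within_open)

lemma frechet_derivative_add_linear: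
  assumes f: "f differentiable (at y)" and c: "c differentiable (at y)" and L: "bounded_linear L"
  shows "frechet_derivative (\<lambda>x. f x + L (c x)) (at y)
    = (\<lambda>v. frechet_derivative f (at y) v + L (frechet_derivative c (at y) v))"
proof -
  have "((\<lambda>x. f x + L (c x)) has_derivative
      (\<lambda>v. frechet_derivative f (at y) v + L (frechet_derivative c (at y) v))) (at y)"
    using f c unfolding frechet_derivative_works
    by (intro has_derivative_add bounded_linear.has_derivative[OF L])
  then show ?thesis by (rule frechet_derivative_at[symmetric])
qed

lemma C2_on_add_linear:
  assumes U: "open U" and f: "C2_on f U" and c: "C2_on c U" and L: "bounded_linear L"
  shows "C2_on (\<lambda>x. f x + L (c x)) U"
  unfolding C2_on_def
proof (intro ballI conjI allI)
  fix y v assume y: "y \<in> U"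
  have Ld: "(\<lambda>x. L (h x)) differentiable (at y)" if "h differentiable (at y)" for h
    using that bounded_linear.has_derivative[OF L] unfolding differentiable_def by blast
  show "(\<lambda>x. f x + L (c x)) differentiable (at y)"
    using f c y by (intro differentiable_add Ld) (auto simp: C2_on_def)
  have "(\<lambda>x. frechet_derivative f (at x) v + L (frechet_derivative c (at x) v)) differentiable (at y)"
    using f c y by (intro differentiable_add Ld) (auto simp: C2_on_def)
  then show "(\<lambda>x. frechet_derivative (\<lambda>x. f x + L (c x)) (at x) v) differentiable (at y)"
  proof (rule differentiable_transform_open[OF _ U y])
    fix x assume "x \<in> U"
    then show "frechet_derivative f (at x) v + L (frechet_derivative c (at x) v)
        = frechet_derivative (\<lambda>x. f x + L (c x)) (at x) v"
      using f c by (subst frechet_derivative_add_linear[OF _ _ L]) (auto simp: C2_on_def)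
  qed
qed

text \<open>\<open>g\<close> has the same increments at \<open>x\<close> and \<open>y\<close>, so
  \<open>has_derivative\<close> at either point is the same predicate, and the derivative chosen
  from it agrees even where \<open>g\<close> is not differentiable. Locality thus survives one
  differentiation.\<close>

lemma frechet_derivative_depends_only_on:
  assumes "depends_only_on np I g"
  shows "depends_only_on np I (\<lambda>y. frechet_derivative g (at y) v)"
  unfolding depends_only_on_def
proof (intro allI impI)
  fix x y :: "real ^ 'a" assume xy: "\<forall>k. np k \<in> I \<longrightarrow> x $ k = y $ k"
  have eq: "g (x + h) = g (y + h)" for h
    using assms xy unfolding depends_only_on_def by simp
  have "(g has_derivative d) (at x) \<longleftrightarrow> (g has_derivative d) (at y)" for d
    using eq eq[of 0] unfolding has_derivative_at by simp
  then show "frechet_derivative g (at x) v = frechet_derivative g (at y) v"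
    by (simp add: frechet_derivative_def)
qed

lemma frechet_derivative_axis_eq_0:
  assumes dep: "depends_only_on np I g" and g: "g differentiable (at x)" and k: "np k \<notin> I"
  shows "frechet_derivative g (at x) (axis k 1) = 0"
proof -
  let ?D = "frechet_derivative g (at x)"
  have D: "(g has_derivative ?D) (at (x + 0 *\<^sub>R axis k 1))"
    using g by (simp add: frechet_derivative_works[symmetric])
  have "((\<lambda>t. x + t *\<^sub>R axis k 1) has_derivative (\<lambda>t. t *\<^sub>R axis k 1)) (at (0::real))"
    by (auto intro!: derivative_eq_intros)
  from has_derivative_compose[OF this D]
  have "((\<lambda>t. g (x + t *\<^sub>R axis k 1)) has_derivative (\<lambda>t. ?D (t *\<^sub>R axis k 1))) (at 0)" .
  moreover have "g (x + t *\<^sub>R axis k 1) = g x" for t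
    using dep k unfolding depends_only_on_def by (auto simp: axis_def)
  ultimately have "((\<lambda>t::real. g x) has_derivative (\<lambda>t. ?D (t *\<^sub>R axis k 1))) (at 0)" by simp
  then have "(\<lambda>t::real. ?D (t *\<^sub>R axis k 1)) = (\<lambda>t. 0)"
    by (rule has_derivative_unique) simp
  then show ?thesis by (metis scaleR_one)
qed

lemma has_derivative_jacobian:
  fixes g :: "real ^ 'a \<Rightarrow> real ^ 'b"
  assumes "g differentiable (at x)"
  shows "(g has_derivative (\<lambda>h. jacobian g (at x) *v h)) (at x)"
  using assms jacobian_works by blast

lemma jacobian_nth:
  "jacobian g (at x) $ k $ l = frechet_derivative g (at x) (axis l 1) $ k"
  by (simp add: jacobian_def matrix_def)

lemma frechet_derivative_nth:
  fixes g :: "real ^ 'a \<Rightarrow> real ^ 'b"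
  assumes "g differentiable (at x)"
  shows "frechet_derivative (\<lambda>y. g y $ k) (at x) v = frechet_derivative g (at x) v $ k"
proof -
  have "((\<lambda>y. g y $ k) has_derivative (\<lambda>v. frechet_derivative g (at x) v $ k)) (at x)"
    using assms unfolding frechet_derivative_works
    by (rule bounded_linear.has_derivative[OF bounded_linear_vec_nth])
  from frechet_derivative_at[OF this] show ?thesis by metis
qed

lemma differentiable_componentwise:
  fixes g :: "real ^ 'a \<Rightarrow> real ^ 'b"
  assumes "\<And>k. (\<lambda>y. g y $ k) differentiable (at x)"
  shows "g differentiable (at x)"
proof -
  have "\<forall>k. \<exists>d. ((\<lambda>y. g y $ k) has_derivative d) (at x)"
    using assms by (simp add: differentiable_def)
  then obtain d where d: "\<And>k. ((\<lambda>y. g y $ k) has_derivative d k) (at x)" by metis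
  have D: "((\<lambda>y. \<Sum>k\<in>UNIV. g y $ k *\<^sub>R (axis k 1 :: real ^ 'b)) has_derivative
      (\<lambda>h. \<Sum>k\<in>UNIV. d k h *\<^sub>R axis k 1)) (at x)"
    by (intro has_derivative_sum has_derivative_scaleR_left d)
  have eq: "(\<Sum>k\<in>UNIV. g y $ k *\<^sub>R axis k 1) = g y" for y
    using basis_expansion[of "g y"] by (simp add: scalar_mult_eq_scaleR)
  show ?thesis using D unfolding eq by (rule differentiableI)
qed

section \<open>Lagrangian and merit function of a graph-structured program\<close>

locale graph_program =
  fixes E :: "('v::finite \<times> 'v) set" and np :: "'p::finite \<Rightarrow> 'v" and nd :: "'d::finite \<Rightarrow> 'v"
    and f :: "'v \<Rightarrow> real ^ 'p \<Rightarrow> real" and c :: "real ^ 'p \<Rightarrow> real ^ 'd" and U :: "(real ^ 'p) set"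
  assumes symE: "sym E"
    and f_local: "\<And>i. depends_only_on np (closed_nbhd E 1 {i}) (f i)"
    and c_local: "\<And>i. depends_only_on np (closed_nbhd E 1 {i}) (\<lambda>y. subvec nd {i} (c y))"
    and U: "open U" and fC2: "\<And>i. C2_on (f i) U" and cC2: "C2_on c U"
begin

text \<open>Grouping by node pairs \<open>f i\<close> with the constraint block at \<open>i\<close>,
  so that each summand is local and the band of the Hessian can be read off.\<close>

definition term_L :: "real ^ 'd \<Rightarrow> 'v \<Rightarrow> real ^ 'p \<Rightarrow> real" where
  "term_L lam i y = f i y + lam \<bullet> subvec nd {i} (c y)"

lemma lagrangian_eq: "lagrangian f c y lam = (\<Sum>i\<in>UNIV. term_L lam i y)"
  unfolding lagrangian_def term_L_def sum.distrib inner_sum_right[symmetric] sum_subvec_singletons ..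

lemma term_L_local: "depends_only_on np (closed_nbhd E 1 {i}) (term_L lam i)"
  using f_local[of i] c_local[of i] unfolding depends_only_on_def term_L_def by metis

lemma term_L_C2: "C2_on (term_L lam i) U"
proof -
  have "bounded_linear (\<lambda>v. lam \<bullet> subvec nd {i} v)"
    by (intro bounded_linear_compose[OF bounded_linear_inner_right] linear_conv_bounded_linear[THEN iffD1] linear_subvec)
  from C2_on_add_linear[OF U fC2[of i] cC2 this] show ?thesis by (simp add: term_L_def[abs_def])
qed

lemma lagrangian_has_derivative:
  assumes "y \<in> U"
  shows "((\<lambda>y. lagrangian f c y lam) has_derivative
     (\<lambda>v. \<Sum>i\<in>UNIV. frechet_derivative (term_L lam i) (at y) v)) (at y)"
  unfolding lagrangian_eq by (intro has_derivative_sum C2_on_D[OF term_L_C2 assms])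

lemma grad_x_L_nth:
  assumes "y \<in> U"
  shows "grad_x_L f c y lam $ k = (\<Sum>i\<in>UNIV. frechet_derivative (term_L lam i) (at y) (axis k 1))"
  unfolding grad_x_L_def grad_def frechet_derivative_at[OF lagrangian_has_derivative[OF assms], symmetric]
  by simp

lemma grad_x_L_nth_differentiable:
  assumes "y \<in> U"
  shows "(\<lambda>y. grad_x_L f c y lam $ k) differentiable (at y)"
proof (rule differentiable_transform_open[OF _ U assms])
  show "(\<lambda>y. \<Sum>i\<in>UNIV. frechet_derivative (term_L lam i) (at y) (axis k 1)) differentiable (at y)"
    by (intro differentiable_sum ballI C2_on_D[OF term_L_C2 assms]) auto
qed (simp add: grad_x_L_nth)

lemma grad_x_L_differentiable: "y \<in> U \<Longrightarrow> (\<lambda>y. grad_x_L f c y lam) differentiable (at y)"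
  by (intro differentiable_componentwise grad_x_L_nth_differentiable)

lemma grad_x_L_has_derivative:
  "y \<in> U \<Longrightarrow> ((\<lambda>y. grad_x_L f c y lam) has_derivative (\<lambda>h. hess_L f c y lam *v h)) (at y)"
  unfolding hess_L_def by (intro has_derivative_jacobian grad_x_L_differentiable)

lemma c_has_derivative: "y \<in> U \<Longrightarrow> (c has_derivative (\<lambda>h. jacobian c (at y) *v h)) (at y)"
  using cC2 by (intro has_derivative_jacobian) (auto simp: C2_on_def)

lemma jacobian_banded:
  assumes x: "x \<in> U" shows "banded E 1 nd np (jacobian c (at x))"
  unfolding banded_def
proof (intro allI impI)
  fix k l assume nz: "jacobian c (at x) $ k $ l \<noteq> 0"
  have c: "c differentiable (at x)" using c_has_derivative[OF x] by (auto simp: differentiable_def)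
  have "depends_only_on np (closed_nbhd E 1 {nd k}) (\<lambda>y. c y $ k)"
    unfolding depends_only_on_def
  proof (intro allI impI)
    fix y z :: "real ^ 'p" assume "\<forall>l. np l \<in> closed_nbhd E 1 {nd k} \<longrightarrow> y $ l = z $ l"
    then have "subvec nd {nd k} (c y) = subvec nd {nd k} (c z)"
      using c_local[of "nd k"] unfolding depends_only_on_def by blast
    then show "c y $ k = c z $ k" by (metis insertI1 subvec_nth)
  qed
  moreover have "(\<lambda>y. c y $ k) differentiable (at x)"
    using c bounded_linear.has_derivative[OF bounded_linear_vec_nth] unfolding differentiable_def by blast
  ultimately have "np l \<in> closed_nbhd E 1 {nd k}"
    using nz frechet_derivative_axis_eq_0[of np _ "\<lambda>y. c y $ k" x l]
    by (metis jacobian_nth frechet_derivative_nth[OF c])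
  then have "gdist E (np l) (nd k) \<le> enat 1" by (elim closed_nbhdE) simp
  then show "gdist E (nd k) (np l) \<le> enat 1" by (rule gdist_sym[OF symE])
qed

text \<open>A nonzero entry comes from a single summand that depends on both coordinates; both
  owners lie within distance 1 of its node \<open>i\<close>, hence the band 1 + 1.\<close>

lemma hess_L_banded:
  assumes x: "x \<in> U" shows "banded E 2 np np (hess_L f c x lam)"
  unfolding banded_def
proof (intro allI impI)
  fix k l assume nz: "hess_L f c x lam $ k $ l \<noteq> 0"
  let ?g = "\<lambda>i y. frechet_derivative (term_L lam i) (at y) (axis k 1)"
  have "hess_L f c x lam $ k $ l = frechet_derivative (\<lambda>y. grad_x_L f c y lam $ k) (at x) (axis l 1)"
    unfolding hess_L_def jacobian_nth frechet_derivative_nth[OF grad_x_L_differentiable[OF x]] ..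
  also have "((\<lambda>y. grad_x_L f c y lam $ k) has_derivative
      (\<lambda>v. \<Sum>i\<in>UNIV. frechet_derivative (?g i) (at x) v)) (at x)"
  proof (rule has_derivative_transform_within_open[OF _ U x])
    show "((\<lambda>y. \<Sum>i\<in>UNIV. ?g i y) has_derivative (\<lambda>v. \<Sum>i\<in>UNIV. frechet_derivative (?g i) (at x) v)) (at x)"
      by (intro has_derivative_sum frechet_derivative_works[THEN iffD1] C2_on_D[OF term_L_C2 x])
  qed (simp add: grad_x_L_nth)
  from frechet_derivative_at[OF this, symmetric]
  have "frechet_derivative (\<lambda>y. grad_x_L f c y lam $ k) (at x) (axis l 1)
      = (\<Sum>i\<in>UNIV. frechet_derivative (?g i) (at x) (axis l 1))" by simp
  finally have "(\<Sum>i\<in>UNIV. frechet_derivative (?g i) (at x) (axis l 1)) \<noteq> 0" using nz by simp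
  then obtain i where i: "frechet_derivative (?g i) (at x) (axis l 1) \<noteq> 0"
    by (rule sum.not_neutral_contains_not_neutral)
  have "np l \<in> closed_nbhd E 1 {i}"
  proof (rule ccontr)
    assume "np l \<notin> closed_nbhd E 1 {i}"
    with frechet_derivative_axis_eq_0[OF frechet_derivative_depends_only_on[OF term_L_local]
        C2_on_D(2)[OF term_L_C2 x], of l i] i show False by blast
  qed
  moreover have "np k \<in> closed_nbhd E 1 {i}"
  proof (rule ccontr)
    assume nk: "np k \<notin> closed_nbhd E 1 {i}"
    \<comment> \<open>The first derivative has to vanish on all of \<open>U\<close>, not just at
      \<open>x\<close>, before it is differentiated again.\<close>
    have z: "0 = ?g i y" if "y \<in> U" for y
      using frechet_derivative_axis_eq_0[OF term_L_local _ nk, of lam y] term_L_C2[of lam i] that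
      by (auto simp: C2_on_def)
    have "(?g i has_derivative (\<lambda>v. 0)) (at x)"
      by (rule has_derivative_transform_within_open[OF has_derivative_const U x z])
    from frechet_derivative_at[OF this, symmetric] i show False by simp
  qed
  ultimately have kl: "gdist E (np k) i \<le> enat 1" "gdist E (np l) i \<le> enat 1"
    by (auto simp: closed_nbhd_iff)
  show "gdist E (np k) (np l) \<le> enat 2"
    using gdist_triangle[OF kl(1) gdist_sym[OF symE kl(2)]] unfolding one_add_one .
qed

lemma grad_l_L_eq: "grad_l_L f c x lam = c x"
  unfolding grad_l_L_def lagrangian_def
  by (rule grad_eqI) (auto intro!: derivative_eq_intros simp: inner_commute)

lemma lagrangian_has_gradient:
  assumes "x \<in> U"
  shows "((\<lambda>y. lagrangian f c y lam) has_derivative (\<lambda>h. grad_x_L f c x lam \<bullet> h)) (at x)"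
proof -
  define D where "D = (\<lambda>v. \<Sum>i\<in>UNIV. frechet_derivative (term_L lam i) (at x) v)"
  have D: "((\<lambda>y. lagrangian f c y lam) has_derivative D) (at x)"
    unfolding D_def by (rule lagrangian_has_derivative[OF assms])
  have lin: "linear D" using D by (rule has_derivative_linear)
  have "D h = grad_x_L f c x lam \<bullet> h" for h
  proof -
    have "D h = D (\<Sum>k\<in>UNIV. h $ k *\<^sub>R axis k 1)"
      using basis_expansion[of h] by (simp add: scalar_mult_eq_scaleR)
    also have "\<dots> = (\<Sum>k\<in>UNIV. h $ k * D (axis k 1))"
      by (simp add: linear_sum[OF lin] linear_scale[OF lin])
    also have "\<dots> = grad_x_L f c x lam \<bullet> h"
      by (simp add: inner_vec_def grad_x_L_nth[OF assms] D_def mult.commute)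
    finally show ?thesis .
  qed
  then have "D = (\<lambda>h. grad_x_L f c x lam \<bullet> h)" by (rule ext)
  then show ?thesis using D by simp
qed

text \<open>The Lagrangian is affine in \<open>lam\<close>; this identifies the dual derivative of
  the primal gradient as \<open>transpose (jacobian c (at x))\<close>, as needed for the dual
  gradient of the merit function.\<close>

lemma grad_x_L_affine:
  assumes "x \<in> U"
  shows "grad_x_L f c x lam = grad_x_L f c x 0 + transpose (jacobian c (at x)) *v lam"
proof -
  let ?G = "jacobian c (at x)"
  have "((\<lambda>y. lagrangian f c y 0 + lam \<bullet> c y) has_derivative
      (\<lambda>h. grad_x_L f c x 0 \<bullet> h + lam \<bullet> (?G *v h))) (at x)"
    by (intro has_derivative_add lagrangian_has_gradient assms has_derivative_inner_right c_has_derivative)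
  then have "((\<lambda>y. lagrangian f c y lam) has_derivative
      (\<lambda>h. (grad_x_L f c x 0 + transpose ?G *v lam) \<bullet> h)) (at x)"
    by (simp add: lagrangian_def inner_add_left inner_transpose del: transpose_matrix_vector)
  then show ?thesis unfolding grad_x_L_def by (rule grad_eqI)
qed

lemma grad_x_merit_eq:
  assumes x: "x \<in> U"
  shows "grad_x_merit f c eta1 eta2 x lam = grad_x_L f c x lam
    + eta1 *\<^sub>R (transpose (jacobian c (at x)) *v c x)
    + eta2 *\<^sub>R (transpose (hess_L f c x lam) *v grad_x_L f c x lam)"
  unfolding grad_x_merit_def merit_def grad_l_L_eq power2_norm_eq_inner
  apply (rule grad_eqI)
  apply (rule derivative_eq_intros lagrangian_has_gradient[OF x] c_has_derivative[OF x]
      grad_x_L_has_derivative[OF x] refl)+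
  apply (rule ext)
  by (simp add: inner_add_left inner_transpose_right inner_commute algebra_simps del: transpose_matrix_vector)

lemma grad_l_merit_eq:
  assumes x: "x \<in> U"
  shows "grad_l_merit f c eta1 eta2 x lam = c x + eta2 *\<^sub>R (jacobian c (at x) *v grad_x_L f c x lam)"
proof -
  let ?GT = "transpose (jacobian c (at x))" and ?p = "grad_x_L f c x lam"
  have p: "((\<lambda>l. grad_x_L f c x l) has_derivative (\<lambda>h. ?GT *v h)) (at lam)"
  proof -
    define a where "a = grad_x_L f c x 0"
    have "((\<lambda>l. a + ?GT *v l) has_derivative (\<lambda>h. 0 + ?GT *v h)) (at lam)"
      by (intro has_derivative_add has_derivative_const bounded_linear_imp_has_derivative
          matrix_vector_mul_bounded_linear)
    moreover have "(\<lambda>l. grad_x_L f c x l) = (\<lambda>l. a + ?GT *v l)"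
      unfolding a_def by (rule ext) (rule grad_x_L_affine[OF x])
    ultimately show ?thesis by (simp only: add_0)
  qed
  have "((\<lambda>l. lagrangian f c x l) has_derivative (\<lambda>h. 0 + h \<bullet> c x)) (at lam)"
    unfolding lagrangian_def
    by (intro has_derivative_add has_derivative_const has_derivative_inner_left has_derivative_ident)
  then have L: "((\<lambda>l. lagrangian f c x l) has_derivative (\<lambda>h. c x \<bullet> h)) (at lam)"
    by (simp only: add_0 inner_commute)
  have "((\<lambda>l. merit f c eta1 eta2 x l) has_derivative
      (\<lambda>h. c x \<bullet> h + 0 + eta2 / 2 * (?p \<bullet> (?GT *v h) + (?GT *v h) \<bullet> ?p))) (at lam)"
    unfolding merit_def grad_l_L_eq power2_norm_eq_inner
    by (intro has_derivative_add has_derivative_const has_derivative_mult_right has_derivative_inner L p)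
  moreover have "c x \<bullet> h + 0 + eta2 / 2 * (?p \<bullet> (?GT *v h) + (?GT *v h) \<bullet> ?p)
      = (c x + eta2 *\<^sub>R (jacobian c (at x) *v ?p)) \<bullet> h" for h
    unfolding inner_transpose inner_transpose_right
    by (simp add: inner_add_left inner_commute[of h])
  ultimately show ?thesis
    unfolding grad_l_merit_def by (intro grad_eqI) simp
qed

end

section \<open>Descent\<close>

text \<open>\<open>a\<close>, \<open>e\<close>, \<open>x\<close>, \<open>l\<close>, \<open>d\<close>
  stand for the norms of \<open>p\<close>, \<open>q\<close>, \<open>dx\<close>, \<open>dl\<close>
  and \<open>(dx, dl)\<close> in \<open>merit_descent\<close>. After Young's inequality the claim is
  linear in the squares and in \<open>s\<close>. No negative multiple of \<open>l\<^sup>2\<close> is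
  available on the left, so \<open>l\<close> is paid for by \<open>a\<close> and \<open>x\<close>
  through \<open>gamG * l\<^sup>2 \<le> (a + U * x)\<^sup>2\<close>.\<close>

lemma descent_arithmetic:
  fixes a e x l U gamH gamG eta1 eta2 delta :: real
  assumes pos: "0 \<le> a" "0 \<le> e" "0 \<le> x" "0 \<le> l" and U: "1 \<le> U"
    and gamH: "0 < gamH" "gamH \<le> 1" and gamG: "0 < gamG" "gamG \<le> 1"
    and eta2: "0 < eta2" "eta2 \<le> gamH / (7 * U\<^sup>2)" and eta1: "9 / (eta2 * gamG) \<le> eta1"
    and delta: "delta \<le> eta2 * gamG / (17 * eta1 * U\<^sup>2)"
    and l: "gamG * l\<^sup>2 \<le> (a + U * x)\<^sup>2"
    and d: "0 \<le> d" "d\<^sup>2 = x\<^sup>2 + l\<^sup>2"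
  shows "- (gamH / 2 * x\<^sup>2) + 7 / 2 * U\<^sup>2 / (gamH * gamG) * e\<^sup>2 + 2 * (e * l) - eta1 * e\<^sup>2
      - eta2 * a\<^sup>2 + 2 * eta2 * U * (a * x)
      + delta * d * ((1 + 2 * eta2 * U) * a + (1 + eta1 * U) * e)
    \<le> - (eta2 / 8) * (a\<^sup>2 + e\<^sup>2) - eta2 * gamG / 16 * (x\<^sup>2 + l\<^sup>2)"
proof -
  define m where "m = eta2 * gamG"
  have U2: "1 \<le> U\<^sup>2" "U \<le> U\<^sup>2"
    using U mult_left_mono[of 1 U U] by (simp_all add: power2_eq_square[of U, symmetric])
  have m0: "0 < m" using eta2 gamG by (simp add: m_def)
  have m_le: "m \<le> eta2" using eta2 gamG by (simp add: m_def mult_left_le)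
  have eU: "eta2 * U\<^sup>2 \<le> gamH / 7"
  proof -
    have "0 < 7 * U\<^sup>2" using U2 by linarith
    then have "eta2 * (7 * U\<^sup>2) \<le> gamH" using eta2(2) by (simp only: pos_le_divide_eq)
    then show ?thesis by simp
  qed
  have eU1: "eta2 * U \<le> 1 / 7"
    using mult_left_mono[OF U2(2), of eta2] eU eta2 gamH by linarith
  have eU0: "eta2 \<le> 1 / 7"
    using mult_left_mono[OF U, of eta2] eU1 eta2 by linarith
  have m9: "9 \<le> eta1 * m" using eta1 m0 by (simp add: m_def[symmetric] pos_divide_le_eq)
  have eta1_63: "63 \<le> eta1"
  proof -
    have "m \<le> 1 / 7" using m_le eU0 by linarith
    then have "9 * 7 \<le> 9 / m" using m0 by (simp add: pos_le_divide_eq)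
    then show ?thesis using eta1 by (simp add: m_def)
  qed
  \<comment> \<open>Of the 9 in \<open>9 \<le> eta1 * m\<close> the curvature deficit takes one
    half; the 7 in the bound on \<open>eta2\<close> cancels its \<open>7 / 2\<close>.\<close>
  have t1: "7 / 2 * U\<^sup>2 / (gamH * gamG) * e\<^sup>2 \<le> eta1 / 18 * e\<^sup>2"
  proof (rule mult_right_mono)
    have "7 / 2 * U\<^sup>2 * m \<le> gamG * (gamH / 2)"
      using mult_right_mono[OF eU, of gamG] gamG by (simp add: m_def algebra_simps)
    then have "7 / 2 * U\<^sup>2 / (gamH * gamG) * m \<le> 1 / 2"
      using gamH gamG by (simp add: pos_divide_le_eq mult.commute)
    also have "\<dots> \<le> eta1 / 18 * m" using m9 by simp
    finally show "7 / 2 * U\<^sup>2 / (gamH * gamG) \<le> eta1 / 18" using m0 by (rule mult_right_le_imp_le)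
  qed simp
  \<comment> \<open>The cross term takes 8 of the 9, which leaves
    \<open>eta1 / 18 * e\<^sup>2\<close> for the target and the perturbation.\<close>
  have t2: "2 * (e * l) \<le> 8 / 9 * eta1 * e\<^sup>2 + 1 / 8 * (m * l\<^sup>2)"
  proof -
    have "0 \<le> (8 * e - m * l)\<^sup>2 / (8 * m)" using m0 by simp
    also have "\<dots> = 8 * e\<^sup>2 / m - 2 * (e * l) + 1 / 8 * (m * l\<^sup>2)"
      using m0 by (simp add: field_simps power2_eq_square)
    finally have "2 * (e * l) \<le> 8 / m * e\<^sup>2 + 1 / 8 * (m * l\<^sup>2)" by simp
    moreover have "8 / m * e\<^sup>2 \<le> 8 / 9 * eta1 * e\<^sup>2"
      using m9 m0 by (intro mult_right_mono) (auto simp: pos_divide_le_eq)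
    ultimately show ?thesis by linarith
  qed
  define s where "s = eta2 * (U * x)\<^sup>2"
  have s: "7 * s \<le> gamH * x\<^sup>2"
    using mult_right_mono[OF eU, of "x\<^sup>2"] by (simp add: s_def power_mult_distrib)
  \<comment> \<open>The curvature \<open>gamH / 2 * x\<^sup>2\<close> is worth
    \<open>7 / 2 * s\<close>. Spending \<open>5 / 2 * s\<close> here leaves one \<open>s\<close> and
    \<open>3 / 5 * (eta2 * a\<^sup>2)\<close>, which cover the \<open>l\<^sup>2\<close> terms, the
    target and the perturbation.\<close>
  have t3: "2 * eta2 * U * (a * x) \<le> 2 / 5 * (eta2 * a\<^sup>2) + 5 / 2 * s"
  proof -
    have "0 \<le> eta2 * (2 * a - 5 * (U * x))\<^sup>2" using eta2 by simp
    then show ?thesis by (simp add: s_def power2_eq_square algebra_simps)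
  qed
  have t4: "m * l\<^sup>2 \<le> 2 * (eta2 * a\<^sup>2) + 2 * s"
  proof -
    have "0 \<le> eta2 * (a - U * x)\<^sup>2" using eta2 by simp
    moreover have "m * l\<^sup>2 \<le> eta2 * (a + U * x)\<^sup>2"
      using mult_left_mono[OF l, of eta2] eta2 by (simp add: m_def mult.assoc)
    ultimately show ?thesis by (simp add: s_def power2_eq_square algebra_simps)
  qed
  have t5: "m * x\<^sup>2 \<le> s"
  proof -
    have "m * x\<^sup>2 \<le> eta2 * (U\<^sup>2 * x\<^sup>2)"
      using U2 m_le m0 eta2 mult_right_mono[of 1 "U\<^sup>2" "x\<^sup>2"] by (intro mult_mono) auto
    then show ?thesis by (simp add: s_def power_mult_distrib)
  qed
  have dl: "delta * (17 * eta1 * U\<^sup>2) \<le> m"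
  proof -
    have "0 < 17 * eta1 * U\<^sup>2" using U2 eta1_63 by (intro mult_pos_pos) auto
    then show ?thesis using delta unfolding m_def by (simp only: pos_le_divide_eq)
  qed
  have d1: "delta * (1 + 2 * eta2 * U) \<le> m / 800" and d2: "delta * (1 + eta1 * U) \<le> 3 / 50 * m"
  proof -
    have "delta * (1 + 2 * eta2 * U) \<le> m / 800 \<and> delta * (1 + eta1 * U) \<le> 3 / 50 * m"
    \<comment> \<open>A negative \<open>delta\<close> makes both products nonpositive. Otherwise 17
      * 63 = 1071 bounds the first, and the factor \<open>64 / 63\<close> absorbs the 1 next to
      \<open>eta1 * U\<close> in the second.\<close>
    proof (cases "0 \<le> delta")
      case True
      have "1071 * 1 \<le> 17 * eta1 * U\<^sup>2" using eta1_63 U2 by (intro mult_mono) auto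
      then have "delta * 1071 \<le> m" using mult_left_mono[of 1071 "17 * eta1 * U\<^sup>2" delta] True dl by linarith
      moreover have "delta * (1 + 2 * eta2 * U) \<le> delta * (9 / 7)"
        using eU1 by (intro mult_left_mono[OF _ True]) linarith
      moreover have "delta * (1 + eta1 * U) \<le> delta * ((64 / 63 / 17) * (17 * eta1 * U\<^sup>2))"
      proof (rule mult_left_mono[OF _ True])
        have "eta1 * U \<le> eta1 * U\<^sup>2" using U2 eta1_63 by (intro mult_left_mono) auto
        moreover have "63 * 1 \<le> eta1 * U\<^sup>2" using eta1_63 U2 by (intro mult_mono) auto
        ultimately show "1 + eta1 * U \<le> (64 / 63 / 17) * (17 * eta1 * U\<^sup>2)" by linarith
      qed
      ultimately show ?thesis using dl m0 by linarith
    next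
      case False
      then have "delta * (1 + 2 * eta2 * U) \<le> 0" "delta * (1 + eta1 * U) \<le> 0"
        using eta2 U eta1_63 by (auto intro!: mult_nonpos_nonneg)
      then show ?thesis using m0 by linarith
    qed
    then show "delta * (1 + 2 * eta2 * U) \<le> m / 800" "delta * (1 + eta1 * U) \<le> 3 / 50 * m" by auto
  qed
  have t6: "delta * d * ((1 + 2 * eta2 * U) * a + (1 + eta1 * U) * e)
      \<le> 31 / 1000 * (m * d\<^sup>2) + 1 / 1000 * (m * a\<^sup>2) + 3 / 100 * (m * e\<^sup>2)"
  proof -
    have "delta * (1 + 2 * eta2 * U) * (d * a) \<le> m / 800 * (d * a)"
      using d pos by (intro mult_right_mono d1) auto
    moreover have "delta * (1 + eta1 * U) * (d * e) \<le> 3 / 50 * m * (d * e)"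
      using d pos by (intro mult_right_mono d2) auto
    moreover have "0 \<le> m * (d - a)\<^sup>2" "0 \<le> m * (d - e)\<^sup>2" "0 \<le> m * d\<^sup>2" "0 \<le> m * a\<^sup>2"
      using m0 by auto
    ultimately show ?thesis by (simp add: power2_eq_square algebra_simps)
  qed
  have md: "m * d\<^sup>2 = m * x\<^sup>2 + m * l\<^sup>2" using d by (simp add: algebra_simps)
  have ma: "m * a\<^sup>2 \<le> eta2 * a\<^sup>2" using m_le by (intro mult_right_mono) auto
  have me: "m * e\<^sup>2 \<le> eta2 * e\<^sup>2" using m_le by (intro mult_right_mono) auto
  have ee: "441 * (eta2 * e\<^sup>2) \<le> eta1 * e\<^sup>2"
    using mult_right_mono[of "441 * eta2" eta1 "e\<^sup>2"] eta1_63 eU0 by simp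
  have nn: "0 \<le> eta2 * a\<^sup>2" "0 \<le> eta2 * e\<^sup>2" "0 \<le> s" using eta2 by (auto simp: s_def)
  have rhs: "- (eta2 / 8) * (a\<^sup>2 + e\<^sup>2) - eta2 * gamG / 16 * (x\<^sup>2 + l\<^sup>2)
      = - (1 / 8) * (eta2 * a\<^sup>2) - 1 / 8 * (eta2 * e\<^sup>2) - 1 / 16 * (m * x\<^sup>2) - 1 / 16 * (m * l\<^sup>2)"
    by (simp add: m_def algebra_simps)
  show ?thesis
    unfolding rhs using t1 t2 t3 t4 t5 t6 s nn ee ma me md by linarith
qed

text \<open>\<open>Hh\<close> is the modified Hessian of the Newton system, \<open>Hs\<close> the
  true one in the merit gradient; their mismatch carries a factor \<open>eta2\<close> and is bounded
  by norms. Descent comes from \<open>- eta1 * (norm q)\<^sup>2\<close> and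
  \<open>- eta2 * (norm p)\<^sup>2\<close>, both produced by substituting the Newton equations, and
  from the curvature of \<open>Hh\<close>.\<close>

lemma merit_descent:
  fixes Hh Hs :: "real ^ 'p ^ 'p" and G :: "real ^ 'p ^ 'd"
  assumes Hh: "transpose Hh = Hh" "\<And>u. norm (Hh *v u) \<le> U * norm u"
    and Hs: "\<And>u. norm (Hs *v u) \<le> U * norm u"
    and G: "\<And>u. norm (G *v u) \<le> U * norm u" and U: "1 \<le> U"
    and gamH: "0 < gamH" "gamH \<le> 1" and gamG: "0 < gamG" "gamG \<le> 1"
    and A1: "\<And>u. G *v u = 0 \<Longrightarrow> gamH * (norm u)\<^sup>2 \<le> u \<bullet> (Hh *v u)"
    and A2: "\<And>y. gamG * (norm y)\<^sup>2 \<le> (norm (transpose G *v y))\<^sup>2"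
    and newton: "newton_direction Hh G p q dx dl"
    and eta2: "0 < eta2" "eta2 \<le> gamH / (7 * U\<^sup>2)" and eta1: "9 / (eta2 * gamG) \<le> eta1"
    and delta: "delta \<le> eta2 * gamG / (17 * eta1 * U\<^sup>2)"
    and err: "norm (dx - dxt, dl - dlt) \<le> delta * norm (dx, dl)"
  shows "(p + eta1 *\<^sub>R (transpose G *v q) + eta2 *\<^sub>R (transpose Hs *v p), q + eta2 *\<^sub>R (G *v p)) \<bullet> (dxt, dlt)
    \<le> - (eta2 / 8) * (norm (p, q))\<^sup>2 - eta2 * gamG / 16 * (norm (dx, dl))\<^sup>2"
proof -
  let ?gx = "p + eta1 *\<^sub>R (transpose G *v q) + eta2 *\<^sub>R (transpose Hs *v p)" and ?gl = "q + eta2 *\<^sub>R (G *v p)"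
  have n1: "Hh *v dx + transpose G *v dl = - p" and n2: "G *v dx = - q"
    using newton by (auto simp: newton_direction_def simp del: transpose_matrix_vector)
  have U0: "0 \<le> U" using U by simp
  note GT = transpose_norm_le[OF U0 G] and HT = transpose_norm_le[OF U0 Hs]
  have eta1_0: "0 < eta1" using eta1 eta2 gamG
    by (meson divide_pos_pos less_le_trans mult_pos_pos zero_less_numeral)
  have dl: "transpose G *v dl = - p - Hh *v dx" using n1 by (simp add: eq_diff_eq add.commute del: transpose_matrix_vector)
  \<comment> \<open>Pairing the first Newton equation with \<open>dx\<close> trades
    \<open>p \<bullet> dx\<close>, which has no sign, for the curvature term and a second copy of
    \<open>q \<bullet> dl\<close>.\<close>
  have qdl: "q \<bullet> dl = p \<bullet> dx + dx \<bullet> (Hh *v dx)"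
  proof -
    have "q \<bullet> dl = - ((transpose G *v dl) \<bullet> dx)"
      using n2 by (simp only: inner_transpose) (simp add: inner_commute)
    then show ?thesis unfolding dl by (simp add: inner_diff_left inner_diff_right inner_commute)
  qed
  have exact: "(?gx, ?gl) \<bullet> (dx, dl) = - (dx \<bullet> (Hh *v dx)) + 2 * (q \<bullet> dl) - eta1 * (norm q)\<^sup>2
      - eta2 * (norm p)\<^sup>2 + eta2 * (p \<bullet> (Hs *v dx) - p \<bullet> (Hh *v dx))"
  proof -
    have r1: "(transpose G *v q) \<bullet> dx = - (norm q)\<^sup>2"
      unfolding inner_transpose n2 by (simp add: dot_square_norm)
    have r2: "(G *v p) \<bullet> dl = - (norm p)\<^sup>2 - p \<bullet> (Hh *v dx)"
    proof -
      have "(G *v p) \<bullet> dl = (transpose G *v dl) \<bullet> p" unfolding inner_transpose by (rule inner_commute)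
      then show ?thesis unfolding dl by (simp add: inner_diff_left inner_diff_right dot_square_norm inner_commute)
    qed
    have "(?gx, ?gl) \<bullet> (dx, dl) = p \<bullet> dx + eta1 * ((transpose G *v q) \<bullet> dx) + eta2 * (p \<bullet> (Hs *v dx))
        + (q \<bullet> dl + eta2 * ((G *v p) \<bullet> dl))"
      by (simp add: inner_add_left inner_transpose del: transpose_matrix_vector)
    then show ?thesis unfolding r1 r2 qdl by (simp add: algebra_simps)
  qed
  have nG: "norm (G *v dx) = norm q" by (simp add: n2)
  have h: "gamH / 2 * (norm dx)\<^sup>2 - 7 / 2 * U\<^sup>2 / (gamH * gamG) * (norm q)\<^sup>2 \<le> dx \<bullet> (Hh *v dx)"
    using reduced_hessian_bound[OF Hh U gamH A1 gamG(1) A2, of dx] unfolding nG .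
  have cs: "\<bar>p \<bullet> (B *v dx)\<bar> \<le> norm p * (U * norm dx)" if "\<And>u. norm (B *v u) \<le> U * norm u"
    for B :: "real ^ 'p ^ 'p"
    by (intro order_trans[OF Cauchy_Schwarz_ineq2] mult_left_mono that) auto
  have "p \<bullet> (Hs *v dx) - p \<bullet> (Hh *v dx) \<le> 2 * U * (norm p * norm dx)"
    using cs[OF Hs] cs[OF Hh(2)] by (simp add: algebra_simps)
  then have "eta2 * (p \<bullet> (Hs *v dx) - p \<bullet> (Hh *v dx)) \<le> eta2 * (2 * U * (norm p * norm dx))"
    using eta2 by (intro mult_left_mono) auto
  moreover have "q \<bullet> dl \<le> norm q * norm dl" by (rule norm_cauchy_schwarz)
  ultimately have I: "(?gx, ?gl) \<bullet> (dx, dl) \<le> - (gamH / 2 * (norm dx)\<^sup>2)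
      + 7 / 2 * U\<^sup>2 / (gamH * gamG) * (norm q)\<^sup>2 + 2 * (norm q * norm dl) - eta1 * (norm q)\<^sup>2
      - eta2 * (norm p)\<^sup>2 + 2 * eta2 * U * (norm p * norm dx)"
    unfolding exact using h by (simp only: mult.assoc mult.left_commute)
  have "norm ?gx \<le> norm p + eta1 * (U * norm q) + eta2 * (U * norm p)"
    using GT[of q] HT[of p] eta1_0 eta2
    by (intro norm_triangle_le add_mono) (simp_all add: mult_left_mono del: transpose_matrix_vector)
  moreover have "norm ?gl \<le> norm q + eta2 * (U * norm p)"
    using G[of p] eta2 by (intro norm_triangle_le add_mono) (simp_all add: mult_left_mono)
  ultimately have ng: "norm (?gx, ?gl) \<le> (1 + 2 * eta2 * U) * norm p + (1 + eta1 * U) * norm q"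
    using norm_Pair_le[of ?gx ?gl] by (simp add: algebra_simps del: transpose_matrix_vector)
  have "(?gx, ?gl) \<bullet> (dxt, dlt) = (?gx, ?gl) \<bullet> (dx, dl) - (?gx, ?gl) \<bullet> (dx - dxt, dl - dlt)"
    by (simp add: inner_diff_right del: transpose_matrix_vector)
  moreover have "- ((?gx, ?gl) \<bullet> (dx - dxt, dl - dlt))
      \<le> ((1 + 2 * eta2 * U) * norm p + (1 + eta1 * U) * norm q) * (delta * norm (dx, dl))"
  proof -
    have "- ((?gx, ?gl) \<bullet> (dx - dxt, dl - dlt)) \<le> norm (?gx, ?gl) * norm (dx - dxt, dl - dlt)"
      using Cauchy_Schwarz_ineq2[of "(?gx, ?gl)" "(dx - dxt, dl - dlt)"] by linarith
    also have "\<dots> \<le> ((1 + 2 * eta2 * U) * norm p + (1 + eta1 * U) * norm q) * (delta * norm (dx, dl))"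
      using eta1_0 eta2 U by (intro mult_mono ng err) auto
    finally show ?thesis .
  qed
  moreover have l: "gamG * (norm dl)\<^sup>2 \<le> (norm p + U * norm dx)\<^sup>2"
  proof -
    have "norm (transpose G *v dl) \<le> norm p + U * norm dx"
      unfolding dl using Hh(2)[of dx] norm_triangle_ineq4[of "- p" "Hh *v dx"] by simp
    then have "(norm (transpose G *v dl))\<^sup>2 \<le> (norm p + U * norm dx)\<^sup>2"
      by (intro power_mono) auto
    then show ?thesis using A2[of dl] by linarith
  qed
  ultimately show ?thesis
    using I descent_arithmetic[OF norm_ge_zero norm_ge_zero norm_ge_zero norm_ge_zero U gamH gamG eta2 eta1
        delta l norm_ge_zero[of "(dx, dl)"], of q] 
    by (simp add: norm_Pair mult_ac del: transpose_matrix_vector)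
qed

section \<open>Descent along the assembled direction at each iterate\<close>

theorem lemma4p3:
  fixes E :: "('v::{finite,linorder} \<times> 'v) set"
    and np :: "'p::finite \<Rightarrow> 'v" and nd :: "'d::finite \<Rightarrow> 'v"
    and f :: "'v \<Rightarrow> real ^ 'p \<Rightarrow> real" and c :: "real ^ 'p \<Rightarrow> real ^ 'd"
    and x Dx Dxt :: "nat \<Rightarrow> real ^ 'p" and lam Dl Dlt :: "nat \<Rightarrow> real ^ 'd"
    and Hh :: "nat \<Rightarrow> real ^ 'p ^ 'p" and alpha :: "nat \<Rightarrow> real"
    and M b :: nat and V W :: "nat \<Rightarrow> 'v set"
    and w :: "nat \<Rightarrow> nat \<Rightarrow> real ^ 'p" and z :: "nat \<Rightarrow> nat \<Rightarrow> real ^ 'd"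
    and X :: "(real ^ 'p) set" and Lam :: "(real ^ 'd) set"
    and pW pG :: "real poly"
    and gamH gamG Ups mu eta1 eta2 :: real
  assumes undirected: "sym E"
    and f_local: "\<And>i. depends_only_on np (closed_nbhd E 1 {i}) (f i)"
    and c_local: "\<And>i. depends_only_on np (closed_nbhd E 1 {i}) (\<lambda>y. subvec nd {i} (c y))"
    and Hh_sym: "\<And>t. transpose (Hh t) = Hh t"
    and Hh_structure: "\<And>t i j. gdist E i j > 2 \<Longrightarrow> submat np np {i} {j} (Hh t) = 0"
    and newton: "\<And>t. newton_direction (Hh t) (jacobian c (at (x t)))
                   (grad_x_L f c (x t) (lam t)) (grad_l_L f c (x t) (lam t)) (Dx t) (Dl t)"
    and V_cover: "(\<Union>l\<in>{1..M}. V l) = UNIV"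
    and V_disjoint: "disjoint_family_on V {1..M}"
    and b_ge: "b \<ge> 1"
    and overlap: "\<And>l. l \<in> {1..M} \<Longrightarrow> closed_nbhd E b (V l) \<subseteq> W l"
    and subproblem: "\<And>t l. l \<in> {1..M} \<Longrightarrow>
          sub_primal_dual_solution E np nd (Hh t) (jacobian c (at (x t)))
            (grad_x_L f c (x t) (lam t)) (c (x t)) mu (W l) (w t l) (z t l)"
    and Dxt: "\<And>t l k. l \<in> {1..M} \<Longrightarrow> np k \<in> V l \<Longrightarrow> Dxt t $ k = w t l $ k"
    and Dlt: "\<And>t l k. l \<in> {1..M} \<Longrightarrow> nd k \<in> V l \<Longrightarrow> Dlt t $ k = z t l $ k"
    and x_step: "\<And>t. x (Suc t) = x t + alpha t *\<^sub>R Dxt t"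
    and lam_step: "\<And>t. lam (Suc t) = lam t + alpha t *\<^sub>R Dlt t"
    and alpha: "\<And>t. 0 < alpha t \<and> alpha t \<le> 1"
    \<comment> \<open>(A1)\<close>
    and gamH: "0 < gamH" "gamH \<le> 1"
    and A1: "\<And>t u. jacobian c (at (x t)) *v u = 0 \<Longrightarrow> u \<bullet> (Hh t *v u) \<ge> gamH * (norm u)\<^sup>2"
    \<comment> \<open>(A2)\<close>
    and gamG: "0 < gamG" "gamG \<le> 1"
    and A2: "\<And>t v. v \<bullet> ((jacobian c (at (x t)) ** transpose (jacobian c (at (x t)))) *v v)
                    \<ge> gamG * (v \<bullet> v)"
    \<comment> \<open>(A3)\<close>
    and Ups: "Ups \<ge> 1"
    and A3: "\<And>t i j. spectral_norm (submat np np {i} {j} (Hh t)) \<le> Ups"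
            "\<And>t i j. spectral_norm (submat np np {i} {j} (hess_L f c (x t) (lam t))) \<le> Ups"
            "\<And>t i j. spectral_norm (submat nd np {i} {j} (jacobian c (at (x t)))) \<le> Ups"
    \<comment> \<open>(A4)\<close>
    and A4: "growth_bounds E b M W pW pG"
    \<comment> \<open>(A5)\<close>
    and A5_compact: "compact (X \<times> Lam)"
    and A5_iterates: "\<And>t a. 0 \<le> a \<Longrightarrow> a \<le> 1 \<Longrightarrow>
          (x t + a *\<^sub>R Dxt t, lam t + a *\<^sub>R Dlt t) \<in> X \<times> Lam"
    and A5_smooth: "\<And>i. Ck_near 3 (f i) X" "Ck_near 3 c X"
    and A5_bounds:
          "\<And>y l i j. y \<in> X \<Longrightarrow> l \<in> Lam \<Longrightarrow> spectral_norm (submat np np {i} {j} (hess_L f c y l)) \<le> Ups"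
          "\<And>y i j. y \<in> X \<Longrightarrow> spectral_norm (submat nd np {i} {j} (jacobian c (at y))) \<le> Ups"
    and mu_ge: "mu \<ge> mu_hat gamH gamG Ups pG"
    and eta1_pos: "eta1 > 0" and eta2_pos: "eta2 > 0"
    and eta1_ge: "eta1 \<ge> 9 / (eta2 * gamG)"
    and eta2_le: "eta2 \<le> gamH / (7 * (Ups_hat Ups pG)\<^sup>2)"
    and delta_le: "delta_mu_b gamH gamG Ups pG pW mu b
                     \<le> eta2 * gamG / (17 * eta1 * (Ups_hat Ups pG)\<^sup>2)"
  shows "\<forall>t. (grad_x_merit f c eta1 eta2 (x t) (lam t), grad_l_merit f c eta1 eta2 (x t) (lam t))
               \<bullet> (Dxt t, Dlt t)
           \<le> - (eta2 / 8) * (norm (grad_x_L f c (x t) (lam t), grad_l_L f c (x t) (lam t)))\<^sup>2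
             - eta2 * gamG / 16 * (norm (Dx t, Dl t))\<^sup>2"
proof
  fix t
  define U where "U = Ups_hat Ups pG"
  define G where "G = jacobian c (at (x t))"
  let ?p = "grad_x_L f c (x t) (lam t)" and ?Hs = "hess_L f c (x t) (lam t)"
  have xX: "x t \<in> X" using A5_iterates[of 0 t] by simp
  have ball1: "real (card {j. gdist E i j \<le> enat 1}) \<le> poly pG 1" for i
    using ball_bounds(1)[OF A4, of i 1] by simp
  have ball2: "real (card {j. gdist E i j \<le> enat 2}) \<le> (poly pG 1)\<^sup>2" for i
    by (rule card_ball_two[OF ball1])
  have "1 \<le> poly pG 1" using order_trans[OF card_ball_pos ball1] .
  then have "1 * 1 \<le> Ups * (poly pG 1)\<^sup>2" using Ups by (intro mult_mono) auto
  then have U1: "1 \<le> U" by (simp add: U_def Ups_hat_def)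
  \<comment> \<open>\<open>Ck_near\<close> gives every function its own open set; there are finitely
    many, so the intersection is still open.\<close>
  obtain T where T: "open T" "X \<subseteq> T" "\<And>i. C2_on (f i) T" "C2_on c T"
  proof -
    have "\<forall>i. \<exists>T. open T \<and> X \<subseteq> T \<and> C2_on (f i) T"
      using A5_smooth(1) Ck_near_3_imp_C2_on by metis
    then obtain T where T: "\<And>i. open (T i) \<and> X \<subseteq> T i \<and> C2_on (f i) (T i)" by metis
    obtain T0 where T0: "open T0" "X \<subseteq> T0" "C2_on c T0"
      using A5_smooth(2) Ck_near_3_imp_C2_on by metis
    show ?thesis
    proof (rule that[of "T0 \<inter> (\<Inter>i. T i)"])
      show "open (T0 \<inter> (\<Inter>i. T i))" using T T0 by (intro open_Int open_INT) auto
      show "X \<subseteq> T0 \<inter> (\<Inter>i. T i)" using T T0 by blast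
      show "C2_on (f i) (T0 \<inter> (\<Inter>i. T i))" for i using T by (rule_tac C2_on_subset[of _ "T i"]) auto
      show "C2_on c (T0 \<inter> (\<Inter>i. T i))" using T0 by (rule_tac C2_on_subset[of _ T0]) auto
    qed
  qed
  interpret graph_program E np nd f c T
    by unfold_locales (fact undirected f_local c_local T)+
  have xT: "x t \<in> T" using xX T by blast
  have G_band: "banded E 1 nd np G" unfolding G_def by (rule jacobian_banded[OF xT])
  have Hs_norm: "norm (?Hs *v u) \<le> U * norm u" for u
    unfolding U_def Ups_hat_def by (rule banded_norm_le[OF undirected hess_L_banded[OF xT] A3(2) ball2])
  have H_band: "banded E 2 np np (Hh t)"
    unfolding banded_def
  proof (intro allI impI, rule ccontr)
    fix k l assume nz: "Hh t $ k $ l \<noteq> 0" and far: "\<not> gdist E (np k) (np l) \<le> enat 2"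
    have "submat np np {np k} {np l} (Hh t) = 0"
      using far by (intro Hh_structure) (simp add: numeral_eq_enat)
    then have "submat np np {np k} {np l} (Hh t) $ k $ l = 0" by simp
    then show False using nz by (simp add: submat_def)
  qed
  have H_norm: "norm (Hh t *v u) \<le> U * norm u" for u
    unfolding U_def Ups_hat_def by (rule banded_norm_le[OF undirected H_band A3(1) ball2])
  have G_norm: "norm (G *v u) \<le> U * norm u" for u
    unfolding U_def Ups_hat_def
    by (rule banded_norm_le[OF undirected banded_mono[OF G_band one_le_numeral] _ ball2])
      (simp add: G_def A3(3))
  have A1': "gamH * (norm u)\<^sup>2 \<le> u \<bullet> (Hh t *v u)" if "G *v u = 0" for u
    using A1 that unfolding G_def by blast
  have A2': "gamG * (norm y)\<^sup>2 \<le> (norm (transpose G *v y))\<^sup>2" for y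
  proof -
    have "y \<bullet> ((G ** transpose G) *v y) = (norm (transpose G *v y))\<^sup>2"
      unfolding matrix_vector_mul_assoc[symmetric] by (metis inner_transpose dot_square_norm)
    then show ?thesis using A2[of y t] unfolding G_def[symmetric] by (simp add: dot_square_norm)
  qed
  have newt: "newton_direction (Hh t) G ?p (c (x t)) (Dx t) (Dl t)"
    using newton[of t] by (simp add: G_def grad_l_L_eq)
  have mu': "4 * U\<^sup>2 / (gamG * gamH) \<le> mu" using mu_ge by (simp add: mu_hat_def U_def)
  \<comment> \<open>The locale assumptions do not mention \<open>W\<close>, so this one fact and the
    constants \<open>Y\<close> and \<open>g\<close> serve every subdomain.\<close>
  have sp: "subproblem E np nd (Hh t) G U gamH gamG mu"
    by unfold_locales (fact undirected Hh_sym H_band G_band H_norm G_norm U1 gamH gamG A1' A2' mu')+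
  define Y where "Y = subproblem.Y U mu"
  define g where "g = subproblem.g U gamH gamG mu"
  have Y_eq: "Y = Ups_K Ups pG mu"
    unfolding Y_def Ups_K_def U_def[symmetric] by (rule subproblem.Y_def[OF sp])
  have g_eq: "g = gam_K gamH gamG Ups pG mu"
    unfolding g_def gam_K_def Y_eq[symmetric] Y_def by (rule subproblem.g_def[OF sp])
  have gY: "0 < g" "g < Y"
    unfolding g_def Y_def by (rule subproblem.g_pos[OF sp], rule subproblem.g_less_Y[OF sp])
  define C where "C = ((Y\<^sup>2 - g\<^sup>2) / (Y\<^sup>2 + g\<^sup>2)) ^ (b div 4) * (Y / g)"
  define N where "N = poly pG (poly pW (real b)) * poly pG (real b + 2)"
  \<comment> \<open>Dropping the empty \<open>V l\<close> keeps the cover and makes the overlap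
    count independent of \<open>M\<close>.\<close>
  define L where "L = {l \<in> {1..M}. V l \<noteq> {}}"
  have C0: "0 \<le> C"
    unfolding C_def using gY
    by (intro mult_nonneg_nonneg zero_le_power divide_nonneg_nonneg) (auto intro: power_mono)
  have VW: "V l \<subseteq> W l" if "l \<in> {1..M}" for l
    using subset_closed_nbhd overlap[OF that] by (rule order_trans)
  have "norm (Dx t - Dxt t, Dl t - Dlt t) \<le> C * sqrt N * norm (Dx t, Dl t)"
  proof (rule assembled_error[where L = L and V = V and w = "w t" and z = "z t"
        and Z = "\<lambda>l. closed_nbhd E 2 (W l)"])
    show "finite L" by (simp add: L_def)
    have "(\<Union>l\<in>L. V l) = (\<Union>l\<in>{1..M}. V l)" unfolding L_def by blast
    then show "(\<Union>l\<in>L. V l) = UNIV" unfolding V_cover .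
    show "Dxt t $ k = w t l $ k" if "l \<in> L" "np k \<in> V l" for l k
      using that by (intro Dxt) (auto simp: L_def)
    show "Dlt t $ k = z t l $ k" if "l \<in> L" "nd k \<in> V l" for l k
      using that by (intro Dlt) (auto simp: L_def)
    show "norm (subvec np (V l) (Dx t - w t l), subvec nd (V l) (Dl t - z t l))
        \<le> C * norm (subvec np (closed_nbhd E 2 (W l)) (Dx t), subvec nd (closed_nbhd E 2 (W l)) (Dl t))"
      if "l \<in> L" for l
    proof -
      have l: "l \<in> {1..M}" using that by (simp add: L_def)
      show ?thesis unfolding C_def Y_def g_def
        by (rule subproblem.interior_error[OF sp subproblem[OF l, of t, folded G_def] newt overlap[OF l] b_ge])
    qed
    show "real (card {l \<in> L. i \<in> closed_nbhd E 2 (W l)}) \<le> N" for i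
      using card_overlap_le[OF A4 V_disjoint VW, of i] by (simp add: L_def N_def)
  qed (rule C0)
  also have "\<dots> \<le> delta_mu_b gamH gamG Ups pG pW mu b * norm (Dx t, Dl t)"
  proof (rule mult_right_mono)
    obtain i l where il: "l \<in> {1..M}" "i \<in> V l" using V_cover by blast
    have "1 \<le> poly pG (poly pW (real b))"
      using VW il by (intro one_le_poly_ball[OF A4 il(1)]) blast
    moreover have "0 \<le> poly pG (real b + 2)"
      using order_trans[OF of_nat_0_le_iff ball_bounds(1)[OF A4, of i "b + 2"]] by (simp add: add.commute)
    ultimately show "C * sqrt N \<le> delta_mu_b gamH gamG Ups pG pW mu b"
      unfolding C_def N_def delta_mu_b_def Ups_mu_b_def Ups_mu_def rho_mu_def Y_eq[symmetric] g_eq[symmetric]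
      by (rule decay_constant_le[OF gY])
  qed simp
  finally have err: "norm (Dx t - Dxt t, Dl t - Dlt t)
      \<le> delta_mu_b gamH gamG Ups pG pW mu b * norm (Dx t, Dl t)" .
  show "(grad_x_merit f c eta1 eta2 (x t) (lam t), grad_l_merit f c eta1 eta2 (x t) (lam t))
               \<bullet> (Dxt t, Dlt t)
           \<le> - (eta2 / 8) * (norm (grad_x_L f c (x t) (lam t), grad_l_L f c (x t) (lam t)))\<^sup>2
             - eta2 * gamG / 16 * (norm (Dx t, Dl t))\<^sup>2"
    unfolding grad_x_merit_eq[OF xT] grad_l_merit_eq[OF xT] grad_l_L_eq G_def[symmetric]
    by (rule merit_descent[OF Hh_sym H_norm Hs_norm G_norm U1 gamH gamG A1' A2' newt eta2_pos
          eta2_le[folded U_def] eta1_ge delta_le[folded U_def] err])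
qed

end
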